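(* Over $\mathsf{RCA}_0^\omega$ there is an explicit equivalence $\mathsf{UADS}\leftrightarrow(\mu^2)$, where $\mathsf{UADS}$ is the statement $$(\exists \Psi^{1\to 1})(\forall X^{1})\big[\mathrm{LO}_{\infty}(X) \to \big((\forall n^{0})\,\Psi(X)(n)<_{X} \Psi(X)(n+1)\ \vee\ (\forall m^{0})\,\Psi(X)(m)>_{X} \Psi(X)(m+1)\big)\big].$$
   Context: Types: $0$ is the type of natural numbers, $1=0\to 0$, $2=1\to 0$. Sets of naturals are type-1 objects given by binary characteristic functions. $\mathsf{RCA}_0^\omega$ is Kohlenbach's base theory $\mathsf{E}\text{-}\mathsf{PRA}^\omega+\mathsf{QF}\text{-}\mathsf{AC}^{1,0}$: $\mathsf{E}\text{-}\mathsf{PRA}^\omega$ is classical extensional primitive recursive arithmetic in all finite types (combinators, recursor for type 0 only, quantifier-free induction, and the full extensionality axiom), and $\mathsf{QF}\text{-}\mathsf{AC}^{1,0}$ is $(\forall f^1)(\exists n^0)\varphi_0(f,n)\to(\exists F^2)(\forall f^1)\varphi_0(f,F(f))$ for quantifier-free $\varphi_0$. $(\mu^2)$ is $(\exists\mu^2)(\forall f^1)[(\exists n^0)f(n)=0\to f(\mu(f))=0]$. $\mathrm{LO}_\infty(X)$ expresses that $X^1$ codes (as a set of pairs of naturals) a linear order whose field is infinite, i.e. not bounded by any number; $\le_X$ and $<_X$ are the order and strict order on $\mathrm{field}(X)$ coded by $X$. An implication $(\exists \Phi)A(\Phi)\to(\exists\Psi)B(\Psi)$ is explicit if there is a term $t$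 of the language such that additionally $(\forall\Phi)[A(\Phi)\to B(t(\Phi))]$ is provable. By convention the implication is still called explicit if $t$ takes as an additional argument an extensionality functional for $\Phi$, i.e. a functional $\Xi$ such that $(\forall k^0,f^1,g^1)[\overline f\,\Xi(f,g,k)=\overline g\,\Xi(f,g,k)\to\overline{\Phi(f)}k=\overline{\Phi(g)}k]$, where $\overline f n$ is the initial segment of $f$ of length $n$. An explicit equivalence is a provable equivalence both of whose implications are explicit. *)

theory Defs
  imports Main
begin

section \<open>Language\<close>

text \<open>The finite types; \<open>N\<close> is the type \<open>0\<close> of natural numbers.\<close>

datatype ty = N | Arr ty ty (infixr "\<Rrightarrow>" 65)

abbreviation ty1 :: ty where "ty1 \<equiv> N \<Rrightarrow> N"
abbreviation ty2 :: ty where "ty2 \<equiv> ty1 \<Rrightarrow> N"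
abbreviation ty11 :: ty where "ty11 \<equiv> ty1 \<Rrightarrow> ty1"

text \<open>
  Variables are de Bruijn indices \<^emph>\<open>counted separately for each type\<close>: \<open>Var \<rho> i\<close> is the
  variable of type \<open>\<rho>\<close> with index \<open>i\<close>, and a quantifier over type \<open>\<rho>\<close> binds (and shifts)
  indices of type \<open>\<rho>\<close> only.  So every variable carries its type, there are infinitely many
  variables of each type, and no typing context is needed.
  Terms are built by application from variables, zero, successor, the typed combinators
  \<open>CPi\<close> and \<open>CSigma\<close>, and the recursor \<open>Rec\<close> of type \<open>0\<close>.
\<close>

datatype tm =
    Var ty nat
  | Zero
  | Succ
  | CPi ty ty
  | CSigma ty ty ty
  | Rec
  | App tm tm (infixl "\<cdot>" 100)

primrec has_type :: "tm \<Rightarrow> ty \<Rightarrow> bool" where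
  "has_type (Var \<rho> i) \<sigma> \<longleftrightarrow> \<sigma> = \<rho>"
| "has_type Zero \<sigma> \<longleftrightarrow> \<sigma> = N"
| "has_type Succ \<sigma> \<longleftrightarrow> \<sigma> = N \<Rrightarrow> N"
| "has_type (CPi \<rho> \<tau>) \<sigma> \<longleftrightarrow> \<sigma> = \<rho> \<Rrightarrow> \<tau> \<Rrightarrow> \<rho>"
| "has_type (CSigma \<delta> \<rho> \<tau>) \<sigma> \<longleftrightarrow> \<sigma> = (\<delta> \<Rrightarrow> \<rho> \<Rrightarrow> \<tau>) \<Rrightarrow> (\<delta> \<Rrightarrow> \<rho>) \<Rrightarrow> \<delta> \<Rrightarrow> \<tau>"
| "has_type Rec \<sigma> \<longleftrightarrow> \<sigma> = N \<Rrightarrow> N \<Rrightarrow> (N \<Rrightarrow> N \<Rrightarrow> N) \<Rrightarrow> N"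
| "has_type (s \<cdot> t) \<sigma> \<longleftrightarrow> (\<exists>\<rho>. has_type s (\<rho> \<Rrightarrow> \<sigma>) \<and> has_type t \<rho>)"

primrec closed_tm :: "tm \<Rightarrow> bool" where
  "closed_tm (Var \<rho> i) \<longleftrightarrow> False"
| "closed_tm Zero \<longleftrightarrow> True"
| "closed_tm Succ \<longleftrightarrow> True"
| "closed_tm (CPi \<rho> \<tau>) \<longleftrightarrow> True"
| "closed_tm (CSigma \<delta> \<rho> \<tau>) \<longleftrightarrow> True"
| "closed_tm Rec \<longleftrightarrow> True"
| "closed_tm (s \<cdot> t) \<longleftrightarrow> closed_tm s \<and> closed_tm t"

text \<open>Equality of type-\<open>0\<close> objects is the only primitive predicate.\<close>

datatype fm =
    Eq tm tm (infix "\<^bold>=" 60)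
  | Falsum
  | Imp fm fm (infixr "\<^bold>\<longrightarrow>" 54)
  | Forall ty fm

text \<open>The logic is classical, so the remaining connectives are abbreviations.\<close>

abbreviation Neg :: "fm \<Rightarrow> fm" ("\<^bold>\<not> _" [58] 58) where
  "\<^bold>\<not> \<phi> \<equiv> \<phi> \<^bold>\<longrightarrow> Falsum"
abbreviation Conj :: "fm \<Rightarrow> fm \<Rightarrow> fm" (infixr "\<^bold>\<and>" 56) where
  "\<phi> \<^bold>\<and> \<psi> \<equiv> \<^bold>\<not> (\<phi> \<^bold>\<longrightarrow> \<^bold>\<not> \<psi>)"
abbreviation Disj :: "fm \<Rightarrow> fm \<Rightarrow> fm" (infixr "\<^bold>\<or>" 55) where
  "\<phi> \<^bold>\<or> \<psi> \<equiv> \<^bold>\<not> \<phi> \<^bold>\<longrightarrow> \<psi>"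
abbreviation Iff :: "fm \<Rightarrow> fm \<Rightarrow> fm" (infix "\<^bold>\<longleftrightarrow>" 53) where
  "\<phi> \<^bold>\<longleftrightarrow> \<psi> \<equiv> (\<phi> \<^bold>\<longrightarrow> \<psi>) \<^bold>\<and> (\<psi> \<^bold>\<longrightarrow> \<phi>)"
abbreviation Exists :: "ty \<Rightarrow> fm \<Rightarrow> fm" where
  "Exists \<rho> \<phi> \<equiv> \<^bold>\<not> (Forall \<rho> (\<^bold>\<not> \<phi>))"

primrec wff :: "fm \<Rightarrow> bool" where
  "wff (s \<^bold>= t) \<longleftrightarrow> has_type s N \<and> has_type t N"
| "wff Falsum \<longleftrightarrow> True"
| "wff (\<phi> \<^bold>\<longrightarrow> \<psi>) \<longleftrightarrow> wff \<phi> \<and> wff \<psi>"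
| "wff (Forall \<rho> \<phi>) \<longleftrightarrow> wff \<phi>"

primrec qfree :: "fm \<Rightarrow> bool" where
  "qfree (s \<^bold>= t) \<longleftrightarrow> True"
| "qfree Falsum \<longleftrightarrow> True"
| "qfree (\<phi> \<^bold>\<longrightarrow> \<psi>) \<longleftrightarrow> qfree \<phi> \<and> qfree \<psi>"
| "qfree (Forall \<rho> \<phi>) \<longleftrightarrow> False"

section \<open>Substitution\<close>

text \<open>Simultaneous substitution of \<open>\<theta> \<rho> i\<close> for each variable \<open>Var \<rho> i\<close>.\<close>

primrec subst_tm :: "(ty \<Rightarrow> nat \<Rightarrow> tm) \<Rightarrow> tm \<Rightarrow> tm" where
  "subst_tm \<theta> (Var \<rho> i) = \<theta> \<rho> i"
| "subst_tm \<theta> Zero = Zero"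
| "subst_tm \<theta> Succ = Succ"
| "subst_tm \<theta> (CPi \<rho> \<tau>) = CPi \<rho> \<tau>"
| "subst_tm \<theta> (CSigma \<delta> \<rho> \<tau>) = CSigma \<delta> \<rho> \<tau>"
| "subst_tm \<theta> Rec = Rec"
| "subst_tm \<theta> (s \<cdot> t) = subst_tm \<theta> s \<cdot> subst_tm \<theta> t"

definition shift :: "ty \<Rightarrow> ty \<Rightarrow> nat \<Rightarrow> tm" where
  "shift \<rho> \<sigma> i = Var \<sigma> (if \<sigma> = \<rho> then Suc i else i)"

abbreviation lift_tm :: "ty \<Rightarrow> tm \<Rightarrow> tm" where
  "lift_tm \<rho> \<equiv> subst_tm (shift \<rho>)"

text \<open>\<open>under \<rho> \<theta>\<close> is \<open>\<theta>\<close> as it acts below a quantifier over type \<open>\<rho>\<close>.\<close>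

definition under :: "ty \<Rightarrow> (ty \<Rightarrow> nat \<Rightarrow> tm) \<Rightarrow> ty \<Rightarrow> nat \<Rightarrow> tm" where
  "under \<rho> \<theta> \<sigma> i =
     (if \<sigma> = \<rho> then (case i of 0 \<Rightarrow> Var \<rho> 0 | Suc j \<Rightarrow> lift_tm \<rho> (\<theta> \<rho> j))
      else lift_tm \<rho> (\<theta> \<sigma> i))"

primrec subst :: "(ty \<Rightarrow> nat \<Rightarrow> tm) \<Rightarrow> fm \<Rightarrow> fm" where
  "subst \<theta> (s \<^bold>= t) = (subst_tm \<theta> s \<^bold>= subst_tm \<theta> t)"
| "subst \<theta> Falsum = Falsum"
| "subst \<theta> (\<phi> \<^bold>\<longrightarrow> \<psi>) = (subst \<theta> \<phi> \<^bold>\<longrightarrow> subst \<theta> \<psi>)"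
| "subst \<theta> (Forall \<rho> \<phi>) = Forall \<rho> (subst (under \<rho> \<theta>) \<phi>)"

abbreviation lift :: "ty \<Rightarrow> fm \<Rightarrow> fm" where
  "lift \<rho> \<equiv> subst (shift \<rho>)"

text \<open>\<open>inst \<rho> s\<close> replaces \<open>Var \<rho> 0\<close> by \<open>s\<close> and lowers the other indices of type \<open>\<rho>\<close>.\<close>

definition inst :: "ty \<Rightarrow> tm \<Rightarrow> ty \<Rightarrow> nat \<Rightarrow> tm" where
  "inst \<rho> s \<sigma> i =
     (if \<sigma> = \<rho> then (case i of 0 \<Rightarrow> s | Suc j \<Rightarrow> Var \<rho> j) else Var \<sigma> i)"

section \<open>Classical many-sorted logic with equality at type \<open>0\<close>\<close>

text \<open>
  \<open>derivable T H \<phi>\<close>: natural deduction of \<open>\<phi>\<close> from the assumptions \<open>H\<close> and the axioms \<open>T\<close>.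
  Free variables of a formula in \<open>T\<close> are read universally, those of a formula in \<open>H\<close> are
  parameters; hence only \<open>H\<close> is lifted in the rule \<open>ForallI\<close>.
\<close>

inductive derivable :: "fm set \<Rightarrow> fm set \<Rightarrow> fm \<Rightarrow> bool" for T where
  Axiom: "\<phi> \<in> T \<Longrightarrow> wff \<phi> \<Longrightarrow> derivable T H \<phi>"
| Assume: "\<phi> \<in> H \<Longrightarrow> wff \<phi> \<Longrightarrow> derivable T H \<phi>"
| ImpI: "wff \<phi> \<Longrightarrow> derivable T (insert \<phi> H) \<psi> \<Longrightarrow> derivable T H (\<phi> \<^bold>\<longrightarrow> \<psi>)"
| ImpE: "derivable T H (\<phi> \<^bold>\<longrightarrow> \<psi>) \<Longrightarrow> derivable T H \<phi> \<Longrightarrow> derivable T H \<psi>"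
| RAA: "wff \<phi> \<Longrightarrow> derivable T (insert (\<^bold>\<not> \<phi>) H) Falsum \<Longrightarrow> derivable T H \<phi>"
| ForallI: "derivable T (lift \<rho> ` H) \<phi> \<Longrightarrow> derivable T H (Forall \<rho> \<phi>)"
| ForallE: "derivable T H (Forall \<rho> \<phi>) \<Longrightarrow> has_type t \<rho> \<Longrightarrow> derivable T H (subst (inst \<rho> t) \<phi>)"
| EqRefl: "has_type t N \<Longrightarrow> derivable T H (t \<^bold>= t)"
| EqSubst: "wff \<phi> \<Longrightarrow> derivable T H (s \<^bold>= t) \<Longrightarrow> derivable T H (subst (inst N s) \<phi>) \<Longrightarrow>
            derivable T H (subst (inst N t) \<phi>)"

abbreviation provable :: "fm set \<Rightarrow> fm \<Rightarrow> bool" where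
  "provable T \<phi> \<equiv> derivable T {} \<phi>"

section \<open>The theory \<open>RCA\<^sub>0\<^sup>\<omega>\<close>\<close>

text \<open>Equality at higher types is the usual abbreviation for pointwise equality.\<close>

primrec eq_at :: "ty \<Rightarrow> tm \<Rightarrow> tm \<Rightarrow> fm" where
  "eq_at N s t = (s \<^bold>= t)"
| "eq_at (\<rho> \<Rrightarrow> \<tau>) s t =
     Forall \<rho> (eq_at \<tau> (lift_tm \<rho> s \<cdot> Var \<rho> 0) (lift_tm \<rho> t \<cdot> Var \<rho> 0))"

text \<open>
  In \<open>QF_IND\<close> the induction variable is \<open>Var N 0\<close>.  In \<open>QF_AC\<close> the formula \<open>\<phi>\<close> has \<open>f\<close> as
  \<open>Var ty1 0\<close> and \<open>n\<close> as \<open>Var N 0\<close>; in the conclusion the new variable \<open>F\<close> is \<open>Var ty2 0\<close>, and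
  \<open>\<phi>\<close> is lifted past it.  All other variables of \<open>\<phi>\<close>, of any type, are parameters.
\<close>

inductive_set RCA0w :: "fm set" where
  Succ_nonzero: "has_type t N \<Longrightarrow> \<^bold>\<not> (Succ \<cdot> t \<^bold>= Zero) \<in> RCA0w"
| Succ_inject: "has_type s N \<Longrightarrow> has_type t N \<Longrightarrow>
    (Succ \<cdot> s \<^bold>= Succ \<cdot> t \<^bold>\<longrightarrow> s \<^bold>= t) \<in> RCA0w"
| CPi_eq: "has_type s \<rho> \<Longrightarrow> has_type t \<tau> \<Longrightarrow> eq_at \<rho> (CPi \<rho> \<tau> \<cdot> s \<cdot> t) s \<in> RCA0w"
| CSigma_eq: "has_type r (\<delta> \<Rrightarrow> \<rho> \<Rrightarrow> \<tau>) \<Longrightarrow> has_type s (\<delta> \<Rrightarrow> \<rho>) \<Longrightarrow> has_type t \<delta> \<Longrightarrow>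
    eq_at \<tau> (CSigma \<delta> \<rho> \<tau> \<cdot> r \<cdot> s \<cdot> t) (r \<cdot> t \<cdot> (s \<cdot> t)) \<in> RCA0w"
| Rec_Zero: "has_type s N \<Longrightarrow> has_type t (N \<Rrightarrow> N \<Rrightarrow> N) \<Longrightarrow>
    (Rec \<cdot> Zero \<cdot> s \<cdot> t \<^bold>= s) \<in> RCA0w"
| Rec_Succ: "has_type r N \<Longrightarrow> has_type s N \<Longrightarrow> has_type t (N \<Rrightarrow> N \<Rrightarrow> N) \<Longrightarrow>
    (Rec \<cdot> (Succ \<cdot> r) \<cdot> s \<cdot> t \<^bold>= t \<cdot> (Rec \<cdot> r \<cdot> s \<cdot> t) \<cdot> r) \<in> RCA0w"
| Extensionality: "has_type s \<rho> \<Longrightarrow> has_type t \<rho> \<Longrightarrow> has_type r (\<rho> \<Rrightarrow> \<tau>) \<Longrightarrow>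
    (eq_at \<rho> s t \<^bold>\<longrightarrow> eq_at \<tau> (r \<cdot> s) (r \<cdot> t)) \<in> RCA0w"
| QF_IND: "qfree \<phi> \<Longrightarrow> wff \<phi> \<Longrightarrow>
    (subst (inst N Zero) \<phi> \<^bold>\<longrightarrow>
     Forall N (\<phi> \<^bold>\<longrightarrow>
       subst (\<lambda>\<sigma> i. if \<sigma> = N \<and> i = 0 then Succ \<cdot> Var N 0 else Var \<sigma> i) \<phi>) \<^bold>\<longrightarrow>
     Forall N \<phi>) \<in> RCA0w"
| QF_AC: "qfree \<phi> \<Longrightarrow> wff \<phi> \<Longrightarrow>
    (Forall ty1 (Exists N \<phi>) \<^bold>\<longrightarrow>
     Exists ty2 (Forall ty1 (subst (inst N (Var ty2 0 \<cdot> Var ty1 0)) (lift ty2 \<phi>)))) \<in> RCA0w"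

section \<open>Coding of pairs\<close>

text \<open>\<open>\<lambda>u v. u + 1\<close>\<close>

definition suc_step :: tm where
  "suc_step = CSigma N N (N \<Rrightarrow> N) \<cdot> (CPi (N \<Rrightarrow> N \<Rrightarrow> N) N \<cdot> CPi N N) \<cdot> Succ"

text \<open>\<open>s + t\<close>, by recursion on \<open>t\<close>\<close>

definition add :: "tm \<Rightarrow> tm \<Rightarrow> tm" where
  "add s t = Rec \<cdot> t \<cdot> s \<cdot> suc_step"

text \<open>
  \<open>\<lambda>u v. Rec u v suc_step\<close>, which is \<open>\<lambda>u v. v + u\<close>, obtained as
  \<open>\<lambda>u. \<Sigma> (Rec u) (\<Pi> suc_step)\<close>
\<close>

definition add_step :: tm where
  "add_step =
     (let A = N \<Rrightarrow> N \<Rrightarrow> N in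
      CSigma N (N \<Rrightarrow> A) (N \<Rrightarrow> N)
      \<cdot> (CSigma N (N \<Rrightarrow> A \<Rrightarrow> N) ((N \<Rrightarrow> A) \<Rrightarrow> N \<Rrightarrow> N)
         \<cdot> (CPi ((N \<Rrightarrow> A \<Rrightarrow> N) \<Rrightarrow> (N \<Rrightarrow> A) \<Rrightarrow> N \<Rrightarrow> N) N \<cdot> CSigma N A N)
         \<cdot> Rec)
      \<cdot> (CPi (N \<Rrightarrow> A) N \<cdot> (CPi A N \<cdot> suc_step)))"

text \<open>\<open>sum_below t\<close> is \<open>0 + 1 + \<dots> + (t - 1)\<close>, so \<open>pair s t\<close> is Cantor's bijective pairing
  \<open>(s + t) (s + t + 1) / 2 + s\<close>.\<close>

definition sum_below :: "tm \<Rightarrow> tm" where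
  "sum_below t = Rec \<cdot> t \<cdot> Zero \<cdot> add_step"

definition pair :: "tm \<Rightarrow> tm \<Rightarrow> tm" where
  "pair s t = add (sum_below (Succ \<cdot> add s t)) s"

definition less :: "tm \<Rightarrow> tm \<Rightarrow> fm" where
  "less s t = Exists N (add (lift_tm N s) (Succ \<cdot> Var N 0) \<^bold>= lift_tm N t)"

section \<open>Linear orders, \<open>UADS\<close> and \<open>(\<mu>\<^sup>2)\<close>\<close>

text \<open>A number \<open>n\<close> belongs to the set with characteristic function \<open>X\<close> iff \<open>X n = 1\<close>.\<close>

definition mem :: "tm \<Rightarrow> tm \<Rightarrow> fm" where
  "mem n X = (X \<cdot> n \<^bold>= Succ \<cdot> Zero)"

definition le_in :: "tm \<Rightarrow> tm \<Rightarrow> tm \<Rightarrow> fm" where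
  "le_in X i j = mem (pair i j) X"

definition less_in :: "tm \<Rightarrow> tm \<Rightarrow> tm \<Rightarrow> fm" where
  "less_in X i j = (le_in X i j \<^bold>\<and> \<^bold>\<not> le_in X j i)"

definition in_field :: "tm \<Rightarrow> tm \<Rightarrow> fm" where
  "in_field X i = le_in X i i"

text \<open>\<open>X\<close> is \<open>Var ty1 0\<close>.\<close>

definition LO_inf :: fm where
  "LO_inf =
     (let X = Var ty1 0; n0 = Var N 0; n1 = Var N 1; n2 = Var N 2 in
      \<comment> \<open>\<open>X\<close> is a set\<close>
      Forall N (X \<cdot> n0 \<^bold>= Zero \<^bold>\<or> X \<cdot> n0 \<^bold>= Succ \<cdot> Zero)
      \<comment> \<open>reflexive on its field\<close>
      \<^bold>\<and> Forall N (Forall N (le_in X n1 n0 \<^bold>\<longrightarrow> in_field X n1 \<^bold>\<and> in_field X n0))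
      \<comment> \<open>antisymmetric\<close>
      \<^bold>\<and> Forall N (Forall N (le_in X n1 n0 \<^bold>\<and> le_in X n0 n1 \<^bold>\<longrightarrow> n1 \<^bold>= n0))
      \<comment> \<open>transitive\<close>
      \<^bold>\<and> Forall N (Forall N (Forall N
          (le_in X n2 n1 \<^bold>\<and> le_in X n1 n0 \<^bold>\<longrightarrow> le_in X n2 n0)))
      \<comment> \<open>total\<close>
      \<^bold>\<and> Forall N (Forall N
          (in_field X n1 \<^bold>\<and> in_field X n0 \<^bold>\<longrightarrow> le_in X n1 n0 \<^bold>\<or> le_in X n0 n1))
      \<comment> \<open>the field is unbounded\<close>
      \<^bold>\<and> Forall N (Exists N (less n1 n0 \<^bold>\<and> in_field X n0)))"

text \<open>\<open>UADS\<close> is \<open>Exists ty11 UADS_matrix\<close>, with \<open>\<Psi>\<close> as \<open>Var ty11 0\<close>.\<close>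

definition UADS_matrix :: fm where
  "UADS_matrix =
     (let \<Psi> = Var ty11 0; X = Var ty1 0; n = Var N 0 in
      Forall ty1 (LO_inf \<^bold>\<longrightarrow>
        Forall N (less_in X (\<Psi> \<cdot> X \<cdot> n) (\<Psi> \<cdot> X \<cdot> (Succ \<cdot> n)))
        \<^bold>\<or> Forall N (less_in X (\<Psi> \<cdot> X \<cdot> (Succ \<cdot> n)) (\<Psi> \<cdot> X \<cdot> n))))"

text \<open>\<open>(\<mu>\<^sup>2)\<close> is \<open>Exists ty2 mu_matrix\<close>, with \<open>\<mu>\<close> as \<open>Var ty2 0\<close>.\<close>

definition mu_matrix :: fm where
  "mu_matrix =
     (let \<mu> = Var ty2 0; f = Var ty1 0 in
      Forall ty1 (Exists N (f \<cdot> Var N 0 \<^bold>= Zero) \<^bold>\<longrightarrow> f \<cdot> (\<mu> \<cdot> f) \<^bold>= Zero))"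

section \<open>Explicit implications and equivalences\<close>

text \<open>Equality of the initial segments of \<open>f\<close> and \<open>g\<close> of length \<open>n\<close>.\<close>

definition same_initial :: "tm \<Rightarrow> tm \<Rightarrow> tm \<Rightarrow> fm" where
  "same_initial f g n =
     Forall N (less (Var N 0) (lift_tm N n) \<^bold>\<longrightarrow>
               lift_tm N f \<cdot> Var N 0 \<^bold>= lift_tm N g \<cdot> Var N 0)"

abbreviation ext_ty :: ty where "ext_ty \<equiv> ty1 \<Rrightarrow> ty1 \<Rrightarrow> N \<Rrightarrow> N"

text \<open>\<open>\<Xi>\<close> (\<open>Var ext_ty 0\<close>) is an extensionality functional for \<open>\<Phi>\<close> (\<open>Var ty11 0\<close>).\<close>

definition ext_functional :: fm where
  "ext_functional =
     (let \<Phi> = Var ty11 0; \<Xi> = Var ext_ty 0; k = Var N 0; f = Var ty1 1; g = Var ty1 0 in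
      Forall N (Forall ty1 (Forall ty1
        (same_initial f g (\<Xi> \<cdot> f \<cdot> g \<cdot> k) \<^bold>\<longrightarrow> same_initial (\<Phi> \<cdot> f) (\<Phi> \<cdot> g) k))))"

text \<open>
  \<open>explicit_imp T \<rho> A \<sigma> B\<close>: the implication \<open>(\<exists>\<Phi>) A(\<Phi>) \<longrightarrow> (\<exists>\<Psi>) B(\<Psi>)\<close> is provable in \<open>T\<close> and
  explicit, where \<open>\<Phi>\<close> is \<open>Var \<rho> 0\<close>, \<open>\<Psi>\<close> is \<open>Var \<sigma> 0\<close>, and \<open>A\<close>, \<open>B\<close> have no other free variables.
  Extensionality functionals are defined for \<open>\<Phi>\<close> of type \<open>1 \<rightarrow> 1\<close>, so only for such \<open>\<Phi>\<close> may
  the term take one as a further argument.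
\<close>

definition explicit_imp :: "fm set \<Rightarrow> ty \<Rightarrow> fm \<Rightarrow> ty \<Rightarrow> fm \<Rightarrow> bool" where
  "explicit_imp T \<rho> A \<sigma> B \<longleftrightarrow>
     provable T (Exists \<rho> A \<^bold>\<longrightarrow> Exists \<sigma> B) \<and>
     ((\<exists>t. closed_tm t \<and> has_type t (\<rho> \<Rrightarrow> \<sigma>) \<and>
           provable T (Forall \<rho> (A \<^bold>\<longrightarrow> subst (inst \<sigma> (t \<cdot> Var \<rho> 0)) B))) \<or>
      (\<rho> = ty11 \<and>
       (\<exists>t. closed_tm t \<and> has_type t (\<rho> \<Rrightarrow> ext_ty \<Rrightarrow> \<sigma>) \<and>
            provable T (Forall \<rho> (Forall ext_ty
              (ext_functional \<^bold>\<longrightarrow> A \<^bold>\<longrightarrow>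
               subst (inst \<sigma> (t \<cdot> Var \<rho> 0 \<cdot> Var ext_ty 0)) B))))))"

definition explicit_equiv :: "fm set \<Rightarrow> ty \<Rightarrow> fm \<Rightarrow> ty \<Rightarrow> fm \<Rightarrow> bool" where
  "explicit_equiv T \<rho> A \<sigma> B \<longleftrightarrow>
     provable T (Exists \<rho> A \<^bold>\<longleftrightarrow> Exists \<sigma> B) \<and>
     explicit_imp T \<rho> A \<sigma> B \<and> explicit_imp T \<sigma> B \<rho> A"

end

theory Submission
  imports Defs "HOL-Library.Countable"
begin

text \<open>
  The calculus is complete for extensional term models (Henkin), so both implications may be argued in
  an arbitrary, possibly nonstandard, model, where induction and choice hold for quantifier-free predicates.

  From \<open>\<mu>\<close> to \<open>\<Psi>\<close>: call an element of the field of \<open>X\<close> a peak if no numerically larger element is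
  \<open>X\<close>-above it.  With \<open>\<mu>\<close> one decides whether the peaks are unbounded.  If so, they form an \<open>X\<close>-descending
  sequence; if not, one can ascend forever from any element past the last peak.

  From \<open>\<Psi>\<close> to \<open>\<mu>\<close>: a function \<open>f\<close> determines an order which is \<open>\<omega>\<close> if \<open>f\<close> has no zero and \<open>n + \<omega>\<^sup>*\<close> if \<open>n\<close>
  is its least zero, and which agrees with \<open>\<omega>\<close> on numbers below \<open>n\<close>.  As \<open>\<Psi>\<close> must ascend on the former
  and descend on the latter, its first two values on the two orders differ unless the second value is at
  least \<open>n\<close>; and if they differ, an extensionality functional for \<open>\<Psi>\<close> bounds \<open>n\<close>.  Either way a bounded
  search finds a zero.  Without an extensionality functional, quantifier-free choice supplies a point at
  which the two orders differ.
\<close>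

subsection \<open>Substitution\<close>

text \<open>Explicitness asks for closed combinator terms. Deriving their equations inside the
  calculus would be unmanageable; in a model they are simply evaluated. The price is that a model
  may be nonstandard: well-foundedness and least-number arguments have to become inductions on
  equations with parameters, which is why truth values, comparison and bounded search are all coded
  by terms. One call of \<open>\<mu>\<close> removes one existential quantifier. That the peaks are
  bounded is an exists-forall-exists statement, hence three nested calls. In the converse,
  \<open>\<Psi>\<close> is applied only to two orders. In each of them a sequence in the wrong
  direction would yield a numerically descending sequence of the model, and quantifier-free
  induction refutes that. An extensionality functional gives a modulus by evaluation and so a closed
  term. The extensionality axiom only says that some point of difference exists for each
  \<open>f\<close>. Since \<open>\<omega>\<close> is fixed, this point depends on one function
  argument, which is the form that the choice axiom handles; the chosen functional is then a
  parameter, so this route gives the plain implication.\<close>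

lemma subst_tm_comp: "subst_tm \<theta> (subst_tm \<eta> t) = subst_tm (\<lambda>\<sigma> i. subst_tm \<theta> (\<eta> \<sigma> i)) t"
  by (induction t) auto

lemma subst_tm_under_lift: "subst_tm (under \<rho> \<theta>) (lift_tm \<rho> t) = lift_tm \<rho> (subst_tm \<theta> t)"
  unfolding subst_tm_comp by (rule arg_cong[where f = "\<lambda>\<theta>. subst_tm \<theta> t"]) (auto simp: shift_def under_def fun_eq_iff)

lemma under_comp:
  "(\<lambda>\<sigma> i. subst_tm (under \<rho> \<theta>) (under \<rho> \<eta> \<sigma> i)) = under \<rho> (\<lambda>\<sigma> i. subst_tm \<theta> (\<eta> \<sigma> i))"
  by (intro ext) (simp add: under_def[of \<rho> \<eta>] under_def[of \<rho> "\<lambda>\<sigma> i. subst_tm \<theta> (\<eta> \<sigma> i)"]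
      subst_tm_under_lift split: nat.split, simp add: under_def)

lemma subst_comp: "subst \<theta> (subst \<eta> \<phi>) = subst (\<lambda>\<sigma> i. subst_tm \<theta> (\<eta> \<sigma> i)) \<phi>"
  by (induction \<phi> arbitrary: \<theta> \<eta>) (auto simp: subst_tm_comp under_comp)

lemma subst_tm_Var: "subst_tm Var t = t"
  by (induction t) auto

lemma under_Var: "under \<rho> Var = Var"
  by (auto simp: under_def fun_eq_iff shift_def split: nat.split)

lemma subst_Var: "subst Var \<phi> = \<phi>"
  by (induction \<phi>) (auto simp: subst_tm_Var under_Var)

lemma subst_tm_inst_lift: "subst_tm (inst \<rho> s) (lift_tm \<rho> t) = t"
proof -
  have "(\<lambda>\<sigma> i. subst_tm (inst \<rho> s) (shift \<rho> \<sigma> i)) = Var"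
    by (auto simp: fun_eq_iff shift_def inst_def)
  then show ?thesis by (simp add: subst_tm_comp subst_tm_Var)
qed

text \<open>Polymorphic in the entries because it extends substitutions by a term and environments
  by a value; \<open>sat_cls\<close> relies on the two uses matching.\<close>

definition cons_subst :: "ty \<Rightarrow> 'a \<Rightarrow> (ty \<Rightarrow> nat \<Rightarrow> 'a) \<Rightarrow> ty \<Rightarrow> nat \<Rightarrow> 'a" where
  "cons_subst \<rho> s \<theta> \<sigma> i = (if \<sigma> = \<rho> then (case i of 0 \<Rightarrow> s | Suc j \<Rightarrow> \<theta> \<rho> j) else \<theta> \<sigma> i)"

lemma subst_inst_under: "subst (inst \<rho> s) (subst (under \<rho> \<theta>) \<phi>) = subst (cons_subst \<rho> s \<theta>) \<phi>"
  unfolding subst_comp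
  by (rule arg_cong[where f = "\<lambda>\<theta>. subst \<theta> \<phi>"])
    (auto simp: fun_eq_iff under_def cons_subst_def subst_tm_inst_lift inst_def split: nat.split)

lemma subst_inst: "subst \<theta> (subst (inst \<rho> s) \<phi>) = subst (inst \<rho> (subst_tm \<theta> s)) (subst (under \<rho> \<theta>) \<phi>)"
  unfolding subst_inst_under unfolding subst_comp
  by (rule arg_cong[where f = "\<lambda>\<theta>. subst \<theta> \<phi>"])
    (auto simp: fun_eq_iff cons_subst_def inst_def split: nat.split)

lemma subst_lift: "subst (under \<rho> \<theta>) (lift \<rho> \<phi>) = lift \<rho> (subst \<theta> \<phi>)"
  unfolding subst_comp
  by (rule arg_cong[where f = "\<lambda>\<theta>. subst \<theta> \<phi>"]) (auto simp: fun_eq_iff shift_def under_def)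

lemma subst_eq_at: "subst \<theta> (eq_at \<rho> s t) = eq_at \<rho> (subst_tm \<theta> s) (subst_tm \<theta> t)"
  by (induction \<rho> arbitrary: \<theta> s t) (auto simp: subst_tm_under_lift, simp_all add: under_def)

section \<open>Typing under substitution, and bounds on the indices in use\<close>

definition wt_subst :: "(ty \<Rightarrow> nat \<Rightarrow> tm) \<Rightarrow> bool" where
  "wt_subst \<theta> \<longleftrightarrow> (\<forall>\<sigma> i. has_type (\<theta> \<sigma> i) \<sigma>)"

lemma has_type_unique: "has_type t \<sigma> \<Longrightarrow> has_type t \<tau> \<Longrightarrow> \<sigma> = \<tau>"
proof (induction t arbitrary: \<sigma> \<tau>)
  case (App s t)
  then show ?case by (metis has_type.simps(7) ty.inject)
qed auto

lemma has_type_subst: "wt_subst \<theta> \<Longrightarrow> has_type t \<tau> \<Longrightarrow> has_type (subst_tm \<theta> t) \<tau>"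
  by (induction t arbitrary: \<tau>) (auto simp: wt_subst_def)

lemma wt_shift: "wt_subst (shift \<rho>)"
  by (auto simp: wt_subst_def shift_def)

lemma wt_under: "wt_subst \<theta> \<Longrightarrow> wt_subst (under \<rho> \<theta>)"
  by (auto simp: wt_subst_def under_def split: nat.split intro!: has_type_subst wt_shift)

lemma wt_inst: "has_type s \<rho> \<Longrightarrow> wt_subst (inst \<rho> s)"
  by (auto simp: wt_subst_def inst_def split: nat.split)

lemma wt_cons: "has_type s \<rho> \<Longrightarrow> wt_subst \<theta> \<Longrightarrow> wt_subst (cons_subst \<rho> s \<theta>)"
  by (auto simp: wt_subst_def cons_subst_def split: nat.split)

lemma wff_subst: "wt_subst \<theta> \<Longrightarrow> wff \<phi> \<Longrightarrow> wff (subst \<theta> \<phi>)"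
  by (induction \<phi> arbitrary: \<theta>) (auto simp: has_type_subst wt_under)

lemma qfree_subst: "qfree (subst \<theta> \<phi>) = qfree \<phi>"
  by (induction \<phi> arbitrary: \<theta>) auto

lemma wff_eq_at: "has_type s \<rho> \<Longrightarrow> has_type t \<rho> \<Longrightarrow> wff (eq_at \<rho> s t)"
proof (induction \<rho> arbitrary: s t)
  case (Arr \<rho> \<tau>)
  then show ?case using has_type_subst[OF wt_shift, of _ _ \<rho>] by (auto intro!: Arr.IH(2))
qed auto

text \<open>These bound the free indices of all types; bound indices are counted too, which only enlarges the bound.\<close>

primrec bound_tm :: "tm \<Rightarrow> nat" where
  "bound_tm (Var \<rho> i) = Suc i"
| "bound_tm Zero = 0"
| "bound_tm Succ = 0"
| "bound_tm (CPi \<rho> \<tau>) = 0"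
| "bound_tm (CSigma \<delta> \<rho> \<tau>) = 0"
| "bound_tm Rec = 0"
| "bound_tm (s \<cdot> t) = max (bound_tm s) (bound_tm t)"

primrec bound_fm :: "fm \<Rightarrow> nat" where
  "bound_fm (s \<^bold>= t) = max (bound_tm s) (bound_tm t)"
| "bound_fm Falsum = 0"
| "bound_fm (\<phi> \<^bold>\<longrightarrow> \<psi>) = max (bound_fm \<phi>) (bound_fm \<psi>)"
| "bound_fm (Forall \<rho> \<phi>) = bound_fm \<phi>"

lemma subst_tm_cong: "(\<And>\<sigma> i. i < bound_tm t \<Longrightarrow> \<theta> \<sigma> i = \<eta> \<sigma> i) \<Longrightarrow> subst_tm \<theta> t = subst_tm \<eta> t"
  by (induction t) auto

lemma subst_cong: "(\<And>\<sigma> i. i < bound_fm \<phi> \<Longrightarrow> \<theta> \<sigma> i = \<eta> \<sigma> i) \<Longrightarrow> subst \<theta> \<phi> = subst \<eta> \<phi>"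
proof (induction \<phi> arbitrary: \<theta> \<eta>)
  case (Eq s t)
  then show ?case by (auto intro!: subst_tm_cong)
next
  case (Forall \<rho> \<phi>)
  have "subst (under \<rho> \<theta>) \<phi> = subst (under \<rho> \<eta>) \<phi>"
    by (rule Forall.IH) (use Forall.prems in \<open>auto simp: under_def split: nat.split\<close>)
  then show ?case by simp
next
  case (Imp \<phi> \<psi>)
  from Imp.IH(1)[of \<theta> \<eta>] Imp.IH(2)[of \<theta> \<eta>] Imp.prems show ?case by simp
qed auto

subsection \<open>Derivations\<close>

lemma derivable_wff: "derivable T H \<phi> \<Longrightarrow> wff \<phi>"
  by (induction rule: derivable.induct) (auto intro!: wff_subst wt_inst)

lemma derivable_mono: "derivable T H \<phi> \<Longrightarrow> H \<subseteq> H' \<Longrightarrow> derivable T H' \<phi>"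
proof (induction arbitrary: H' rule: derivable.induct)
  case (ImpI \<phi> H \<psi>)
  then show ?case by (meson derivable.ImpI insert_mono)
next
  case (RAA \<phi> H)
  then show ?case by (meson derivable.RAA insert_mono)
next
  case (ForallI \<rho> H \<phi>)
  then show ?case by (meson derivable.ForallI image_mono)
next
  case (Assume \<phi> H)
  then show ?case by (auto intro: derivable.Assume)
next
  case (ImpE H \<phi> \<psi>)
  then show ?case by (meson derivable.ImpE)
next
  case (ForallE H \<rho> \<phi> t)
  then show ?case by (meson derivable.ForallE)
next
  case (EqSubst \<phi> H s t)
  then show ?case by (meson derivable.EqSubst)
next
  case (Axiom \<phi> H)
  then show ?case by (simp add: derivable.Axiom)
next
  case (EqRefl t H)
  then show ?case by (simp add: derivable.EqRefl)
qed

text \<open>Free variables of axioms are read universally, so an instance of an axiom must again be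
  an axiom; this is the closure hypothesis on \<open>T\<close>. Well-typedness of the substitution
  preserves the \<open>wff\<close> side conditions.\<close>

lemma derivable_subst:
  assumes "derivable T H \<phi>" and "wt_subst \<theta>"
    and T: "\<And>\<phi> \<theta>. \<phi> \<in> T \<Longrightarrow> wt_subst \<theta> \<Longrightarrow> subst \<theta> \<phi> \<in> T"
  shows "derivable T (subst \<theta> ` H) (subst \<theta> \<phi>)"
  using assms(1,2)
proof (induction arbitrary: \<theta> rule: derivable.induct)
  case (ImpI \<phi> H \<psi>)
  then show ?case by (auto intro!: derivable.ImpI wff_subst)
next
  case (ImpE H \<phi> \<psi>)
  then show ?case using derivable.ImpE by fastforce
next
  case (RAA \<phi> H)
  have "derivable T (insert (\<^bold>\<not> subst \<theta> \<phi>) (subst \<theta> ` H)) Falsum"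
    using RAA.IH[OF RAA.prems] by simp
  then show ?case by (rule derivable.RAA[OF wff_subst[OF RAA.prems RAA.hyps(1)]])
next
  case (ForallI \<rho> H \<phi>)
  have "subst (under \<rho> \<theta>) ` lift \<rho> ` H = lift \<rho> ` subst \<theta> ` H"
    by (simp add: image_image subst_lift)
  then show ?case using ForallI.IH[OF wt_under[OF ForallI.prems], of \<rho>] by (auto intro: derivable.ForallI)
next
  case (ForallE H \<rho> \<phi> t)
  then show ?case using derivable.ForallE[of T "subst \<theta> ` H" \<rho> "subst (under \<rho> \<theta>) \<phi>" "subst_tm \<theta> t"]
    by (simp add: subst_inst has_type_subst)
next
  case (EqSubst \<phi> H s t)
  then show ?case using derivable.EqSubst[of "subst (under N \<theta>) \<phi>" T "subst \<theta> ` H" "subst_tm \<theta> s" "subst_tm \<theta> t"]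
    by (simp add: subst_inst wff_subst wt_under)
next
  case (Axiom \<phi> H)
  then show ?case by (simp add: derivable.Axiom T wff_subst)
next
  case (Assume \<phi> H)
  then show ?case by (simp add: derivable.Assume wff_subst)
next
  case (EqRefl t H)
  then show ?case by (simp add: derivable.EqRefl has_type_subst)
qed

lemma derivable_finite: "derivable T H \<phi> \<Longrightarrow> \<exists>H0 \<subseteq> H. finite H0 \<and> derivable T H0 \<phi>"
proof (induction rule: derivable.induct)
  case (Axiom \<phi> H)
  then show ?case by (meson derivable.Axiom empty_subsetI finite.emptyI)
next
  case (Assume \<phi> H)
  then show ?case by (intro exI[of _ "{\<phi>}"]) (auto intro: derivable.Assume)
next
  case (ImpI \<phi> H \<psi>)
  then obtain H0 where "H0 \<subseteq> insert \<phi> H" "finite H0" "derivable T H0 \<psi>" by blast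
  then show ?case
    by (intro exI[of _ "H0 - {\<phi>}"]) (auto intro!: derivable.ImpI ImpI.hyps intro: derivable_mono)
next
  case (RAA \<phi> H)
  then obtain H0 where H0: "H0 \<subseteq> insert (\<^bold>\<not> \<phi>) H" "finite H0" "derivable T H0 Falsum" by blast
  then have "derivable T (insert (\<^bold>\<not> \<phi>) (H0 - {\<^bold>\<not> \<phi>})) Falsum" by (blast intro: derivable_mono)
  then have "derivable T (H0 - {\<^bold>\<not> \<phi>}) \<phi>" by (rule derivable.RAA[OF RAA.hyps(1)])
  with H0 show ?case by blast
next
  case (ImpE H \<phi> \<psi>)
  then obtain H0 H1 where "H0 \<subseteq> H" "finite H0" "derivable T H0 (\<phi> \<^bold>\<longrightarrow> \<psi>)"
    "H1 \<subseteq> H" "finite H1" "derivable T H1 \<phi>" by blast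
  then show ?case
    by (intro exI[of _ "H0 \<union> H1"])
      (auto intro!: derivable.ImpE[of T "H0 \<union> H1" \<phi> \<psi>] elim: derivable_mono)
next
  case (EqSubst \<phi> H s t)
  then obtain H0 H1 where "H0 \<subseteq> H" "finite H0" "derivable T H0 (s \<^bold>= t)"
    "H1 \<subseteq> H" "finite H1" "derivable T H1 (subst (inst N s) \<phi>)" by blast
  then show ?case using EqSubst.hyps(1)
    by (intro exI[of _ "H0 \<union> H1"])
      (auto intro!: derivable.EqSubst[of \<phi> T "H0 \<union> H1" s t] elim: derivable_mono)
next
  case (ForallI \<rho> H \<phi>)
  then obtain H0 where "H0 \<subseteq> lift \<rho> ` H" "finite H0" "derivable T H0 \<phi>" by blast
  then show ?case by (metis derivable.ForallI finite_subset_image)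
next
  case (ForallE H \<rho> \<phi> t)
  then show ?case by (meson derivable.ForallE)
next
  case (EqRefl t H)
  then show ?case by (meson derivable.EqRefl empty_subsetI finite.emptyI)
qed

section \<open>Closure of the axioms under substitution\<close>

lemma RCA0w_wff: "\<phi> \<in> RCA0w \<Longrightarrow> wff \<phi>"
proof (induction rule: RCA0w.induct)
  case (QF_IND \<phi>)
  then show ?case by (auto intro!: wff_subst wt_inst simp: wt_subst_def)
next
  case (QF_AC \<phi>)
  then show ?case by (auto intro!: wff_subst wt_inst wt_shift)
qed (auto intro!: wff_eq_at, blast)

text \<open>Most schemes admit arbitrary terms in every place and are closed at once. Induction and
  choice contain bound variables, so their substituted instance has to be recognized as the instance
  for the substituted \<open>\<phi>\<close>.\<close>

lemma RCA0w_subst: "\<phi> \<in> RCA0w \<Longrightarrow> wt_subst \<theta> \<Longrightarrow> subst \<theta> \<phi> \<in> RCA0w"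
proof (induction arbitrary: \<theta> rule: RCA0w.induct)
  case (QF_IND \<phi>)
  let ?\<phi> = "subst (under N \<theta>) \<phi>"
  let ?S = "\<lambda>\<sigma> i. if \<sigma> = N \<and> i = 0 then Succ \<cdot> Var N 0 else Var \<sigma> i"
  \<comment> \<open>A lifted term does not mention \<open>Var N 0\<close>, the only variable that
    \<open>?S\<close> moves.\<close>
  have lift_S: "subst_tm ?S (lift_tm N t) = lift_tm N t" for t
    unfolding subst_tm_comp
    by (rule arg_cong[where f = "\<lambda>\<theta>. subst_tm \<theta> t"]) (auto simp: fun_eq_iff shift_def)
  have "subst (under N \<theta>) (subst ?S \<phi>) = subst ?S ?\<phi>"
    unfolding subst_comp
    by (rule arg_cong[where f = "\<lambda>\<theta>. subst \<theta> \<phi>"])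
      (auto simp: fun_eq_iff under_def lift_S split: nat.split)
  moreover have "qfree ?\<phi>" "wff ?\<phi>"
    using QF_IND by (auto simp: qfree_subst wff_subst wt_under)
  ultimately show ?case
    using RCA0w.QF_IND[of ?\<phi>] by (simp add: subst_inst)
next
  case (QF_AC \<phi>)
  let ?\<phi> = "subst (under N (under ty1 \<theta>)) \<phi>"
  have "qfree ?\<phi>" "wff ?\<phi>"
    using QF_AC by (auto simp: qfree_subst wff_subst wt_under)
  moreover have "subst (under N (under ty1 (under ty2 \<theta>))) (lift ty2 \<phi>) = lift ty2 ?\<phi>"
    unfolding subst_comp
    by (rule arg_cong[where f = "\<lambda>\<theta>. subst \<theta> \<phi>"])
      (auto simp: fun_eq_iff shift_def under_def subst_tm_comp split: nat.split
        intro!: arg_cong[where f = "\<lambda>\<theta>. subst_tm \<theta> _"])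
  moreover have "subst_tm (under ty1 (under ty2 \<theta>)) (Var ty2 0 \<cdot> Var ty1 0) = Var ty2 0 \<cdot> Var ty1 0"
    by (simp add: under_def shift_def)
  ultimately show ?case
    using RCA0w.QF_AC[of ?\<phi>] by (simp add: subst_inst del: subst_tm.simps)
qed (auto simp: subst_eq_at has_type_subst intro!: RCA0w.intros)

subsection \<open>Semantics\<close>

text \<open>\<open>con\<close> is a function on terms so that the term model can use
  \<open>cls\<close> for it; evaluation consults it only at the constants.\<close>

primrec val :: "('a \<Rightarrow> 'a \<Rightarrow> 'a) \<Rightarrow> (tm \<Rightarrow> 'a) \<Rightarrow> (ty \<Rightarrow> nat \<Rightarrow> 'a) \<Rightarrow> tm \<Rightarrow> 'a" where
  "val app con e (Var \<rho> i) = e \<rho> i"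
| "val app con e Zero = con Zero"
| "val app con e Succ = con Succ"
| "val app con e (CPi \<rho> \<tau>) = con (CPi \<rho> \<tau>)"
| "val app con e (CSigma \<delta> \<rho> \<tau>) = con (CSigma \<delta> \<rho> \<tau>)"
| "val app con e Rec = con Rec"
| "val app con e (s \<cdot> t) = app (val app con e s) (val app con e t)"

primrec sat :: "(ty \<Rightarrow> 'a set) \<Rightarrow> ('a \<Rightarrow> 'a \<Rightarrow> 'a) \<Rightarrow> (tm \<Rightarrow> 'a) \<Rightarrow> (ty \<Rightarrow> nat \<Rightarrow> 'a) \<Rightarrow> fm \<Rightarrow> bool" where
  "sat D app con e (s \<^bold>= t) \<longleftrightarrow> val app con e s = val app con e t"
| "sat D app con e Falsum \<longleftrightarrow> False"
| "sat D app con e (\<phi> \<^bold>\<longrightarrow> \<psi>) \<longleftrightarrow> (sat D app con e \<phi> \<longrightarrow> sat D app con e \<psi>)"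
| "sat D app con e (Forall \<rho> \<phi>) \<longleftrightarrow> (\<forall>x\<in>D \<rho>. sat D app con (cons_subst \<rho> x e) \<phi>)"

text \<open>All types share one carrier, with \<open>D\<close> marking the objects of each type.
  Extensionality is stated for true equality, so that \<open>eq_at\<close> means equality in the
  model.\<close>

locale ext_structure =
  fixes D :: "ty \<Rightarrow> 'a set" and app :: "'a \<Rightarrow> 'a \<Rightarrow> 'a" and con :: "tm \<Rightarrow> 'a"
  assumes app_in: "f \<in> D (\<rho> \<Rrightarrow> \<tau>) \<Longrightarrow> x \<in> D \<rho> \<Longrightarrow> app f x \<in> D \<tau>"
    and con_in: "closed_tm c \<Longrightarrow> has_type c \<rho> \<Longrightarrow> con c \<in> D \<rho>"
    and extensional: "f \<in> D (\<rho> \<Rrightarrow> \<tau>) \<Longrightarrow> g \<in> D (\<rho> \<Rrightarrow> \<tau>) \<Longrightarrow> (\<And>x. x \<in> D \<rho> \<Longrightarrow> app f x = app g x) \<Longrightarrow> f = g"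

definition env_in :: "(ty \<Rightarrow> 'a set) \<Rightarrow> (ty \<Rightarrow> nat \<Rightarrow> 'a) \<Rightarrow> bool" where
  "env_in D e \<longleftrightarrow> (\<forall>\<sigma> i. e \<sigma> i \<in> D \<sigma>)"

locale rca_model = ext_structure +
  assumes axioms_sat: "\<phi> \<in> RCA0w \<Longrightarrow> env_in D e \<Longrightarrow> sat D app con e \<phi>"

subsection \<open>Completeness\<close>

instance ty :: countable by countable_datatype
instance tm :: countable by countable_datatype
instance fm :: countable by countable_datatype

definition consistent :: "fm set \<Rightarrow> fm set \<Rightarrow> bool" where
  "consistent T H \<longleftrightarrow> \<not> derivable T H Falsum"

text \<open>If adding the negation of \<open>\<chi> y\<close>, for a fresh variable \<open>y\<close>, were inconsistent, renaming \<open>y\<close> to the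
  bound variable would give a derivation of \<open>\<forall>x. \<chi> x\<close>.\<close>

lemma consistent_witness:
  assumes T: "\<And>\<phi> \<theta>. \<phi> \<in> T \<Longrightarrow> wt_subst \<theta> \<Longrightarrow> subst \<theta> \<phi> \<in> T"
    and con: "consistent T H" and mem: "\<^bold>\<not> Forall \<rho> \<chi> \<in> H" and wff: "\<forall>\<psi>\<in>H. wff \<psi>"
    and fresh: "\<forall>\<psi>\<in>H. bound_fm \<psi> \<le> k"
  shows "consistent T (insert (\<^bold>\<not> subst (inst \<rho> (Var \<rho> k)) \<chi>) H)"
proof (rule ccontr)
  let ?y = "inst \<rho> (Var \<rho> k)"
  assume "\<not> ?thesis"
  then have d: "derivable T (insert (\<^bold>\<not> subst ?y \<chi>) H) Falsum" by (simp add: consistent_def)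
  have "wff \<chi>" using mem wff by auto
  then have "wff (subst ?y \<chi>)" by (simp add: wff_subst wt_inst)
  then have d1: "derivable T H (subst ?y \<chi>)" using d by (rule derivable.RAA)
  \<comment> \<open>Apart from index \<open>k\<close> of type \<open>\<rho>\<close> this is
    \<open>shift \<rho>\<close>, so it lifts \<open>H\<close>, whose indices stay below
    \<open>k\<close>; on \<open>\<chi>\<close> it undoes \<open>?y\<close>.\<close>
  define \<theta> where "\<theta> \<sigma> i = (if \<sigma> = \<rho> then if i = k then Var \<rho> 0 else Var \<rho> (Suc i) else Var \<sigma> i)" for \<sigma> i
  have "wt_subst \<theta>" by (simp add: wt_subst_def \<theta>_def)
  then have d2: "derivable T (subst \<theta> ` H) (subst \<theta> (subst ?y \<chi>))"
    using derivable_subst[OF d1 _ T] by blast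
  have "subst \<theta> \<psi> = lift \<rho> \<psi>" if "\<psi> \<in> H" for \<psi>
    using that fresh by (intro subst_cong) (auto simp: \<theta>_def shift_def)
  then have im: "subst \<theta> ` H = lift \<rho> ` H" by (rule image_cong[OF refl])
  have "subst \<theta> (subst ?y \<chi>) = subst Var \<chi>"
    unfolding subst_comp using mem fresh
    by (intro subst_cong) (fastforce simp: \<theta>_def inst_def split: nat.split)
  with d2 im have "derivable T (lift \<rho> ` H) \<chi>" by (simp add: subst_Var)
  then have "derivable T H (Forall \<rho> \<chi>)" by (rule derivable.ForallI)
  moreover have "derivable T H (\<^bold>\<not> Forall \<rho> \<chi>)" using mem wff by (auto intro: derivable.Assume)
  ultimately show False using con derivable.ImpE unfolding consistent_def by blast
qed

definition witness_bound :: "fm set \<Rightarrow> nat" where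
  "witness_bound H = Max (insert 0 (bound_fm ` H))"

text \<open>A negated universal formula enters together with its counterexample; for every other
  formula the comprehension is empty.\<close>

definition henkin_step :: "fm set \<Rightarrow> fm set \<Rightarrow> fm \<Rightarrow> fm set" where
  "henkin_step T H \<psi> = (if wff \<psi> \<and> consistent T (insert \<psi> H) then
     insert \<psi> H \<union> {\<^bold>\<not> subst (inst \<rho> (Var \<rho> (witness_bound (insert \<psi> H)))) \<chi> | \<rho> \<chi>. \<psi> = \<^bold>\<not> Forall \<rho> \<chi>}
   else H)"

primrec henkin_chain :: "fm set \<Rightarrow> fm set \<Rightarrow> nat \<Rightarrow> fm set" where
  "henkin_chain T H 0 = H"
| "henkin_chain T H (Suc n) = henkin_step T (henkin_chain T H n) (from_nat n)"

definition henkin :: "fm set \<Rightarrow> fm set \<Rightarrow> bool" where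
  "henkin T M \<longleftrightarrow> consistent T M \<and> (\<forall>\<psi>\<in>M. wff \<psi>) \<and>
     (\<forall>\<psi>. wff \<psi> \<longrightarrow> consistent T (insert \<psi> M) \<longrightarrow> \<psi> \<in> M) \<and>
     (\<forall>\<rho> \<chi>. \<^bold>\<not> Forall \<rho> \<chi> \<in> M \<longrightarrow> (\<exists>t. has_type t \<rho> \<and> \<^bold>\<not> subst (inst \<rho> t) \<chi> \<in> M))"

lemma consistent_mono: "consistent T H' \<Longrightarrow> H \<subseteq> H' \<Longrightarrow> consistent T H"
  unfolding consistent_def by (blast intro: derivable_mono)

text \<open>Finiteness is carried along because it bounds the indices in use and so leaves a fresh
  variable for the next witness.\<close>

lemma henkin_step:
  assumes T: "\<And>\<phi> \<theta>. \<phi> \<in> T \<Longrightarrow> wt_subst \<theta> \<Longrightarrow> subst \<theta> \<phi> \<in> T"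
    and H: "consistent T H" "finite H" "\<forall>\<psi>\<in>H. wff \<psi>"
  shows "consistent T (henkin_step T H \<psi>) \<and> finite (henkin_step T H \<psi>) \<and> (\<forall>\<psi>\<in>henkin_step T H \<psi>. wff \<psi>)"
proof (cases "wff \<psi> \<and> consistent T (insert \<psi> H)")
  case False
  then show ?thesis using H by (auto simp: henkin_step_def)
next
  case True
  show ?thesis
  proof (cases "\<exists>\<rho> \<chi>. \<psi> = \<^bold>\<not> Forall \<rho> \<chi>")
    case False
    then have "henkin_step T H \<psi> = insert \<psi> H" using True by (auto simp: henkin_step_def)
    then show ?thesis using True H by auto
  next
    case ex: True
    then obtain \<rho> \<chi> where \<psi>: "\<psi> = \<^bold>\<not> Forall \<rho> \<chi>" by blast
    define k where "k = witness_bound (insert \<psi> H)"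
    have eq: "henkin_step T H \<psi> = insert (\<^bold>\<not> subst (inst \<rho> (Var \<rho> k)) \<chi>) (insert \<psi> H)"
      using True by (auto simp: henkin_step_def \<psi> k_def)
    have "\<forall>\<phi>\<in>insert \<psi> H. bound_fm \<phi> \<le> k"
      using H(2) unfolding k_def witness_bound_def by (auto intro!: Max_ge)
    then have "consistent T (henkin_step T H \<psi>)" unfolding eq
      using True H \<psi> by (intro consistent_witness T) auto
    moreover have "wff \<chi>" using True \<psi> by simp
    ultimately show ?thesis using True H unfolding eq by (auto simp: wff_subst wt_inst)
  qed
qed

lemma henkin_exists:
  assumes T: "\<And>\<phi> \<theta>. \<phi> \<in> T \<Longrightarrow> wt_subst \<theta> \<Longrightarrow> subst \<theta> \<phi> \<in> T"
    and H: "consistent T H" "finite H" "\<forall>\<psi>\<in>H. wff \<psi>"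
  shows "\<exists>M. H \<subseteq> M \<and> henkin T M"
proof -
  let ?C = "henkin_chain T H"
  define M where "M = (\<Union>n. ?C n)"
  have chain: "consistent T (?C n) \<and> finite (?C n) \<and> (\<forall>\<psi>\<in>?C n. wff \<psi>)" for n
    by (induction n) (use H henkin_step[OF T] in auto)
  have inc: "m \<le> n \<Longrightarrow> ?C m \<subseteq> ?C n" for m n
    by (rule lift_Suc_mono_le[of ?C]) (auto simp: henkin_step_def)
  have fin: "\<exists>n. H0 \<subseteq> ?C n" if "finite H0" "H0 \<subseteq> M" for H0
    using that
  proof (induction H0)
    case (insert \<psi> H0)
    then obtain m n where "H0 \<subseteq> ?C m" "\<psi> \<in> ?C n" by (auto simp: M_def)
    then show ?case using inc[of m "max m n"] inc[of n "max m n"] by (intro exI[of _ "max m n"]) auto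
  qed auto
  have con: "consistent T M"
    unfolding consistent_def using derivable_finite[of T M Falsum] fin chain
    by (meson consistent_def derivable_mono)
  have wff: "\<forall>\<psi>\<in>M. wff \<psi>" using chain by (auto simp: M_def)
  \<comment> \<open>Each formula is handled at the stage given by its own code.\<close>
  have step: "henkin_step T (?C (to_nat \<psi>)) \<psi> \<subseteq> M" for \<psi>
    using UN_upper[of "Suc (to_nat \<psi>)" UNIV ?C] by (simp add: M_def)
  have maxi: "\<psi> \<in> M" if "wff \<psi>" "consistent T (insert \<psi> M)" for \<psi>
  proof -
    have "consistent T (insert \<psi> (?C (to_nat \<psi>)))"
      using that(2) by (rule consistent_mono) (auto simp: M_def)
    then show ?thesis using step[of \<psi>] that(1) by (auto simp: henkin_step_def)
  qed
  have wit: "\<exists>t. has_type t \<rho> \<and> \<^bold>\<not> subst (inst \<rho> t) \<chi> \<in> M" if "\<^bold>\<not> Forall \<rho> \<chi> \<in> M" for \<rho> \<chi>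
  proof -
    let ?\<psi> = "\<^bold>\<not> Forall \<rho> \<chi>"
    have "consistent T (insert ?\<psi> (?C (to_nat ?\<psi>)))"
      using con by (rule consistent_mono) (use that in \<open>auto simp: M_def\<close>)
    moreover have "wff ?\<psi>" using that wff by blast
    ultimately have "\<^bold>\<not> subst (inst \<rho> (Var \<rho> (witness_bound (insert ?\<psi> (?C (to_nat ?\<psi>)))))) \<chi>
        \<in> henkin_step T (?C (to_nat ?\<psi>)) ?\<psi>"
      unfolding henkin_step_def by auto
    then show ?thesis using step[of ?\<psi>] by (intro exI[of _ "Var \<rho> _"]) auto
  qed
  have "H \<subseteq> M" using UN_upper[of 0 UNIV ?C] by (simp add: M_def)
  then show ?thesis using con wff maxi wit unfolding henkin_def by blast
qed

section \<open>The term model of a Henkin set\<close>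

locale henkin_set =
  fixes M :: "fm set"
  assumes henkin: "henkin RCA0w M"
begin

lemma M_wff: "\<psi> \<in> M \<Longrightarrow> wff \<psi>"
  using henkin by (simp add: henkin_def)

lemma M_derivable: "derivable RCA0w M \<psi> \<Longrightarrow> \<psi> \<in> M"
proof (rule ccontr)
  assume d: "derivable RCA0w M \<psi>" and "\<psi> \<notin> M"
  then have "derivable RCA0w (insert \<psi> M) Falsum"
    using henkin derivable_wff[OF d] unfolding henkin_def consistent_def by blast
  then have "derivable RCA0w M (\<^bold>\<not> \<psi>)" using derivable_wff[OF d] by (intro derivable.ImpI)
  then have "derivable RCA0w M Falsum" using d by (rule derivable.ImpE)
  then show False using henkin by (simp add: henkin_def consistent_def)
qed

lemma M_derivable_iff: "derivable RCA0w M \<psi> \<longleftrightarrow> \<psi> \<in> M"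
  using M_derivable M_wff derivable.Assume by blast

lemma M_Falsum: "Falsum \<notin> M"
  using henkin M_derivable_iff by (auto simp: henkin_def consistent_def)

lemma M_Imp: "wff \<phi> \<Longrightarrow> wff \<psi> \<Longrightarrow> (\<phi> \<^bold>\<longrightarrow> \<psi>) \<in> M \<longleftrightarrow> (\<phi> \<in> M \<longrightarrow> \<psi> \<in> M)"
proof
  assume "(\<phi> \<^bold>\<longrightarrow> \<psi>) \<in> M"
  then show "\<phi> \<in> M \<longrightarrow> \<psi> \<in> M" unfolding M_derivable_iff[symmetric] using derivable.ImpE by blast
next
  assume w: "wff \<phi>" "wff \<psi>" and imp: "\<phi> \<in> M \<longrightarrow> \<psi> \<in> M"
  show "(\<phi> \<^bold>\<longrightarrow> \<psi>) \<in> M"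
  proof (cases "\<phi> \<in> M")
    case True
    then show ?thesis using imp w
      by (intro M_derivable derivable.ImpI derivable.Assume) auto
  next
    case False
    then have "derivable RCA0w (insert \<phi> M) Falsum"
      using henkin w unfolding henkin_def consistent_def by blast
    then have "derivable RCA0w (insert (\<^bold>\<not> \<psi>) (insert \<phi> M)) Falsum" by (rule derivable_mono) auto
    then have "derivable RCA0w (insert \<phi> M) \<psi>" by (rule derivable.RAA[OF w(2)])
    then show ?thesis using w by (intro M_derivable derivable.ImpI) auto
  qed
qed

text \<open>The converse is where the counterexample terms come in: a universal formula outside
  \<open>M\<close> has its negation in \<open>M\<close>.\<close>

lemma M_Forall:
  assumes "wff \<phi>"
  shows "Forall \<rho> \<phi> \<in> M \<longleftrightarrow> (\<forall>t. has_type t \<rho> \<longrightarrow> subst (inst \<rho> t) \<phi> \<in> M)"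
proof
  assume "Forall \<rho> \<phi> \<in> M"
  then show "\<forall>t. has_type t \<rho> \<longrightarrow> subst (inst \<rho> t) \<phi> \<in> M"
    unfolding M_derivable_iff[symmetric] by (blast intro: derivable.ForallE)
next
  assume all: "\<forall>t. has_type t \<rho> \<longrightarrow> subst (inst \<rho> t) \<phi> \<in> M"
  show "Forall \<rho> \<phi> \<in> M"
  proof (rule ccontr)
    assume "Forall \<rho> \<phi> \<notin> M"
    then have "\<^bold>\<not> Forall \<rho> \<phi> \<in> M" using assms by (simp add: M_Imp)
    then obtain t where t: "has_type t \<rho>" "\<^bold>\<not> subst (inst \<rho> t) \<phi> \<in> M"
      using henkin unfolding henkin_def by blast
    then show False using all assms M_Falsum by (simp add: M_Imp wff_subst wt_inst)
  qed
qed

lemma M_axiom: "\<phi> \<in> RCA0w \<Longrightarrow> \<phi> \<in> M"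
  by (rule M_derivable) (simp add: derivable.Axiom RCA0w_wff)

lemma M_eq_Arr:
  assumes "has_type s (\<rho> \<Rrightarrow> \<tau>)" "has_type t (\<rho> \<Rrightarrow> \<tau>)"
  shows "eq_at (\<rho> \<Rrightarrow> \<tau>) s t \<in> M \<longleftrightarrow> (\<forall>r. has_type r \<rho> \<longrightarrow> eq_at \<tau> (s \<cdot> r) (t \<cdot> r) \<in> M)"
proof -
  have "wff (eq_at (\<rho> \<Rrightarrow> \<tau>) s t)" using assms by (rule wff_eq_at)
  then have "eq_at (\<rho> \<Rrightarrow> \<tau>) s t \<in> M \<longleftrightarrow>
     (\<forall>r. has_type r \<rho> \<longrightarrow> subst (inst \<rho> r) (eq_at \<tau> (lift_tm \<rho> s \<cdot> Var \<rho> 0) (lift_tm \<rho> t \<cdot> Var \<rho> 0)) \<in> M)"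
    by (simp add: M_Forall)
  then show ?thesis by (simp add: subst_eq_at subst_tm_inst_lift) (simp add: inst_def)
qed

lemma M_eq_N_subst:
  assumes "(s \<^bold>= t) \<in> M" "wff \<phi>" "subst (inst N s) \<phi> \<in> M"
  shows "subst (inst N t) \<phi> \<in> M"
  using assms unfolding M_derivable_iff[symmetric] by (blast intro: derivable.EqSubst)

lemma M_eq_refl: "has_type t \<rho> \<Longrightarrow> eq_at \<rho> t t \<in> M"
proof (induction \<rho> arbitrary: t)
  case N
  then show ?case by (simp add: M_derivable derivable.EqRefl)
next
  case (Arr \<rho> \<tau>)
  then have "eq_at \<tau> (t \<cdot> r) (t \<cdot> r) \<in> M" if "has_type r \<rho>" for r
    using that by (intro Arr.IH) auto
  then show ?case using Arr.prems by (simp add: M_eq_Arr del: eq_at.simps)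
qed

lemma M_eq_sym: "has_type s \<rho> \<Longrightarrow> has_type t \<rho> \<Longrightarrow> eq_at \<rho> s t \<in> M \<Longrightarrow> eq_at \<rho> t s \<in> M"
proof (induction \<rho> arbitrary: s t)
  case N
  have "subst (inst N s) (Var N 0 \<^bold>= lift_tm N s) \<in> M"
    using M_eq_refl[OF N(1)] by (simp add: subst_tm_inst_lift) (simp add: inst_def)
  then have "subst (inst N t) (Var N 0 \<^bold>= lift_tm N s) \<in> M"
    using N by (intro M_eq_N_subst[of s t]) (auto intro: has_type_subst wt_shift)
  then show ?case by (simp add: subst_tm_inst_lift) (simp add: inst_def)
next
  case (Arr \<rho> \<tau>)
  from Arr.prems(3) have *: "\<And>r. has_type r \<rho> \<Longrightarrow> eq_at \<tau> (s \<cdot> r) (t \<cdot> r) \<in> M"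
    using Arr.prems(1,2) M_eq_Arr by blast
  have "eq_at \<tau> (t \<cdot> r) (s \<cdot> r) \<in> M" if "has_type r \<rho>" for r
    by (rule Arr.IH(2)[OF _ _ *[OF that]]) (use that Arr.prems in auto)
  then show ?case using Arr.prems(1,2) M_eq_Arr by blast
qed

lemma M_eq_trans: "has_type s \<rho> \<Longrightarrow> has_type t \<rho> \<Longrightarrow> has_type r \<rho> \<Longrightarrow> eq_at \<rho> s t \<in> M \<Longrightarrow> eq_at \<rho> t r \<in> M \<Longrightarrow>
   eq_at \<rho> s r \<in> M"
proof (induction \<rho> arbitrary: s t r)
  case N
  have "subst (inst N t) (lift_tm N s \<^bold>= Var N 0) \<in> M"
    using N(4) by (simp add: subst_tm_inst_lift) (simp add: inst_def)
  then have "subst (inst N r) (lift_tm N s \<^bold>= Var N 0) \<in> M"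
    using N by (intro M_eq_N_subst[of t r]) (auto intro: has_type_subst wt_shift)
  then show ?case by (simp add: subst_tm_inst_lift) (simp add: inst_def)
next
  case (Arr \<rho> \<tau>)
  have *: "eq_at \<tau> (s \<cdot> x) (t \<cdot> x) \<in> M" "eq_at \<tau> (t \<cdot> x) (r \<cdot> x) \<in> M" if "has_type x \<rho>" for x
    using Arr.prems M_eq_Arr that by blast+
  have "eq_at \<tau> (s \<cdot> x) (r \<cdot> x) \<in> M" if "has_type x \<rho>" for x
    by (rule Arr.IH(2)[OF _ _ _ *[OF that]]) (use that Arr.prems in auto)
  then show ?case using Arr.prems M_eq_Arr by blast
qed

text \<open>Equal functions agree by the definition of higher-type equality; replacing the argument
  is what the extensionality axiom provides. Hence application respects the classes.\<close>

lemma M_eq_App: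
  assumes "has_type s (\<rho> \<Rrightarrow> \<tau>)" "has_type s' (\<rho> \<Rrightarrow> \<tau>)" "has_type t \<rho>" "has_type t' \<rho>"
    and "eq_at (\<rho> \<Rrightarrow> \<tau>) s s' \<in> M" "eq_at \<rho> t t' \<in> M"
  shows "eq_at \<tau> (s \<cdot> t) (s' \<cdot> t') \<in> M"
proof (rule M_eq_trans)
  have "(eq_at \<rho> t t' \<^bold>\<longrightarrow> eq_at \<tau> (s \<cdot> t) (s \<cdot> t')) \<in> M"
    using assms by (intro M_axiom RCA0w.Extensionality)
  moreover have "wff (eq_at \<rho> t t')" "wff (eq_at \<tau> (s \<cdot> t) (s \<cdot> t'))"
    using assms by (auto intro!: wff_eq_at)
  ultimately show "eq_at \<tau> (s \<cdot> t) (s \<cdot> t') \<in> M" using assms(6) by (simp add: M_Imp)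
  show "eq_at \<tau> (s \<cdot> t') (s' \<cdot> t') \<in> M"
    using assms M_eq_Arr by blast
qed (use assms in auto)

definition cls :: "tm \<Rightarrow> tm set" where
  "cls t = {s. \<exists>\<rho>. has_type t \<rho> \<and> has_type s \<rho> \<and> eq_at \<rho> t s \<in> M}"

definition dom :: "ty \<Rightarrow> tm set set" where
  "dom \<rho> = cls ` {t. has_type t \<rho>}"

text \<open>Representatives are chosen so that application is total on sets of terms; on classes the
  choice is immaterial by \<open>M_eq_App\<close>.\<close>

definition cls_app :: "tm set \<Rightarrow> tm set \<Rightarrow> tm set" where
  "cls_app f x = cls ((SOME s. s \<in> f) \<cdot> (SOME t. t \<in> x))"

lemma cls_eq_iff:
  assumes "has_type s \<rho>" "has_type t \<rho>"
  shows "cls s = cls t \<longleftrightarrow> eq_at \<rho> s t \<in> M"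
proof
  assume "cls s = cls t"
  moreover have "t \<in> cls t" using assms M_eq_refl by (auto simp: cls_def)
  ultimately have "t \<in> cls s" by simp
  then show "eq_at \<rho> s t \<in> M" using assms has_type_unique by (auto simp: cls_def)
next
  assume eq: "eq_at \<rho> s t \<in> M"
  have "eq_at \<rho> s r \<in> M \<longleftrightarrow> eq_at \<rho> t r \<in> M" if "has_type r \<rho>" for r
    using M_eq_trans[of s \<rho> t r] M_eq_trans[of t \<rho> s r] M_eq_sym[of s \<rho> t] eq assms that by blast
  then show "cls s = cls t" using assms has_type_unique unfolding cls_def by blast
qed

lemma cls_some:
  assumes "has_type t \<rho>"
  shows "has_type (SOME s. s \<in> cls t) \<rho>" "eq_at \<rho> t (SOME s. s \<in> cls t) \<in> M"
proof -
  have "t \<in> cls t" using assms M_eq_refl by (auto simp: cls_def)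
  then have "(SOME s. s \<in> cls t) \<in> cls t" by (rule someI)
  then show "has_type (SOME s. s \<in> cls t) \<rho>" "eq_at \<rho> t (SOME s. s \<in> cls t) \<in> M"
    using assms has_type_unique by (auto simp: cls_def)
qed

lemma cls_app:
  assumes "has_type s (\<rho> \<Rrightarrow> \<tau>)" "has_type t \<rho>"
  shows "cls_app (cls s) (cls t) = cls (s \<cdot> t)"
proof -
  let ?s = "SOME x. x \<in> cls s" and ?t = "SOME x. x \<in> cls t"
  have "eq_at \<tau> (s \<cdot> t) (?s \<cdot> ?t) \<in> M"
    using cls_some[OF assms(1)] cls_some[OF assms(2)] assms by (intro M_eq_App)
  then have "cls (s \<cdot> t) = cls (?s \<cdot> ?t)"
    using cls_some[OF assms(1)] cls_some[OF assms(2)] assms by (subst cls_eq_iff[of _ \<tau>]) auto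
  then show ?thesis by (simp add: cls_app_def)
qed

lemma val_cls:
  "wt_subst \<theta> \<Longrightarrow> has_type t \<rho> \<Longrightarrow> val cls_app cls (\<lambda>\<sigma> i. cls (\<theta> \<sigma> i)) t = cls (subst_tm \<theta> t)"
proof (induction t arbitrary: \<rho>)
  case (App s t)
  then obtain \<sigma> where "has_type s (\<sigma> \<Rrightarrow> \<rho>)" "has_type t \<sigma>" by auto
  then show ?case using App cls_app[of "subst_tm \<theta> s" \<sigma> \<rho> "subst_tm \<theta> t"] by (simp add: has_type_subst)
qed auto

text \<open>The truth lemma. Environments have the form of a substitution followed by
  \<open>cls\<close>, so that binding a class becomes extending the substitution by a
  representative.\<close>

lemma sat_cls:
  "wt_subst \<theta> \<Longrightarrow> wff \<phi> \<Longrightarrow> sat dom cls_app cls (\<lambda>\<sigma> i. cls (\<theta> \<sigma> i)) \<phi> \<longleftrightarrow> subst \<theta> \<phi> \<in> M"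
proof (induction \<phi> arbitrary: \<theta>)
  case (Eq s t)
  then show ?case using cls_eq_iff[of "subst_tm \<theta> s" N "subst_tm \<theta> t"]
    by (simp add: val_cls[of _ _ N] has_type_subst)
next
  case (Forall \<rho> \<phi>)
  have "cons_subst \<rho> (cls t) (\<lambda>\<sigma> i. cls (\<theta> \<sigma> i)) = (\<lambda>\<sigma> i. cls (cons_subst \<rho> t \<theta> \<sigma> i))" for t
    by (auto simp: cons_subst_def fun_eq_iff split: nat.split)
  moreover have "wff (subst (under \<rho> \<theta>) \<phi>)" using Forall.prems by (simp add: wff_subst wt_under)
  ultimately show ?case using Forall
    by (simp add: dom_def M_Forall subst_inst_under wt_cons)
qed (auto simp: M_Falsum M_Imp wff_subst)

lemma env_cls:
  assumes "env_in dom e"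
  shows "\<exists>\<theta>. wt_subst \<theta> \<and> e = (\<lambda>\<sigma> i. cls (\<theta> \<sigma> i))"
proof -
  have "\<forall>\<sigma> i. \<exists>t. has_type t \<sigma> \<and> e \<sigma> i = cls t" using assms by (fastforce simp: env_in_def dom_def)
  then obtain \<theta> where "\<forall>\<sigma> i. has_type (\<theta> \<sigma> i) \<sigma> \<and> e \<sigma> i = cls (\<theta> \<sigma> i)" by metis
  then show ?thesis by (intro exI[of _ \<theta>]) (auto simp: wt_subst_def fun_eq_iff)
qed

lemma canonical_model: "rca_model dom cls_app cls"
proof
  fix f x \<rho> \<tau>
  assume "f \<in> dom (\<rho> \<Rrightarrow> \<tau>)" "x \<in> dom \<rho>"
  then obtain s t where "has_type s (\<rho> \<Rrightarrow> \<tau>)" "has_type t \<rho>" "f = cls s" "x = cls t"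
    by (auto simp: dom_def)
  then show "cls_app f x \<in> dom \<tau>"
    using cls_app by (auto simp: dom_def intro!: imageI)
next
  fix f g \<rho> \<tau>
  assume "f \<in> dom (\<rho> \<Rrightarrow> \<tau>)" "g \<in> dom (\<rho> \<Rrightarrow> \<tau>)" and eq: "\<And>x. x \<in> dom \<rho> \<Longrightarrow> cls_app f x = cls_app g x"
  then obtain s t where st: "has_type s (\<rho> \<Rrightarrow> \<tau>)" "has_type t (\<rho> \<Rrightarrow> \<tau>)" "f = cls s" "g = cls t"
    by (auto simp: dom_def)
  have "eq_at \<tau> (s \<cdot> r) (t \<cdot> r) \<in> M" if "has_type r \<rho>" for r
  proof -
    have "cls (s \<cdot> r) = cls (t \<cdot> r)"
      using eq[of "cls r"] that st cls_app[of _ \<rho> \<tau> r] by (auto simp: dom_def)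
    then show ?thesis using st that by (subst (asm) cls_eq_iff[of _ \<tau>]) auto
  qed
  then show "f = g" using st by (simp add: cls_eq_iff M_eq_Arr del: eq_at.simps)
next
  fix \<phi> and e :: "ty \<Rightarrow> nat \<Rightarrow> tm set"
  assume "\<phi> \<in> RCA0w" "env_in dom e"
  \<comment> \<open>The environment comes from a substitution, and the axiom so substituted is again
    an axiom, hence in \<open>M\<close>.\<close>
  then show "sat dom cls_app cls e \<phi>"
    using env_cls[of e] sat_cls RCA0w_wff M_axiom RCA0w_subst by blast
qed (auto simp: dom_def)

end

text \<open>Models carried by sets of terms are enough, since the term model of a Henkin set
  containing the negation of \<open>\<phi>\<close> is one of them.\<close>

theorem completeness:
  assumes wff: "wff \<phi>"
    and valid: "\<And>D app (con :: tm \<Rightarrow> tm set) e. rca_model D app con \<Longrightarrow> env_in D e \<Longrightarrow> sat D app con e \<phi>"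
  shows "provable RCA0w \<phi>"
proof (rule ccontr)
  assume np: "\<not> provable RCA0w \<phi>"
  have "consistent RCA0w {\<^bold>\<not> \<phi>}"
    using np derivable.RAA[OF wff, of RCA0w "{}"] by (auto simp: consistent_def)
  then obtain M where M: "\<^bold>\<not> \<phi> \<in> M" "henkin RCA0w M"
    using henkin_exists[of RCA0w "{\<^bold>\<not> \<phi>}"] RCA0w_subst wff by auto
  interpret henkin_set M by unfold_locales (rule M)
  have "wt_subst Var" by (simp add: wt_subst_def)
  then have "sat dom cls_app cls (\<lambda>\<sigma> i. cls (Var \<sigma> i)) \<phi> \<longleftrightarrow> \<phi> \<in> M"
    using sat_cls[of Var \<phi>] wff by (simp add: subst_Var)
  moreover have "sat dom cls_app cls (\<lambda>\<sigma> i. cls (Var \<sigma> i)) \<phi>"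
    by (rule valid[OF canonical_model]) (auto simp: env_in_def dom_def)
  ultimately have "\<phi> \<in> M" by simp
  then show False using M(1) wff M_Falsum by (simp add: M_Imp)
qed

subsection \<open>Bracket abstraction\<close>

text \<open>Here indices serve as names: \<open>abs \<rho> i t\<close> abstracts \<open>Var \<rho> i\<close> without shifting.\<close>

primrec tyof :: "tm \<Rightarrow> ty" where
  "tyof (Var \<rho> i) = \<rho>"
| "tyof Zero = N"
| "tyof Succ = N \<Rrightarrow> N"
| "tyof (CPi \<rho> \<tau>) = \<rho> \<Rrightarrow> \<tau> \<Rrightarrow> \<rho>"
| "tyof (CSigma \<delta> \<rho> \<tau>) = (\<delta> \<Rrightarrow> \<rho> \<Rrightarrow> \<tau>) \<Rrightarrow> (\<delta> \<Rrightarrow> \<rho>) \<Rrightarrow> \<delta> \<Rrightarrow> \<tau>"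
| "tyof Rec = N \<Rrightarrow> N \<Rrightarrow> (N \<Rrightarrow> N \<Rrightarrow> N) \<Rrightarrow> N"
| "tyof (s \<cdot> t) = (case tyof s of N \<Rightarrow> N | \<rho> \<Rrightarrow> \<tau> \<Rightarrow> \<tau>)"

primrec well_typed :: "tm \<Rightarrow> bool" where
  "well_typed (Var \<rho> i) \<longleftrightarrow> True"
| "well_typed Zero \<longleftrightarrow> True"
| "well_typed Succ \<longleftrightarrow> True"
| "well_typed (CPi \<rho> \<tau>) \<longleftrightarrow> True"
| "well_typed (CSigma \<delta> \<rho> \<tau>) \<longleftrightarrow> True"
| "well_typed Rec \<longleftrightarrow> True"
| "well_typed (s \<cdot> t) \<longleftrightarrow> well_typed s \<and> well_typed t \<and>
     (case tyof s of N \<Rightarrow> False | \<rho> \<Rrightarrow> \<tau> \<Rightarrow> \<rho> = tyof t)"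

lemma has_type_iff: "has_type t \<sigma> \<longleftrightarrow> well_typed t \<and> tyof t = \<sigma>"
  by (induction t arbitrary: \<sigma>) (auto split: ty.splits)

primrec fvs :: "tm \<Rightarrow> (ty \<times> nat) set" where
  "fvs (Var \<rho> i) = {(\<rho>, i)}"
| "fvs Zero = {}"
| "fvs Succ = {}"
| "fvs (CPi \<rho> \<tau>) = {}"
| "fvs (CSigma \<delta> \<rho> \<tau>) = {}"
| "fvs Rec = {}"
| "fvs (s \<cdot> t) = fvs s \<union> fvs t"

lemma closed_tm_iff: "closed_tm t \<longleftrightarrow> fvs t = {}"
  by (induction t) auto

definition const_abs :: "ty \<Rightarrow> tm \<Rightarrow> tm" where
  "const_abs \<rho> t = CPi (tyof t) \<rho> \<cdot> t"

primrec abs :: "ty \<Rightarrow> nat \<Rightarrow> tm \<Rightarrow> tm" where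
  "abs \<rho> i (Var \<sigma> j) = (if \<sigma> = \<rho> \<and> j = i then CSigma \<rho> (\<rho> \<Rrightarrow> \<rho>) \<rho> \<cdot> CPi \<rho> (\<rho> \<Rrightarrow> \<rho>) \<cdot> CPi \<rho> \<rho>
     else const_abs \<rho> (Var \<sigma> j))"
| "abs \<rho> i Zero = const_abs \<rho> Zero"
| "abs \<rho> i Succ = const_abs \<rho> Succ"
| "abs \<rho> i (CPi \<sigma> \<tau>) = const_abs \<rho> (CPi \<sigma> \<tau>)"
| "abs \<rho> i (CSigma \<delta> \<sigma> \<tau>) = const_abs \<rho> (CSigma \<delta> \<sigma> \<tau>)"
| "abs \<rho> i Rec = const_abs \<rho> Rec"
| "abs \<rho> i (s \<cdot> t) = CSigma \<rho> (tyof t) (tyof (s \<cdot> t)) \<cdot> abs \<rho> i s \<cdot> abs \<rho> i t"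

lemma tyof_abs [simp]: "tyof (abs \<rho> i t) = \<rho> \<Rrightarrow> tyof t"
  by (induction t) (auto simp: const_abs_def)

lemma well_typed_abs [simp]: "well_typed t \<Longrightarrow> well_typed (abs \<rho> i t)"
  by (induction t) (auto simp: const_abs_def split: ty.splits)

lemma fvs_abs [simp]: "fvs (abs \<rho> i t) = fvs t - {(\<rho>, i)}"
  by (induction t) (auto simp: const_abs_def)

declare abs.simps [simp del]

text \<open>Overwrites by name and so matches \<open>abs\<close>, whereas \<open>cons_subst\<close>
  shifts indices and matches quantifiers.\<close>

definition upd :: "(ty \<Rightarrow> nat \<Rightarrow> 'a) \<Rightarrow> ty \<Rightarrow> nat \<Rightarrow> 'a \<Rightarrow> ty \<Rightarrow> nat \<Rightarrow> 'a" where
  "upd e \<rho> i x \<sigma> j = (if \<sigma> = \<rho> \<and> j = i then x else e \<sigma> j)"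

lemma env_in_upd [simp]: "env_in D e \<Longrightarrow> x \<in> D \<rho> \<Longrightarrow> env_in D (upd e \<rho> i x)"
  by (simp add: env_in_def upd_def)

lemma env_in_cons: "env_in D e \<Longrightarrow> x \<in> D \<rho> \<Longrightarrow> env_in D (cons_subst \<rho> x e)"
  by (simp add: env_in_def cons_subst_def split: nat.split)

lemma cons_subst_simps [simp]:
  "cons_subst \<rho> x e \<rho> 0 = x"
  "cons_subst \<rho> x e \<rho> (Suc i) = e \<rho> i"
  "\<sigma> \<noteq> \<rho> \<Longrightarrow> cons_subst \<rho> x e \<sigma> i = e \<sigma> i"
  by (simp_all add: cons_subst_def)

lemma val_cong: "(\<And>\<rho> i. (\<rho>, i) \<in> fvs t \<Longrightarrow> e \<rho> i = e' \<rho> i) \<Longrightarrow> val app con e t = val app con e' t"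
  by (induction t) auto

lemma val_subst: "val app con e (subst_tm \<theta> t) = val app con (\<lambda>\<sigma> i. val app con e (\<theta> \<sigma> i)) t"
  by (induction t) auto

lemma val_lift [simp]: "val app con (cons_subst \<rho> x e) (lift_tm \<rho> t) = val app con e t"
  unfolding val_subst by (rule val_cong) (auto simp: shift_def cons_subst_def)

lemma sat_subst: "sat D app con e (subst \<theta> \<phi>) \<longleftrightarrow> sat D app con (\<lambda>\<sigma> i. val app con e (\<theta> \<sigma> i)) \<phi>"
proof (induction \<phi> arbitrary: e \<theta>)
  case (Forall \<rho> \<phi>)
  have "(\<lambda>\<sigma> i. val app con (cons_subst \<rho> x e) (under \<rho> \<theta> \<sigma> i)) =
      cons_subst \<rho> x (\<lambda>\<sigma> i. val app con e (\<theta> \<sigma> i))" for x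
    by (intro ext) (auto simp: under_def cons_subst_def[of _ _ "\<lambda>\<sigma> i. val app con e (\<theta> \<sigma> i)"] split: nat.split)
  then show ?case using Forall by simp
qed (auto simp: val_subst)

subsection \<open>Models of the theory\<close>

primrec default_tm :: "ty \<Rightarrow> tm" where
  "default_tm N = Zero"
| "default_tm (\<rho> \<Rrightarrow> \<tau>) = CPi \<tau> \<rho> \<cdot> default_tm \<tau>"

lemma default_tm: "has_type (default_tm \<rho>) \<rho>" "closed_tm (default_tm \<rho>)"
  by (induction \<rho>) auto

context ext_structure
begin

abbreviation vl :: "(ty \<Rightarrow> nat \<Rightarrow> 'a) \<Rightarrow> tm \<Rightarrow> 'a" where "vl \<equiv> val app con"

lemma val_in: "env_in D e \<Longrightarrow> has_type t \<rho> \<Longrightarrow> vl e t \<in> D \<rho>"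
  by (induction t arbitrary: \<rho>) (auto simp: env_in_def con_in intro: app_in)

lemma val_closed_in: "has_type t \<rho> \<Longrightarrow> closed_tm t \<Longrightarrow> vl e t \<in> D \<rho>"
  by (induction t arbitrary: \<rho>) (auto simp: con_in intro: app_in)

text \<open>The default terms are closed, so \<open>undefined\<close> is never read.\<close>

definition env0 :: "ty \<Rightarrow> nat \<Rightarrow> 'a" where
  "env0 \<rho> i = vl undefined (default_tm \<rho>)"

lemma env0_in [simp]: "env_in D env0"
  by (simp add: env_in_def env0_def default_tm val_closed_in)

lemma sat_eq_at:
  "env_in D e \<Longrightarrow> has_type s \<rho> \<Longrightarrow> has_type t \<rho> \<Longrightarrow> sat D app con e (eq_at \<rho> s t) \<longleftrightarrow> vl e s = vl e t"
proof (induction \<rho> arbitrary: e s t)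
  case (Arr \<rho> \<tau>)
  have "sat D app con (cons_subst \<rho> x e) (eq_at \<tau> (lift_tm \<rho> s \<cdot> Var \<rho> 0) (lift_tm \<rho> t \<cdot> Var \<rho> 0)) \<longleftrightarrow>
      app (vl e s) x = app (vl e t) x" if "x \<in> D \<rho>" for x
    using Arr.prems that
    by (subst Arr.IH(2)) (auto simp: env_in_cons intro: has_type_subst wt_shift)
  then have "sat D app con e (eq_at (\<rho> \<Rrightarrow> \<tau>) s t) \<longleftrightarrow> (\<forall>x\<in>D \<rho>. app (vl e s) x = app (vl e t) x)" by simp
  then show ?case using extensional[of "vl e s" \<rho> \<tau> "vl e t"] Arr.prems val_in by auto
qed simp

end

context rca_model
begin

lemma axiom_eq_at:
  "eq_at \<rho> s t \<in> RCA0w \<Longrightarrow> has_type s \<rho> \<Longrightarrow> has_type t \<rho> \<Longrightarrow> env_in D e \<Longrightarrow> vl e s = vl e t"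
  using axioms_sat sat_eq_at by blast

text \<open>The variables get different indices so that they stay distinct when
  \<open>\<rho>\<close> and \<open>\<tau>\<close> are the same type.\<close>

lemma CPi_app: "x \<in> D \<rho> \<Longrightarrow> y \<in> D \<tau> \<Longrightarrow> app (app (con (CPi \<rho> \<tau>)) x) y = x"
  using axiom_eq_at[OF CPi_eq[of "Var \<rho> 0" \<rho> "Var \<tau> 1" \<tau>], of "upd (upd env0 \<rho> 0 x) \<tau> 1 y"]
  by (simp add: upd_def env_in_upd)

lemma CSigma_app: "f \<in> D (\<delta> \<Rrightarrow> \<rho> \<Rrightarrow> \<tau>) \<Longrightarrow> g \<in> D (\<delta> \<Rrightarrow> \<rho>) \<Longrightarrow> x \<in> D \<delta> \<Longrightarrow>
    app (app (app (con (CSigma \<delta> \<rho> \<tau>)) f) g) x = app (app f x) (app g x)"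
  using axiom_eq_at[OF CSigma_eq[of "Var (\<delta> \<Rrightarrow> \<rho> \<Rrightarrow> \<tau>) 0" \<delta> \<rho> \<tau> "Var (\<delta> \<Rrightarrow> \<rho>) 1" "Var \<delta> 2"],
      of "upd (upd (upd env0 (\<delta> \<Rrightarrow> \<rho> \<Rrightarrow> \<tau>) 0 f) (\<delta> \<Rrightarrow> \<rho>) 1 g) \<delta> 2 x"]
  by (simp add: upd_def env_in_upd)

text \<open>The beta rule for combinator terms, by which all abstractions below are
  evaluated.\<close>

lemma val_abs:
  "env_in D e \<Longrightarrow> well_typed t \<Longrightarrow> x \<in> D \<rho> \<Longrightarrow> app (vl e (abs \<rho> i t)) x = vl (upd e \<rho> i x) t"
proof (induction t)
  case (App s t)
  obtain \<sigma> \<tau> where ty: "tyof s = \<sigma> \<Rrightarrow> \<tau>" "tyof t = \<sigma>" using App.prems by (auto split: ty.splits)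
  have "vl e (abs \<rho> i s) \<in> D (\<rho> \<Rrightarrow> \<sigma> \<Rrightarrow> \<tau>)" "vl e (abs \<rho> i t) \<in> D (\<rho> \<Rrightarrow> \<sigma>)"
    using App.prems ty by (auto intro!: val_in simp: has_type_iff)
  then show ?case using App ty by (simp add: abs.simps CSigma_app)
next
  case (Var \<sigma> j)
  have "con (CPi \<rho> (\<rho> \<Rrightarrow> \<rho>)) \<in> D (\<rho> \<Rrightarrow> (\<rho> \<Rrightarrow> \<rho>) \<Rrightarrow> \<rho>)" "con (CPi \<rho> \<rho>) \<in> D (\<rho> \<Rrightarrow> \<rho> \<Rrightarrow> \<rho>)"
    by (simp_all add: con_in)
  moreover from this have "app (con (CPi \<rho> \<rho>)) x \<in> D (\<rho> \<Rrightarrow> \<rho>)" using Var by (intro app_in)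
  moreover have "e \<sigma> j \<in> D \<sigma>" using Var by (simp add: env_in_def)
  ultimately show ?case using Var by (auto simp: abs.simps const_abs_def upd_def CSigma_app CPi_app)
qed (auto simp: abs.simps const_abs_def CPi_app con_in)

lemma val_closed: "fvs t = {} \<Longrightarrow> vl e t = vl env0 t"
  by (rule val_cong) simp

abbreviation zr :: 'a where "zr \<equiv> con Zero"
abbreviation sc :: "'a \<Rightarrow> 'a" where "sc x \<equiv> app (con Succ) x"
definition rc :: "'a \<Rightarrow> 'a \<Rightarrow> 'a \<Rightarrow> 'a" where "rc n a h = app (app (app (con Rec) n) a) h"

lemma zr_in [simp]: "zr \<in> D N" by (simp add: con_in)
lemma sc_in [simp]: "x \<in> D N \<Longrightarrow> sc x \<in> D N" by (rule app_in[of _ N]) (simp_all add: con_in)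

lemma rc_in [simp]: "n \<in> D N \<Longrightarrow> a \<in> D N \<Longrightarrow> h \<in> D (N \<Rrightarrow> N \<Rrightarrow> N) \<Longrightarrow> rc n a h \<in> D N"
  unfolding rc_def
  by (rule app_in[of _ "N \<Rrightarrow> N \<Rrightarrow> N"], rule app_in[of _ N], rule app_in[of _ N]) (simp_all add: con_in)

lemma sc_nonzero [simp]: "x \<in> D N \<Longrightarrow> sc x \<noteq> zr" "x \<in> D N \<Longrightarrow> zr \<noteq> sc x"
  using axioms_sat[OF Succ_nonzero[of "Var N 0"], of "upd env0 N 0 x"]
  by (auto simp add: upd_def env_in_upd)

lemma sc_inject [simp]: "x \<in> D N \<Longrightarrow> y \<in> D N \<Longrightarrow> sc x = sc y \<longleftrightarrow> x = y"
  using axioms_sat[OF Succ_inject[of "Var N 0" "Var N 1"], of "upd (upd env0 N 0 x) N 1 y"]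
  by (auto simp add: upd_def env_in_upd)

lemma rc_zero [simp]: "a \<in> D N \<Longrightarrow> h \<in> D (N \<Rrightarrow> N \<Rrightarrow> N) \<Longrightarrow> rc zr a h = a"
  using axioms_sat[OF Rec_Zero[of "Var N 0" "Var (N \<Rrightarrow> N \<Rrightarrow> N) 0"], of "upd (upd env0 N 0 a) (N \<Rrightarrow> N \<Rrightarrow> N) 0 h"]
  by (auto simp add: upd_def env_in_upd rc_def)

lemma rc_succ [simp]: "n \<in> D N \<Longrightarrow> a \<in> D N \<Longrightarrow> h \<in> D (N \<Rrightarrow> N \<Rrightarrow> N) \<Longrightarrow> rc (sc n) a h = app (app h (rc n a h)) n"
  using axioms_sat[OF Rec_Succ[of "Var N 1" "Var N 0" "Var (N \<Rrightarrow> N \<Rrightarrow> N) 0"],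
      of "upd (upd (upd env0 N 0 a) (N \<Rrightarrow> N \<Rrightarrow> N) 0 h) N 1 n"]
  by (auto simp add: upd_def env_in_upd rc_def)

subsubsection \<open>Quantifier-free induction and choice\<close>

definition rep :: "ty \<Rightarrow> ('a \<Rightarrow> 'a) \<Rightarrow> bool" where
  "rep \<tau> f \<longleftrightarrow> (\<exists>F\<in>D (N \<Rrightarrow> \<tau>). \<forall>x\<in>D N. app F x = f x)"

lemma rep_const: "c \<in> D \<tau> \<Longrightarrow> rep \<tau> (\<lambda>x. c)"
  unfolding rep_def
  by (rule bexI[of _ "app (con (CPi \<tau> N)) c"]) (auto simp: CPi_app con_in intro!: app_in[of _ \<tau>])

lemma rep_id: "rep N (\<lambda>x. x)"
proof -
  have "vl env0 (abs N 0 (Var N 0)) \<in> D (N \<Rrightarrow> N)" by (rule val_in) (auto simp: has_type_iff)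
  then show ?thesis unfolding rep_def by (rule bexI[rotated]) (simp add: val_abs upd_def)
qed

lemma rep_app: "rep (\<sigma> \<Rrightarrow> \<tau>) f \<Longrightarrow> rep \<sigma> g \<Longrightarrow> rep \<tau> (\<lambda>x. app (f x) (g x))"
  unfolding rep_def
proof (elim bexE)
  fix F G
  assume FG: "F \<in> D (N \<Rrightarrow> \<sigma> \<Rrightarrow> \<tau>)" "\<forall>x\<in>D N. app F x = f x" "G \<in> D (N \<Rrightarrow> \<sigma>)" "\<forall>x\<in>D N. app G x = g x"
  have "con (CSigma N \<sigma> \<tau>) \<in> D ((N \<Rrightarrow> \<sigma> \<Rrightarrow> \<tau>) \<Rrightarrow> (N \<Rrightarrow> \<sigma>) \<Rrightarrow> N \<Rrightarrow> \<tau>)" by (simp add: con_in)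
  then have "app (app (con (CSigma N \<sigma> \<tau>)) F) G \<in> D (N \<Rrightarrow> \<tau>)" using FG by (blast intro: app_in)
  then show "\<exists>H\<in>D (N \<Rrightarrow> \<tau>). \<forall>x\<in>D N. app H x = app (f x) (g x)"
    by (rule bexI[rotated]) (use FG in \<open>auto simp: CSigma_app\<close>)
qed

lemma rep_rc: "rep N f \<Longrightarrow> rep N g \<Longrightarrow> h \<in> D (N \<Rrightarrow> N \<Rrightarrow> N) \<Longrightarrow> rep N (\<lambda>x. rc (f x) (g x) h)"
  unfolding rc_def
  by (rule rep_app[of "N \<Rrightarrow> N \<Rrightarrow> N"], rule rep_app[of N], rule rep_app[of N]) (auto simp: con_in intro!: rep_const)

text \<open>These are the predicates to which the induction axiom applies: parameters enter through
  the environment, and \<open>Var N 0\<close> is the argument. The closure rules that follow replace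
  writing out a formula for each induction.\<close>

definition qfp :: "('a \<Rightarrow> bool) \<Rightarrow> bool" where
  "qfp P \<longleftrightarrow> (\<exists>\<phi> e. qfree \<phi> \<and> wff \<phi> \<and> env_in D e \<and> (\<forall>x\<in>D N. P x \<longleftrightarrow> sat D app con (upd e N 0 x) \<phi>))"

lemma qfp_const: "qfp (\<lambda>x. c)"
proof -
  have "c \<longleftrightarrow> sat D app con e (if c then Falsum \<^bold>\<longrightarrow> Falsum else Falsum)" for e by simp
  then show ?thesis unfolding qfp_def
    by (intro exI[of _ "if c then Falsum \<^bold>\<longrightarrow> Falsum else Falsum"] exI[of _ env0]) auto
qed

lemma qfp_eq:
  assumes "rep N f" "rep N g"
  shows "qfp (\<lambda>x. f x = g x)"
proof -
  obtain F G where FG: "F \<in> D ty1" "\<forall>x\<in>D N. app F x = f x" "G \<in> D ty1" "\<forall>x\<in>D N. app G x = g x"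
    using assms by (auto simp: rep_def)
  show ?thesis unfolding qfp_def
    by (rule exI[of _ "Var ty1 0 \<cdot> Var N 0 \<^bold>= Var ty1 1 \<cdot> Var N 0"],
        rule exI[of _ "upd (upd env0 ty1 0 F) ty1 1 G"]) (use FG in \<open>auto simp: upd_def[abs_def] env_in_def env0_def val_closed_in default_tm\<close>)
qed

lemma qfp_imp:
  assumes "qfp P" "qfp Q"
  shows "qfp (\<lambda>x. P x \<longrightarrow> Q x)"
proof -
  obtain \<phi> e1 where 1: "qfree \<phi>" "wff \<phi>" "env_in D e1" "\<forall>x\<in>D N. P x \<longleftrightarrow> sat D app con (upd e1 N 0 x) \<phi>"
    using assms(1) by (auto simp: qfp_def)
  obtain \<psi> e2 where 2: "qfree \<psi>" "wff \<psi>" "env_in D e2" "\<forall>x\<in>D N. Q x \<longleftrightarrow> sat D app con (upd e2 N 0 x) \<psi>"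
    using assms(2) by (auto simp: qfp_def)
  \<comment> \<open>The two formulas come with different parameters, which are interleaved: those of
    \<open>\<phi>\<close> go to the even indices from 2 on, those of \<open>\<psi>\<close> to the
    odd ones. Index 0 of type \<open>N\<close> remains the common argument.\<close>
  define \<theta> where "\<theta> b \<sigma> i = Var \<sigma> (if \<sigma> = N \<and> i = 0 then 0 else 2 * i + b)" for b \<sigma> i
  define e where "e \<sigma> i = (if even i then e1 \<sigma> ((i - 2) div 2) else e2 \<sigma> (i div 2))" for \<sigma> i
  have e: "env_in D e" using 1 2 by (simp add: env_in_def e_def)
  have "(\<lambda>\<sigma> i. vl (upd e N 0 x) (\<theta> 2 \<sigma> i)) = upd e1 N 0 x" for x
    by (auto simp: fun_eq_iff \<theta>_def e_def upd_def)
  moreover have "(\<lambda>\<sigma> i. vl (upd e N 0 x) (\<theta> 1 \<sigma> i)) = upd e2 N 0 x" for x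
    by (auto simp: fun_eq_iff \<theta>_def e_def upd_def)
  moreover have "wt_subst (\<theta> b)" for b by (simp add: wt_subst_def \<theta>_def)
  ultimately show ?thesis unfolding qfp_def using 1 2 e
    by (intro exI[of _ "subst (\<theta> 2) \<phi> \<^bold>\<longrightarrow> subst (\<theta> 1) \<psi>"] exI[of _ e])
      (auto simp: qfree_subst wff_subst sat_subst)
qed

lemma qfp_not: "qfp P \<Longrightarrow> qfp (\<lambda>x. \<not> P x)"
  using qfp_imp[OF _ qfp_const[of False]] by simp

lemma qfp_disj: "qfp P \<Longrightarrow> qfp Q \<Longrightarrow> qfp (\<lambda>x. P x \<or> Q x)"
  using qfp_imp[OF qfp_not, of P Q] by (simp add: disj_imp)

lemma qfp_conj: "qfp P \<Longrightarrow> qfp Q \<Longrightarrow> qfp (\<lambda>x. P x \<and> Q x)"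
  using qfp_not[OF qfp_imp[OF _ qfp_not], of P Q] by simp

lemmas qfp_intros = qfp_eq qfp_imp qfp_not qfp_disj qfp_conj rep_const rep_id rep_app rep_rc

lemma induction_qf:
  assumes x: "x \<in> D N" and P: "qfp P" and zero: "P zr" and succ: "\<And>y. y \<in> D N \<Longrightarrow> P y \<Longrightarrow> P (sc y)"
  shows "P x"
proof -
  obtain \<phi> e where 1: "qfree \<phi>" "wff \<phi>" "env_in D e" "\<And>x. x \<in> D N \<Longrightarrow> P x \<longleftrightarrow> sat D app con (upd e N 0 x) \<phi>"
    using P by (auto simp: qfp_def)
  \<comment> \<open>Binding the induction variable shifts the entries of type \<open>N\<close> up by
    one; \<open>e'\<close> drops entry 0 in advance to compensate.\<close>
  define e' where "e' \<sigma> i = (if \<sigma> = N then e N (Suc i) else e \<sigma> i)" for \<sigma> i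
  have e': "env_in D e'" using 1 by (simp add: env_in_def e'_def)
  have cons: "cons_subst N x e' = upd e N 0 x" for x
    by (auto simp: fun_eq_iff cons_subst_def e'_def upd_def split: nat.split)
  have inst: "(\<lambda>\<sigma> i. vl e' (inst N Zero \<sigma> i)) = upd e N 0 zr"
    unfolding cons[symmetric] by (auto simp: fun_eq_iff inst_def cons_subst_def split: nat.split)
  have step: "(\<lambda>\<sigma> i. vl (upd e N 0 x) (if \<sigma> = N \<and> i = 0 then Succ \<cdot> Var N 0 else Var \<sigma> i)) = upd e N 0 (sc x)" for x
    by (auto simp: fun_eq_iff upd_def)
  show ?thesis
    using axioms_sat[OF QF_IND[OF 1(1,2)] e'] zero succ x
    by (simp add: sat_subst cons inst step 1(4)[symmetric])
qed

lemma choice_qf: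
  assumes "qfree \<phi>" "wff \<phi>" "env_in D e"
    and "\<And>f. f \<in> D ty1 \<Longrightarrow> \<exists>n\<in>D N. sat D app con (cons_subst N n (cons_subst ty1 f e)) \<phi>"
  shows "\<exists>F\<in>D ty2. \<forall>f\<in>D ty1. sat D app con (cons_subst N (app F f) (cons_subst ty1 f e)) \<phi>"
proof -
  have eq: "(\<lambda>\<sigma> i. vl (\<lambda>\<sigma> i. vl (cons_subst ty1 f (cons_subst ty2 F e)) (inst N (Var ty2 0 \<cdot> Var ty1 0) \<sigma> i)) (shift ty2 \<sigma> i))
      = cons_subst N (app F f) (cons_subst ty1 f e)" for F f
    by (auto simp: fun_eq_iff inst_def shift_def cons_subst_def split: nat.split)
  show ?thesis using axioms_sat[OF QF_AC[OF assms(1,2)] assms(3)] assms(4)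
    by (auto simp: sat_subst eq)
qed

end

subsection \<open>Arithmetic in a model\<close>

definition tm_one :: tm where "tm_one = Succ \<cdot> Zero"
text \<open>The recursor hands its step the previous value first and the index second; the
  predecessor returns the index.\<close>

definition pred_step :: tm where "pred_step = abs N 0 (abs N 1 (Var N 1))"
definition tm_pred :: "tm \<Rightarrow> tm" where "tm_pred t = Rec \<cdot> t \<cdot> Zero \<cdot> pred_step"
definition minus_step :: tm where "minus_step = abs N 0 (abs N 1 (tm_pred (Var N 0)))"
definition tm_minus :: "tm \<Rightarrow> tm \<Rightarrow> tm" where "tm_minus s t = Rec \<cdot> t \<cdot> s \<cdot> minus_step"
text \<open>Case distinction on whether \<open>r\<close> is zero: the step ignores both its
  arguments, so one unfolding already gives \<open>t\<close>.\<close>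

definition tm_cond :: "tm \<Rightarrow> tm \<Rightarrow> tm \<Rightarrow> tm" where
  "tm_cond r s t = Rec \<cdot> r \<cdot> s \<cdot> (CPi (N \<Rrightarrow> N) N \<cdot> (CPi N N \<cdot> t))"

text \<open>Terms used as truth values are true iff they have the value \<open>0\<close>.\<close>

definition tm_and :: "tm \<Rightarrow> tm \<Rightarrow> tm" where "tm_and s t = add s t"
definition tm_not :: "tm \<Rightarrow> tm" where "tm_not t = tm_minus tm_one t"
definition tm_le :: "tm \<Rightarrow> tm \<Rightarrow> tm" where "tm_le s t = tm_minus s t"
definition tm_lt :: "tm \<Rightarrow> tm \<Rightarrow> tm" where "tm_lt s t = tm_minus (Succ \<cdot> s) t"
definition tm_eq :: "tm \<Rightarrow> tm \<Rightarrow> tm" where "tm_eq s t = tm_and (tm_le s t) (tm_le t s)"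

lemma tyof_suc_step [simp]: "tyof suc_step = N \<Rrightarrow> N \<Rrightarrow> N" "well_typed suc_step" "fvs suc_step = {}"
  by (simp_all add: suc_step_def)

lemma tyof_add_step [simp]: "tyof add_step = N \<Rrightarrow> N \<Rrightarrow> N" "well_typed add_step" "fvs add_step = {}"
  by (simp_all add: add_step_def Let_def)

lemma tyof_pred_step [simp]: "tyof pred_step = N \<Rrightarrow> N \<Rrightarrow> N" "well_typed pred_step" "fvs pred_step = {}"
  by (simp_all add: pred_step_def)

lemma tyof_minus_step [simp]: "tyof minus_step = N \<Rrightarrow> N \<Rrightarrow> N" "well_typed minus_step" "fvs minus_step = {}"
  by (simp_all add: minus_step_def tm_pred_def)

lemma tyof_tm [simp]:
  "tyof (add s t) = N" "tyof (sum_below t) = N" "tyof (pair s t) = N" "tyof tm_one = N"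
  "tyof (tm_pred t) = N" "tyof (tm_minus s t) = N" "tyof (tm_cond r s t) = N"
  "tyof (tm_and s t) = N" "tyof (tm_not t) = N" "tyof (tm_le s t) = N" "tyof (tm_lt s t) = N" "tyof (tm_eq s t) = N"
  by (simp_all add: add_def sum_below_def pair_def tm_one_def tm_pred_def tm_minus_def tm_cond_def
      tm_and_def tm_not_def tm_le_def tm_lt_def tm_eq_def)

lemma well_typed_tm [simp]:
  "well_typed (add s t) \<longleftrightarrow> well_typed s \<and> well_typed t \<and> tyof s = N \<and> tyof t = N"
  "well_typed (sum_below t) \<longleftrightarrow> well_typed t \<and> tyof t = N"
  "well_typed (pair s t) \<longleftrightarrow> well_typed s \<and> well_typed t \<and> tyof s = N \<and> tyof t = N"
  "well_typed tm_one"
  "well_typed (tm_pred t) \<longleftrightarrow> well_typed t \<and> tyof t = N"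
  "well_typed (tm_minus s t) \<longleftrightarrow> well_typed s \<and> well_typed t \<and> tyof s = N \<and> tyof t = N"
  "well_typed (tm_cond r s t) \<longleftrightarrow> well_typed r \<and> well_typed s \<and> well_typed t \<and> tyof r = N \<and> tyof s = N \<and> tyof t = N"
  "well_typed (tm_and s t) \<longleftrightarrow> well_typed s \<and> well_typed t \<and> tyof s = N \<and> tyof t = N"
  "well_typed (tm_not t) \<longleftrightarrow> well_typed t \<and> tyof t = N"
  "well_typed (tm_le s t) \<longleftrightarrow> well_typed s \<and> well_typed t \<and> tyof s = N \<and> tyof t = N"
  "well_typed (tm_lt s t) \<longleftrightarrow> well_typed s \<and> well_typed t \<and> tyof s = N \<and> tyof t = N"
  "well_typed (tm_eq s t) \<longleftrightarrow> well_typed s \<and> well_typed t \<and> tyof s = N \<and> tyof t = N"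
  by (auto simp: add_def sum_below_def pair_def tm_one_def tm_pred_def tm_minus_def tm_cond_def
      tm_and_def tm_not_def tm_le_def tm_lt_def tm_eq_def)

lemma fvs_tm [simp]:
  "fvs (add s t) = fvs s \<union> fvs t" "fvs (sum_below t) = fvs t" "fvs (pair s t) = fvs s \<union> fvs t" "fvs tm_one = {}"
  "fvs (tm_pred t) = fvs t" "fvs (tm_minus s t) = fvs s \<union> fvs t" "fvs (tm_cond r s t) = fvs r \<union> fvs s \<union> fvs t"
  "fvs (tm_and s t) = fvs s \<union> fvs t" "fvs (tm_not t) = fvs t" "fvs (tm_le s t) = fvs s \<union> fvs t"
  "fvs (tm_lt s t) = fvs s \<union> fvs t" "fvs (tm_eq s t) = fvs s \<union> fvs t"
  by (auto simp: add_def sum_below_def pair_def tm_one_def tm_pred_def tm_minus_def tm_cond_def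
      tm_and_def tm_not_def tm_le_def tm_lt_def tm_eq_def)

context rca_model
begin

lemma val_closed_step:
  assumes "fvs t = {}" "well_typed t" "tyof t = N \<Rrightarrow> N \<Rrightarrow> N"
  shows "vl env0 t \<in> D (N \<Rrightarrow> N \<Rrightarrow> N)"
  using assms by (intro val_in) (auto simp: has_type_iff)

lemma step_in [simp]:
  "vl env0 suc_step \<in> D (N \<Rrightarrow> N \<Rrightarrow> N)" "vl env0 add_step \<in> D (N \<Rrightarrow> N \<Rrightarrow> N)"
  "vl env0 pred_step \<in> D (N \<Rrightarrow> N \<Rrightarrow> N)" "vl env0 minus_step \<in> D (N \<Rrightarrow> N \<Rrightarrow> N)"
  by (simp_all add: val_closed_step)

definition pl :: "'a \<Rightarrow> 'a \<Rightarrow> 'a" where "pl x y = rc y x (vl env0 suc_step)"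
definition pd :: "'a \<Rightarrow> 'a" where "pd x = rc x zr (vl env0 pred_step)"
definition mn :: "'a \<Rightarrow> 'a \<Rightarrow> 'a" where "mn x y = rc y x (vl env0 minus_step)"
definition tri :: "'a \<Rightarrow> 'a" where "tri x = rc x zr (vl env0 add_step)"
definition pr :: "'a \<Rightarrow> 'a \<Rightarrow> 'a" where "pr x y = pl (tri (sc (pl x y))) x"
text \<open>An equation instead of the existential formula \<open>less\<close>, so that comparisons
  may occur in quantifier-free inductions; \<open>sat_less\<close> reconciles the two.\<close>

definition le :: "'a \<Rightarrow> 'a \<Rightarrow> bool" where "le x y \<longleftrightarrow> mn x y = zr"
definition lt :: "'a \<Rightarrow> 'a \<Rightarrow> bool" where "lt x y \<longleftrightarrow> le (sc x) y"

lemma arith_in [simp]: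
  "x \<in> D N \<Longrightarrow> y \<in> D N \<Longrightarrow> pl x y \<in> D N"
  "x \<in> D N \<Longrightarrow> pd x \<in> D N"
  "x \<in> D N \<Longrightarrow> y \<in> D N \<Longrightarrow> mn x y \<in> D N"
  "x \<in> D N \<Longrightarrow> tri x \<in> D N"
  by (simp_all add: pl_def pd_def mn_def tri_def)

lemma pr_in [simp]: "x \<in> D N \<Longrightarrow> y \<in> D N \<Longrightarrow> pr x y \<in> D N"
  by (simp add: pr_def)

lemma rep_arith:
  "rep N f \<Longrightarrow> rep N (\<lambda>x. sc (f x))"
  "rep N f \<Longrightarrow> rep N g \<Longrightarrow> rep N (\<lambda>x. pl (f x) (g x))"
  "rep N f \<Longrightarrow> rep N (\<lambda>x. pd (f x))"
  "rep N f \<Longrightarrow> rep N g \<Longrightarrow> rep N (\<lambda>x. mn (f x) (g x))"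
  "rep N f \<Longrightarrow> rep N (\<lambda>x. tri (f x))"
  "rep N f \<Longrightarrow> rep N g \<Longrightarrow> qfp (\<lambda>x. le (f x) (g x))"
  unfolding pl_def pd_def mn_def tri_def le_def
  by (intro qfp_intros; simp add: con_in)+

lemma rep_arith2:
  "rep N f \<Longrightarrow> rep N g \<Longrightarrow> rep N (\<lambda>x. pr (f x) (g x))"
  "rep N f \<Longrightarrow> rep N g \<Longrightarrow> qfp (\<lambda>x. lt (f x) (g x))"
  unfolding pr_def lt_def by (intro rep_arith; assumption)+

lemmas qf_intros = qfp_eq qfp_imp qfp_not qfp_disj qfp_conj rep_const rep_id rep_arith rep_arith2 rep_rc

lemma suc_step_app: "u \<in> D N \<Longrightarrow> v \<in> D N \<Longrightarrow> app (app (vl env0 suc_step) u) v = sc u"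
proof -
  assume uv: "u \<in> D N" "v \<in> D N"
  have "con (CPi N N) \<in> D (N \<Rrightarrow> N \<Rrightarrow> N)" "con Succ \<in> D (N \<Rrightarrow> N)" by (simp_all add: con_in)
  moreover from this have "app (con (CPi (N \<Rrightarrow> N \<Rrightarrow> N) N)) (con (CPi N N)) \<in> D (N \<Rrightarrow> N \<Rrightarrow> N \<Rrightarrow> N)"
    by (intro app_in[of _ "N \<Rrightarrow> N \<Rrightarrow> N"]) (simp_all add: con_in)
  ultimately show ?thesis using uv by (simp add: suc_step_def CSigma_app CPi_app)
qed

lemma pl_zero_right [simp]: "x \<in> D N \<Longrightarrow> pl x zr = x"
  by (simp add: pl_def)

lemma pl_succ_right [simp]: "x \<in> D N \<Longrightarrow> y \<in> D N \<Longrightarrow> pl x (sc y) = sc (pl x y)"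
  by (simp add: pl_def suc_step_app)

lemma add_step_app: "u \<in> D N \<Longrightarrow> v \<in> D N \<Longrightarrow> app (app (vl env0 add_step) u) v = pl v u"
proof -
  assume uv: "u \<in> D N" "v \<in> D N"
  let ?A = "N \<Rrightarrow> N \<Rrightarrow> N" and ?ss = "vl env0 suc_step"
  let ?S = "con (CSigma N ?A N)" and ?K = "con (CPi ((N \<Rrightarrow> ?A \<Rrightarrow> N) \<Rrightarrow> (N \<Rrightarrow> ?A) \<Rrightarrow> N \<Rrightarrow> N) N)"
  have S: "?S \<in> D ((N \<Rrightarrow> ?A \<Rrightarrow> N) \<Rrightarrow> (N \<Rrightarrow> ?A) \<Rrightarrow> N \<Rrightarrow> N)" by (simp add: con_in)
  have KS: "app ?K ?S \<in> D (N \<Rrightarrow> (N \<Rrightarrow> ?A \<Rrightarrow> N) \<Rrightarrow> (N \<Rrightarrow> ?A) \<Rrightarrow> N \<Rrightarrow> N)"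
    by (rule app_in[OF _ S]) (simp add: con_in)
  have R: "con Rec \<in> D (N \<Rrightarrow> N \<Rrightarrow> ?A \<Rrightarrow> N)" by (simp add: con_in)
  then have Ru: "app (con Rec) u \<in> D (N \<Rrightarrow> ?A \<Rrightarrow> N)" using uv by (intro app_in)
  have C: "app (con (CPi ?A N)) ?ss \<in> D (N \<Rrightarrow> ?A)" by (rule app_in[of _ ?A]) (simp_all add: con_in)
  have CC: "app (con (CPi (N \<Rrightarrow> ?A) N)) (app (con (CPi ?A N)) ?ss) \<in> D (N \<Rrightarrow> N \<Rrightarrow> ?A)"
    by (rule app_in[OF _ C]) (simp add: con_in)
  have T: "app (app (con (CSigma N (N \<Rrightarrow> ?A \<Rrightarrow> N) ((N \<Rrightarrow> ?A) \<Rrightarrow> N \<Rrightarrow> N))) (app ?K ?S)) (con Rec)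
      \<in> D (N \<Rrightarrow> (N \<Rrightarrow> ?A) \<Rrightarrow> N \<Rrightarrow> N)"
    by (rule app_in[OF app_in[OF _ KS] R]) (simp add: con_in)
  show ?thesis using uv S KS R Ru C CC T
    by (simp add: add_step_def Let_def CSigma_app CPi_app pl_def rc_def)
qed

lemma tri_zero [simp]: "tri zr = zr"
  by (simp add: tri_def)

lemma tri_succ [simp]: "x \<in> D N \<Longrightarrow> tri (sc x) = pl x (tri x)"
  by (simp add: tri_def add_step_app)

lemma pd_zero [simp]: "pd zr = zr"
  by (simp add: pd_def)

lemma pd_succ [simp]: "x \<in> D N \<Longrightarrow> pd (sc x) = x"
proof -
  have "app (app (vl env0 pred_step) u) v = v" if "u \<in> D N" "v \<in> D N" for u v
    using that by (simp add: pred_step_def val_abs upd_def)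
  then show "x \<in> D N \<Longrightarrow> pd (sc x) = x" by (simp add: pd_def)
qed

lemma val_tm_pred: "vl e (tm_pred t) = pd (vl e t)"
  by (simp add: tm_pred_def pd_def rc_def val_closed[of _ e])

lemma mn_zero_right [simp]: "x \<in> D N \<Longrightarrow> mn x zr = x"
  by (simp add: mn_def)

lemma mn_succ_right: "x \<in> D N \<Longrightarrow> y \<in> D N \<Longrightarrow> mn x (sc y) = pd (mn x y)"
proof -
  have "app (app (vl env0 minus_step) u) v = pd u" if "u \<in> D N" "v \<in> D N" for u v
    using that by (simp add: minus_step_def val_abs upd_def val_tm_pred)
  then show "x \<in> D N \<Longrightarrow> y \<in> D N \<Longrightarrow> mn x (sc y) = pd (mn x y)" by (simp add: mn_def)
qed

section \<open>Laws of addition, truncated subtraction and the order\<close>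

lemma zero_or_succ: "x \<in> D N \<Longrightarrow> x = zr \<or> x = sc (pd x)"
  by (rule induction_qf[where P = "\<lambda>x. x = zr \<or> x = sc (pd x)"]) (assumption | (intro qf_intros; simp) | simp)+

lemma nat_cases: "x \<in> D N \<Longrightarrow> (x = zr \<Longrightarrow> P) \<Longrightarrow> (\<And>y. y \<in> D N \<Longrightarrow> x = sc y \<Longrightarrow> P) \<Longrightarrow> P"
  using zero_or_succ arith_in(2) by blast

lemma pl_zero_left [simp]: "x \<in> D N \<Longrightarrow> pl zr x = x"
  by (rule induction_qf[where P = "\<lambda>x. pl zr x = x"]) (assumption | (intro qf_intros; simp) | simp)+

lemma pl_succ_left [simp]: "x \<in> D N \<Longrightarrow> y \<in> D N \<Longrightarrow> pl (sc x) y = sc (pl x y)"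
  by (rule induction_qf[where P = "\<lambda>y. pl (sc x) y = sc (pl x y)"]) (assumption | (intro qf_intros; simp) | simp)+

lemma pl_comm: "x \<in> D N \<Longrightarrow> y \<in> D N \<Longrightarrow> pl x y = pl y x"
  by (rule induction_qf[where P = "\<lambda>y. pl x y = pl y x"]) (assumption | (intro qf_intros; simp) | simp)+

lemma pl_assoc: "x \<in> D N \<Longrightarrow> y \<in> D N \<Longrightarrow> z \<in> D N \<Longrightarrow> pl (pl x y) z = pl x (pl y z)"
  by (rule induction_qf[where P = "\<lambda>z. pl (pl x y) z = pl x (pl y z)"]) (assumption | (intro qf_intros; simp) | simp)+

lemma pl_left_cancel: "x \<in> D N \<Longrightarrow> y \<in> D N \<Longrightarrow> z \<in> D N \<Longrightarrow> pl z x = pl z y \<longleftrightarrow> x = y"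
proof -
  assume x: "x \<in> D N" and y: "y \<in> D N" and z: "z \<in> D N"
  have "pl z x = pl z y \<longrightarrow> x = y"
    by (rule induction_qf[where P = "\<lambda>z. pl z x = pl z y \<longrightarrow> x = y", OF z])
      (use x y in \<open>(intro qf_intros; simp) | simp\<close>)+
  then show ?thesis by blast
qed

lemma pl_eq_zero [simp]: "x \<in> D N \<Longrightarrow> y \<in> D N \<Longrightarrow> pl x y = zr \<longleftrightarrow> x = zr \<and> y = zr"
  by (cases y rule: nat_cases) auto

lemma mn_succ_succ [simp]: "x \<in> D N \<Longrightarrow> y \<in> D N \<Longrightarrow> mn (sc x) (sc y) = mn x y"
  by (rule induction_qf[where P = "\<lambda>y. mn (sc x) (sc y) = mn x y"])
    (assumption | (intro qf_intros; simp) | simp add: mn_succ_right)+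

lemma mn_self: "x \<in> D N \<Longrightarrow> mn x x = zr"
  by (rule induction_qf[where P = "\<lambda>x. mn x x = zr"]) (assumption | (intro qf_intros; simp) | simp)+

lemma mn_zero_left [simp]: "x \<in> D N \<Longrightarrow> mn zr x = zr"
  by (rule induction_qf[where P = "\<lambda>x. mn zr x = zr"]) (assumption | (intro qf_intros; simp) | simp add: mn_succ_right)+

lemma mn_pl: "x \<in> D N \<Longrightarrow> y \<in> D N \<Longrightarrow> mn (pl x y) x = y"
  by (rule induction_qf[where P = "\<lambda>x. mn (pl x y) x = y"]) (assumption | (intro qf_intros; simp) | simp)+

lemma le_pl: "x \<in> D N \<Longrightarrow> y \<in> D N \<Longrightarrow> le x (pl x y)"
  by (rule induction_qf[where P = "\<lambda>x. le x (pl x y)"]) (assumption | (intro qf_intros; simp) | simp add: le_def)+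

lemma pd_mn_succ: "x \<in> D N \<Longrightarrow> y \<in> D N \<Longrightarrow> pd (mn (sc x) y) = mn x y"
  by (cases y rule: nat_cases) (simp_all add: mn_succ_right[of x])

text \<open>Turns the equation behind \<open>le\<close> into an additive witness. In the induction
  on \<open>y\<close>, a zero difference \<open>mn x y\<close> would mean \<open>y = x\<close>, and
  then \<open>sc y\<close> is not below \<open>x\<close>; otherwise one unit moves from the
  difference to \<open>y\<close>.\<close>

lemma le_pl_mn:
  assumes "x \<in> D N" "y \<in> D N" "le y x" shows "pl y (mn x y) = x"
proof -
  have "le y x \<longrightarrow> pl y (mn x y) = x"
  proof (rule induction_qf[where P = "\<lambda>y. le y x \<longrightarrow> pl y (mn x y) = x"])
    show "qfp (\<lambda>y. le y x \<longrightarrow> pl y (mn x y) = x)" using assms by (intro qf_intros)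
  next
    fix y assume y: "y \<in> D N" and IH: "le y x \<longrightarrow> pl y (mn x y) = x"
    show "le (sc y) x \<longrightarrow> pl (sc y) (mn x (sc y)) = x"
    proof
      assume l: "le (sc y) x"
      then have "le y x" using pd_mn_succ[of y x] y assms by (simp add: le_def)
      then have eq: "pl y (mn x y) = x" using IH by blast
      show "pl (sc y) (mn x (sc y)) = x"
      proof (cases "mn x y" rule: nat_cases)
        case 2
        then have "y = x" using eq y by simp
        moreover have "mn (sc y) y = sc zr" using mn_pl[of y "sc zr"] y by simp
        ultimately show ?thesis using l by (simp add: le_def)
      next
        case (3 u)
        then show ?thesis using eq y assms by (simp add: mn_succ_right)
      qed (use y assms in simp)
    qed
  qed (use assms in simp_all)
  then show ?thesis using assms by blast
qed

lemma le_iff_pl: "x \<in> D N \<Longrightarrow> y \<in> D N \<Longrightarrow> le x y \<longleftrightarrow> (\<exists>z\<in>D N. pl x z = y)"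
  using le_pl_mn[of y x] le_pl[of x] by auto

lemma le_refl [simp]: "x \<in> D N \<Longrightarrow> le x x"
  by (simp add: le_def mn_self)

lemma le_zero_left [simp]: "x \<in> D N \<Longrightarrow> le zr x"
  by (simp add: le_def)

lemma le_trans: "le x y \<Longrightarrow> le y z \<Longrightarrow> x \<in> D N \<Longrightarrow> y \<in> D N \<Longrightarrow> z \<in> D N \<Longrightarrow> le x z"
  by (auto simp: le_iff_pl pl_assoc)

lemma le_antisym: "le x y \<Longrightarrow> le y x \<Longrightarrow> x \<in> D N \<Longrightarrow> y \<in> D N \<Longrightarrow> x = y"
proof -
  assume xy: "x \<in> D N" "y \<in> D N" and "le x y" "le y x"
  then obtain z w where z: "z \<in> D N" "pl x z = y" and w: "w \<in> D N" "pl y w = x" by (auto simp: le_iff_pl)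
  then have "pl x (pl z w) = pl x zr" using xy by (simp add: pl_assoc[symmetric])
  then have "pl z w = zr" using xy z w pl_left_cancel[of "pl z w" zr x] by simp
  then show "x = y" using z w xy by simp
qed

lemma le_succ_succ [simp]: "x \<in> D N \<Longrightarrow> y \<in> D N \<Longrightarrow> le (sc x) (sc y) \<longleftrightarrow> le x y"
  by (simp add: le_def)

lemma le_total: "x \<in> D N \<Longrightarrow> y \<in> D N \<Longrightarrow> le x y \<or> le y x"
proof (rule induction_qf[where P = "\<lambda>x. le x y \<or> le y x"])
  fix x assume xy: "x \<in> D N" "y \<in> D N" and "le x y \<or> le y x"
  then consider z where "z \<in> D N" "y = pl x z" | z where "z \<in> D N" "x = pl y z" using le_iff_pl by metis
  then show "le (sc x) y \<or> le y (sc x)"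
  proof cases
    case (1 z)
    then show ?thesis
    proof (cases z rule: nat_cases)
      case 2
      then show ?thesis using 1 xy le_pl[of x "sc zr"] by simp
    next
      case (3 u)
      then show ?thesis using 1 xy le_pl[of "sc x" u] by simp
    qed simp
  next
    case (2 z)
    then show ?thesis using xy le_pl[of y "sc z"] by simp
  qed
qed (assumption | (intro qf_intros; simp) | simp)+

lemma le_succ_self: "x \<in> D N \<Longrightarrow> le x (sc x)"
  using le_pl[of x "sc zr"] by simp

lemma not_succ_le: "x \<in> D N \<Longrightarrow> \<not> le (sc x) x"
proof
  assume x: "x \<in> D N" and "le (sc x) x"
  then obtain z where "z \<in> D N" "pl (sc x) z = x" by (auto simp: le_iff_pl)
  then have "pl x (sc z) = pl x zr" using x by simp
  then show False using x \<open>z \<in> D N\<close> pl_left_cancel[of "sc z" zr x] by simp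
qed

lemma not_le: "x \<in> D N \<Longrightarrow> y \<in> D N \<Longrightarrow> \<not> le x y \<longleftrightarrow> lt y x"
proof -
  assume xy: "x \<in> D N" "y \<in> D N"
  have "le x y" if "\<not> lt y x"
  proof (rule ccontr)
    assume n: "\<not> le x y"
    then obtain z where z: "z \<in> D N" "x = pl y z" using le_total[of x y] xy le_iff_pl[of y x] by auto
    then show False using n that xy le_pl[of "sc y" "pd z"]
      by (cases z rule: nat_cases) (auto simp: lt_def)
  qed
  moreover have "\<not> (le x y \<and> lt y x)"
    unfolding lt_def using le_trans[of "sc y" x y] not_succ_le[of y] xy by auto
  ultimately show ?thesis by blast
qed

lemma lt_irrefl [simp]: "x \<in> D N \<Longrightarrow> \<not> lt x x"
  by (simp add: lt_def not_succ_le)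

lemma lt_imp_le: "lt x y \<Longrightarrow> x \<in> D N \<Longrightarrow> y \<in> D N \<Longrightarrow> le x y"
  unfolding lt_def by (rule le_trans[OF le_succ_self]) simp_all

lemma le_lt_trans: "le x y \<Longrightarrow> lt y z \<Longrightarrow> x \<in> D N \<Longrightarrow> y \<in> D N \<Longrightarrow> z \<in> D N \<Longrightarrow> lt x z"
  unfolding lt_def by (rule le_trans[of _ "sc y"]) simp_all

lemma lt_le_trans: "lt x y \<Longrightarrow> le y z \<Longrightarrow> x \<in> D N \<Longrightarrow> y \<in> D N \<Longrightarrow> z \<in> D N \<Longrightarrow> lt x z"
  unfolding lt_def by (rule le_trans[of _ y]) simp_all

lemma lt_trans: "lt x y \<Longrightarrow> lt y z \<Longrightarrow> x \<in> D N \<Longrightarrow> y \<in> D N \<Longrightarrow> z \<in> D N \<Longrightarrow> lt x z"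
  using lt_le_trans lt_imp_le by blast

lemma lt_iff_pl: "x \<in> D N \<Longrightarrow> y \<in> D N \<Longrightarrow> lt x y \<longleftrightarrow> (\<exists>z\<in>D N. pl x (sc z) = y)"
  by (auto simp: lt_def le_iff_pl)

lemma pl_le_mono: "le x y \<Longrightarrow> x \<in> D N \<Longrightarrow> y \<in> D N \<Longrightarrow> z \<in> D N \<Longrightarrow> le (pl z x) (pl z y)"
  by (auto simp: le_iff_pl pl_assoc intro!: bexI)

subsubsection \<open>Values of terms\<close>

lemma val_arith [simp]:
  "vl e (add s t) = pl (vl e s) (vl e t)"
  "vl e (sum_below t) = tri (vl e t)"
  "vl e (pair s t) = pr (vl e s) (vl e t)"
  "vl e (tm_pred t) = pd (vl e t)"
  "vl e (tm_minus s t) = mn (vl e s) (vl e t)"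
  by (simp_all add: add_def sum_below_def pair_def tm_minus_def val_tm_pred pl_def tri_def pr_def mn_def rc_def
      val_closed[of _ e])

lemma val_N_in: "env_in D e \<Longrightarrow> well_typed t \<Longrightarrow> tyof t = N \<Longrightarrow> vl e t \<in> D N"
  by (rule val_in) (auto simp: has_type_iff)

lemma val_cond:
  assumes "env_in D e" "well_typed (tm_cond r s t)"
  shows "vl e (tm_cond r s t) = (if vl e r = zr then vl e s else vl e t)"
proof -
  have rst: "vl e r \<in> D N" "vl e s \<in> D N" "vl e t \<in> D N"
    using assms by (simp_all add: val_N_in)
  let ?h = "app (con (CPi (N \<Rrightarrow> N) N)) (app (con (CPi N N)) (vl e t))"
  have 1: "app (con (CPi N N)) (vl e t) \<in> D (N \<Rrightarrow> N)" by (rule app_in[OF _ rst(3)]) (simp add: con_in)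
  have h: "?h \<in> D (N \<Rrightarrow> N \<Rrightarrow> N)" by (rule app_in[OF _ 1]) (simp add: con_in)
  have "vl e (tm_cond r s t) = rc (vl e r) (vl e s) ?h" by (simp add: tm_cond_def rc_def)
  also have "\<dots> = (if vl e r = zr then vl e s else vl e t)"
    by (cases "vl e r" rule: nat_cases) (use rst h 1 in \<open>simp_all add: CPi_app\<close>)
  finally show ?thesis .
qed

lemma val_truth:
  assumes "env_in D e"
  shows "well_typed (tm_and s t) \<Longrightarrow> vl e (tm_and s t) = zr \<longleftrightarrow> vl e s = zr \<and> vl e t = zr"
    and "well_typed (tm_not t) \<Longrightarrow> vl e (tm_not t) = zr \<longleftrightarrow> vl e t \<noteq> zr"
    and "vl e (tm_le s t) = zr \<longleftrightarrow> le (vl e s) (vl e t)"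
    and "vl e (tm_lt s t) = zr \<longleftrightarrow> lt (vl e s) (vl e t)"
    and "well_typed (tm_eq s t) \<Longrightarrow> vl e (tm_eq s t) = zr \<longleftrightarrow> vl e s = vl e t"
proof -
  show and_iff: "vl e (tm_and s t) = zr \<longleftrightarrow> vl e s = zr \<and> vl e t = zr" if "well_typed (tm_and s t)" for s t
    using assms that by (simp add: tm_and_def val_N_in)
  show "vl e (tm_not t) = zr \<longleftrightarrow> vl e t \<noteq> zr" if "well_typed (tm_not t)"
  proof -
    have "vl e t \<in> D N" using assms that by (simp add: val_N_in)
    then show ?thesis by (cases "vl e t" rule: nat_cases) (simp_all add: tm_not_def tm_one_def)
  qed
  show le_iff: "vl e (tm_le s t) = zr \<longleftrightarrow> le (vl e s) (vl e t)" for s t by (simp add: tm_le_def le_def)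
  show "vl e (tm_lt s t) = zr \<longleftrightarrow> lt (vl e s) (vl e t)" by (simp add: tm_lt_def lt_def le_def)
  show "vl e (tm_eq s t) = zr \<longleftrightarrow> vl e s = vl e t" if "well_typed (tm_eq s t)"
    using assms that le_antisym[of "vl e s" "vl e t"] by (auto simp: tm_eq_def and_iff le_iff val_N_in)
qed

lemma sat_less:
  assumes "env_in D e" "has_type s N" "has_type t N"
  shows "sat D app con e (less s t) \<longleftrightarrow> lt (vl e s) (vl e t)"
  using assms by (simp add: less_def lt_iff_pl val_in del: pl_succ_right)

end

subsubsection \<open>Inverting the pairing function\<close>

text \<open>Runs along Cantor's enumeration with the current diagonal \<open>u\<close> as state:
  passing to the code \<open>v + 1\<close> moves on to diagonal \<open>u + 1\<close> once its first
  code, \<open>sum_below (u + 2)\<close>, is reached.\<close>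

definition diag_step :: tm where
  "diag_step = abs N 0 (abs N 1 (tm_cond (tm_le (sum_below (Succ \<cdot> (Succ \<cdot> Var N 0))) (Succ \<cdot> Var N 1))
     (Succ \<cdot> Var N 0) (Var N 0)))"

definition tm_diag :: "tm \<Rightarrow> tm" where "tm_diag t = Rec \<cdot> t \<cdot> Zero \<cdot> diag_step"
definition tm_fst :: "tm \<Rightarrow> tm" where "tm_fst t = tm_minus t (sum_below (Succ \<cdot> tm_diag t))"
definition tm_snd :: "tm \<Rightarrow> tm" where "tm_snd t = tm_minus (tm_diag t) (tm_fst t)"

lemma tyof_diag_step [simp]: "tyof diag_step = N \<Rrightarrow> N \<Rrightarrow> N" "well_typed diag_step" "fvs diag_step = {}"
  by (simp_all add: diag_step_def, auto)

lemma tyof_fst_snd [simp]: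
  "tyof (tm_fst t) = N" "tyof (tm_snd t) = N"
  "well_typed (tm_fst t) \<longleftrightarrow> well_typed t \<and> tyof t = N"
  "well_typed (tm_snd t) \<longleftrightarrow> well_typed t \<and> tyof t = N"
  "fvs (tm_fst t) = fvs t" "fvs (tm_snd t) = fvs t"
  by (auto simp: tm_fst_def tm_snd_def tm_diag_def)

context rca_model
begin

definition dg :: "'a \<Rightarrow> 'a" where "dg x = rc x zr (vl env0 diag_step)"
definition p1 :: "'a \<Rightarrow> 'a" where "p1 x = mn x (tri (sc (dg x)))"
definition p2 :: "'a \<Rightarrow> 'a" where "p2 x = mn (dg x) (p1 x)"

lemma val_fst_snd [simp]: "vl e (tm_fst t) = p1 (vl e t)" "vl e (tm_snd t) = p2 (vl e t)"
  by (simp_all add: tm_fst_def tm_snd_def tm_diag_def p1_def p2_def dg_def rc_def val_closed[of _ e])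

lemma diag_step_in [simp]: "vl env0 diag_step \<in> D (N \<Rrightarrow> N \<Rrightarrow> N)"
  by (simp add: val_closed_step)

lemma dg_in [simp]: "x \<in> D N \<Longrightarrow> dg x \<in> D N"
  by (simp add: dg_def)

lemma p_in [simp]: "x \<in> D N \<Longrightarrow> p1 x \<in> D N" "x \<in> D N \<Longrightarrow> p2 x \<in> D N"
  by (simp_all add: p1_def p2_def)

lemma dg_zero [simp]: "dg zr = zr"
  by (simp add: dg_def)

lemma dg_succ:
  "x \<in> D N \<Longrightarrow> dg (sc x) = (if le (tri (sc (sc (dg x)))) (sc x) then sc (dg x) else dg x)"
proof -
  have "app (app (vl env0 diag_step) u) v = (if le (tri (sc (sc u))) (sc v) then sc u else u)"
    if "u \<in> D N" "v \<in> D N" for u v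
    using that by (simp add: diag_step_def val_abs val_cond val_truth upd_def del: tri_succ)
  then show "x \<in> D N \<Longrightarrow> dg (sc x) = (if le (tri (sc (sc (dg x)))) (sc x) then sc (dg x) else dg x)"
    by (simp add: dg_def del: tri_succ)
qed

lemma rep_dg: "rep N f \<Longrightarrow> rep N (\<lambda>x. dg (f x))"
  unfolding dg_def by (intro rep_rc rep_const) simp_all

lemma dg_bounds: "x \<in> D N \<Longrightarrow> le (tri (sc (dg x))) x \<and> lt x (tri (sc (sc (dg x))))"
proof (rule induction_qf[where P = "\<lambda>x. le (tri (sc (dg x))) x \<and> lt x (tri (sc (sc (dg x))))"])
  show "qfp (\<lambda>x. le (tri (sc (dg x))) x \<and> lt x (tri (sc (sc (dg x)))))"
    by (intro qf_intros rep_dg)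
next
  fix x assume x: "x \<in> D N" and IH: "le (tri (sc (dg x))) x \<and> lt x (tri (sc (sc (dg x))))"
  show "le (tri (sc (dg (sc x)))) (sc x) \<and> lt (sc x) (tri (sc (sc (dg (sc x)))))"
  proof (cases "le (tri (sc (sc (dg x)))) (sc x)")
    case True
    let ?t = "tri (sc (sc (dg x)))"
    have t: "?t \<in> D N" using x by simp
    \<comment> \<open>By the induction hypothesis \<open>sc x\<close> is at most \<open>?t\<close>,
      and the diagonal starting at \<open>?t\<close> is not empty.\<close>
    have "lt (sc x) (pl (sc (sc (dg x))) ?t)"
      using IH x t le_pl[of ?t "sc (dg x)"] le_trans[of "sc x" ?t "pl ?t (sc (dg x))"]
        pl_comm[of "sc (dg x)" ?t] unfolding lt_def by (simp del: tri_succ)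
    moreover have "tri (sc (sc (sc (dg x)))) = pl (sc (sc (dg x))) ?t" using x by (simp only: tri_succ sc_in dg_in)
    moreover have "dg (sc x) = sc (dg x)" using True x by (simp add: dg_succ del: tri_succ)
    ultimately show ?thesis using True by (simp del: tri_succ)
  next
    case False
    then have "dg (sc x) = dg x" using x by (simp add: dg_succ del: tri_succ)
    moreover have "lt (sc x) (tri (sc (sc (dg x))))" using False x not_le by (simp del: tri_succ)
    moreover have "le (tri (sc (dg x))) (sc x)"
      using IH x le_trans[OF _ le_succ_self[of x]] by (simp del: tri_succ)
    ultimately show ?thesis by (simp del: tri_succ)
  qed
qed (simp_all add: lt_def)

lemma tri_mono: "le x y \<Longrightarrow> x \<in> D N \<Longrightarrow> y \<in> D N \<Longrightarrow> le (tri x) (tri y)"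
proof -
  assume xy: "x \<in> D N" "y \<in> D N" and "le x y"
  then obtain z where z: "z \<in> D N" "y = pl x z" by (auto simp: le_iff_pl)
  have "le (tri x) (tri (pl x z))"
  proof (rule induction_qf[where P = "\<lambda>z. le (tri x) (tri (pl x z))"])
    fix z assume "z \<in> D N" "le (tri x) (tri (pl x z))"
    then show "le (tri x) (tri (pl x (sc z)))"
      using xy le_trans[of "tri x" "tri (pl x z)" "pl (pl x z) (tri (pl x z))"]
        le_pl[of "tri (pl x z)" "pl x z"] pl_comm[of "tri (pl x z)" "pl x z"] by simp
  qed (use xy z in \<open>(intro qf_intros; simp) | simp\<close>)+
  then show ?thesis using z by simp
qed

text \<open>By \<open>tri_mono\<close> the diagonals are disjoint intervals of codes. The pair lies
  in the one numbered \<open>pl x y\<close>, so any other index contradicts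
  \<open>dg_bounds\<close>.\<close>

lemma dg_pr: "x \<in> D N \<Longrightarrow> y \<in> D N \<Longrightarrow> dg (pr x y) = pl x y"
proof -
  assume xy: "x \<in> D N" "y \<in> D N"
  let ?w = "pl x y" and ?c = "pr x y"
  have w: "?w \<in> D N" "?c \<in> D N" using xy by simp_all
  have lo: "le (tri (sc ?w)) ?c" unfolding pr_def using xy le_pl by (simp del: tri_succ)
  have hi: "lt ?c (tri (sc (sc ?w)))"
  proof -
    have "tri (sc (sc ?w)) = pl (sc ?w) (tri (sc ?w))" using w by (simp only: tri_succ sc_in)
    also have "\<dots> = pl (tri (sc ?w)) (pl x (sc y))" using xy by (subst pl_comm) simp_all
    also have "\<dots> = pl ?c (sc y)" unfolding pr_def using xy by (simp add: pl_assoc del: tri_succ pl_succ_right)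
    finally show ?thesis using xy w lt_iff_pl[of ?c "pl ?c (sc y)"] by auto
  qed
  note b = dg_bounds[OF w(2)]
  have "\<not> lt (dg ?c) ?w"
  proof
    assume "lt (dg ?c) ?w"
    then have "le (tri (sc (sc (dg ?c)))) (tri (sc ?w))"
      using w by (intro tri_mono) (simp_all add: lt_def)
    then have "lt ?c ?c"
      using b lo w lt_le_trans[of ?c "tri (sc (sc (dg ?c)))" "tri (sc ?w)"] lt_le_trans[of ?c "tri (sc ?w)" ?c]
      by (simp del: tri_succ)
    then show False using w by simp
  qed
  moreover have "\<not> lt ?w (dg ?c)"
  proof
    assume "lt ?w (dg ?c)"
    then have "le (tri (sc (sc ?w))) (tri (sc (dg ?c)))"
      using w by (intro tri_mono) (simp_all add: lt_def)
    then have "lt ?c ?c"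
      using b hi w lt_le_trans[of ?c "tri (sc (sc ?w))" "tri (sc (dg ?c))"] lt_le_trans[of ?c "tri (sc (dg ?c))" ?c]
      by (simp del: tri_succ)
    then show False using w by simp
  qed
  ultimately show ?thesis using w not_le le_antisym dg_in by blast
qed

lemma p_pr [simp]: "x \<in> D N \<Longrightarrow> y \<in> D N \<Longrightarrow> p1 (pr x y) = x" "x \<in> D N \<Longrightarrow> y \<in> D N \<Longrightarrow> p2 (pr x y) = y"
proof -
  show 1: "p1 (pr x y) = x" if "x \<in> D N" "y \<in> D N"
    using that by (simp add: p1_def dg_pr del: tri_succ) (simp add: pr_def mn_pl del: tri_succ)
  show "p2 (pr x y) = y" if "x \<in> D N" "y \<in> D N"
    using that 1 by (simp add: p2_def dg_pr mn_pl)
qed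

lemma mn_le: "x \<in> D N \<Longrightarrow> y \<in> D N \<Longrightarrow> le (mn x y) x"
proof -
  assume xy: "x \<in> D N" "y \<in> D N"
  show ?thesis
  proof (cases "le y x")
    case True
    then show ?thesis using le_pl_mn[of x y] xy le_iff_pl[of "mn x y" x] pl_comm[of y "mn x y"] by auto
  next
    case False
    then have "le x y" using le_total xy by blast
    then show ?thesis using xy by (simp add: le_def)
  qed
qed

text \<open>An order is a function of pair codes, so a place where two orders differ has to bound
  the numbers coded there.\<close>

lemma p_le: "x \<in> D N \<Longrightarrow> le (p1 x) x" "x \<in> D N \<Longrightarrow> le (p2 x) x"
proof -
  show "le (p1 x) x" if "x \<in> D N" using that by (simp add: p1_def mn_le del: tri_succ)
  show "le (p2 x) x" if x: "x \<in> D N"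
  proof -
    have "le (dg x) (tri (sc (dg x)))" using x le_pl by simp
    then have "le (dg x) x" using dg_bounds[OF x] x le_trans[of "dg x" "tri (sc (dg x))" x] by (simp del: tri_succ)
    then show ?thesis unfolding p2_def using x mn_le[of "dg x" "p1 x"] le_trans by (meson dg_in p_in(1) arith_in(3))
  qed
qed

end

subsection \<open>Meaning of the formulas\<close>

context rca_model
begin

definition Le :: "'a \<Rightarrow> 'a \<Rightarrow> 'a \<Rightarrow> bool" where "Le X i j \<longleftrightarrow> app X (pr i j) = sc zr"
definition Lt :: "'a \<Rightarrow> 'a \<Rightarrow> 'a \<Rightarrow> bool" where "Lt X i j \<longleftrightarrow> Le X i j \<and> \<not> Le X j i"

definition LO :: "'a \<Rightarrow> bool" where
  "LO X \<longleftrightarrow> (\<forall>n\<in>D N. app X n = zr \<or> app X n = sc zr)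
     \<and> (\<forall>i\<in>D N. \<forall>j\<in>D N. Le X i j \<longrightarrow> Le X i i \<and> Le X j j)
     \<and> (\<forall>i\<in>D N. \<forall>j\<in>D N. Le X i j \<and> Le X j i \<longrightarrow> i = j)
     \<and> (\<forall>i\<in>D N. \<forall>j\<in>D N. \<forall>k\<in>D N. Le X i j \<and> Le X j k \<longrightarrow> Le X i k)
     \<and> (\<forall>i\<in>D N. \<forall>j\<in>D N. Le X i i \<and> Le X j j \<longrightarrow> Le X i j \<or> Le X j i)
     \<and> (\<forall>i\<in>D N. \<exists>j\<in>D N. lt i j \<and> Le X j j)"

definition ads_functional :: "'a \<Rightarrow> bool" where
  "ads_functional \<Psi> \<longleftrightarrow> (\<forall>X\<in>D ty1. LO X \<longrightarrow>
     (\<forall>n\<in>D N. Lt X (app (app \<Psi> X) n) (app (app \<Psi> X) (sc n))) \<or>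
     (\<forall>n\<in>D N. Lt X (app (app \<Psi> X) (sc n)) (app (app \<Psi> X) n)))"

definition mu_functional :: "'a \<Rightarrow> bool" where
  "mu_functional \<mu> \<longleftrightarrow> (\<forall>f\<in>D ty1. (\<exists>n\<in>D N. app f n = zr) \<longrightarrow> app f (app \<mu> f) = zr)"

definition ext_bound :: "'a \<Rightarrow> 'a \<Rightarrow> bool" where
  "ext_bound \<Phi> \<Xi> \<longleftrightarrow> (\<forall>k\<in>D N. \<forall>f\<in>D ty1. \<forall>g\<in>D ty1.
     (\<forall>m\<in>D N. lt m (app (app (app \<Xi> f) g) k) \<longrightarrow> app f m = app g m) \<longrightarrow>
     (\<forall>m\<in>D N. lt m k \<longrightarrow> app (app \<Phi> f) m = app (app \<Phi> g) m))"

lemma sat_connectives: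
  "sat D app con e (\<phi> \<^bold>\<and> \<psi>) \<longleftrightarrow> sat D app con e \<phi> \<and> sat D app con e \<psi>"
  "sat D app con e (\<phi> \<^bold>\<or> \<psi>) \<longleftrightarrow> sat D app con e \<phi> \<or> sat D app con e \<psi>"
  "sat D app con e (Exists \<rho> \<phi>) \<longleftrightarrow> (\<exists>x\<in>D \<rho>. sat D app con (cons_subst \<rho> x e) \<phi>)"
  by auto

lemma sat_le_in: "sat D app con e (le_in X i j) \<longleftrightarrow> Le (vl e X) (vl e i) (vl e j)"
  by (simp add: le_in_def mem_def Le_def)

text \<open>Restricted to \<open>le_in\<close> premises because conjunction and disjunction
  abbreviate implications: the general clause could break them up before
  \<open>sat_connectives\<close> applies.\<close>

lemma sat_imp_le_in:
  "sat D app con e (le_in X i j \<^bold>\<longrightarrow> \<psi>) \<longleftrightarrow> (sat D app con e (le_in X i j) \<longrightarrow> sat D app con e \<psi>)"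
  by simp

lemma sat_LO_inf:
  assumes "env_in D e"
  shows "sat D app con e LO_inf \<longleftrightarrow> LO (e ty1 0)"
proof -
  have "sat D app con (cons_subst N y (cons_subst N x e)) (less (Var N 1) (Var N 0)) \<longleftrightarrow> lt x y"
    if "x \<in> D N" "y \<in> D N" for x y
    using assms that by (simp add: sat_less env_in_cons)
  then show ?thesis
    unfolding LO_inf_def Let_def LO_def in_field_def
    by (simp only: sat_connectives sat_imp_le_in sat_le_in sat.simps(1,2,4) mem_def val.simps cons_subst_simps ty.distinct
        not_False_eq_True numeral_2_eq_2 One_nat_def imp_conv_disj de_Morgan_conj disj_assoc simp_thms cong: ball_cong bex_cong)
qed

lemma sat_UADS: "env_in D e \<Longrightarrow> sat D app con e UADS_matrix \<longleftrightarrow> ads_functional (e ty11 0)"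
  by (simp add: UADS_matrix_def Let_def ads_functional_def sat_LO_inf env_in_cons Lt_def Le_def less_in_def le_in_def mem_def)
    blast

lemma sat_mu: "env_in D e \<Longrightarrow> sat D app con e mu_matrix \<longleftrightarrow> mu_functional (e ty2 0)"
  by (simp add: mu_matrix_def Let_def mu_functional_def)

lemma sat_ext: "env_in D e \<Longrightarrow> sat D app con e ext_functional \<longleftrightarrow> ext_bound (e ty11 0) (e ext_ty 0)"
  by (simp add: ext_functional_def Let_def ext_bound_def same_initial_def sat_less env_in_cons has_type_iff shift_def)

lemma val_upd_fresh [simp]: "(\<rho>, i) \<notin> fvs t \<Longrightarrow> vl (upd e \<rho> i x) t = vl e t"
  by (rule val_cong) (auto simp: upd_def)

lemma upd_simps [simp]: "upd e \<rho> i x \<rho> i = x" "(\<sigma>, j) \<noteq> (\<rho>, i) \<Longrightarrow> upd e \<rho> i x \<sigma> j = e \<sigma> j"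
  by (auto simp: upd_def)

end

subsection \<open>From \<open>(\<mu>\<^sup>2)\<close> to \<open>UADS\<close>\<close>

text \<open>Free variables: \<open>\<mu>\<close> is \<open>Var ty2 0\<close> and \<open>X\<close> is \<open>Var ty1 0\<close>.\<close>

definition X_le :: "tm \<Rightarrow> tm \<Rightarrow> tm" where "X_le s t = tm_eq (Var ty1 0 \<cdot> pair s t) tm_one"
definition X_lt :: "tm \<Rightarrow> tm \<Rightarrow> tm" where "X_lt s t = tm_and (X_le s t) (tm_not (X_le t s))"
text \<open>\<open>\<mu>\<close> may return any zero, and anything at all if there is none; so a
  test of the returned value has to stand for the existential statement.\<close>

definition mu_search :: "nat \<Rightarrow> tm \<Rightarrow> tm" where "mu_search i t = Var ty2 0 \<cdot> abs N i t"

definition higher :: "tm \<Rightarrow> tm \<Rightarrow> tm" where "higher s t = tm_and (tm_lt s t) (X_lt s t)"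
definition next_tm :: tm where "next_tm = abs N 0 (mu_search 1 (higher (Var N 0) (Var N 1)))"
definition peak_tm :: "tm \<Rightarrow> tm" where "peak_tm t = tm_and (X_le t t) (tm_not (higher t (next_tm \<cdot> t)))"
definition higher_peak :: "tm \<Rightarrow> tm \<Rightarrow> tm" where "higher_peak s t = tm_and (tm_lt s t) (peak_tm t)"
definition next_peak :: tm where "next_peak = abs N 0 (mu_search 1 (higher_peak (Var N 0) (Var N 1)))"
text \<open>\<open>next_tm\<close> and \<open>next_peak\<close> have absorbed the two inner
  quantifiers of the statement that the peaks are bounded, so a single search is left.\<close>

definition peak_bound :: tm where
  "peak_bound = mu_search 0 (tm_not (higher_peak (Var N 0) (next_peak \<cdot> Var N 0)))"
definition bounded_peaks :: tm where
  "bounded_peaks = tm_not (higher_peak peak_bound (next_peak \<cdot> peak_bound))"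
definition ads_start :: tm where
  "ads_start = tm_cond bounded_peaks
     (mu_search 0 (tm_and (tm_lt peak_bound (Var N 0)) (X_le (Var N 0) (Var N 0)))) (next_peak \<cdot> Zero)"
definition ads_step :: tm where
  "ads_step = abs N 0 (abs N 1 (tm_cond bounded_peaks (next_tm \<cdot> Var N 0) (next_peak \<cdot> Var N 0)))"
definition ads_tm :: tm where
  "ads_tm = abs ty2 0 (abs ty1 0 (abs N 0 (Rec \<cdot> Var N 0 \<cdot> ads_start \<cdot> ads_step)))"

lemma X_le_simps [simp]:
  "tyof (X_le s t) = N" "tyof (X_lt s t) = N" "tyof (mu_search i t) = N" "tyof (higher s t) = N" "tyof next_tm = ty1"
  "well_typed (X_le s t) \<longleftrightarrow> well_typed s \<and> well_typed t \<and> tyof s = N \<and> tyof t = N"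
  "well_typed (X_lt s t) \<longleftrightarrow> well_typed s \<and> well_typed t \<and> tyof s = N \<and> tyof t = N"
  "well_typed (higher s t) \<longleftrightarrow> well_typed s \<and> well_typed t \<and> tyof s = N \<and> tyof t = N"
  "well_typed t \<Longrightarrow> tyof t = N \<Longrightarrow> well_typed (mu_search i t)"
  "fvs (X_le s t) = insert (ty1, 0) (fvs s \<union> fvs t)"
  "fvs (X_lt s t) = insert (ty1, 0) (fvs s \<union> fvs t)"
  "fvs (higher s t) = insert (ty1, 0) (fvs s \<union> fvs t)"
  "fvs (mu_search i t) = insert (ty2, 0) (fvs t - {(N, i)})"
  by (auto simp: X_le_def X_lt_def mu_search_def higher_def next_tm_def)

lemma next_tm_simps [simp]: "well_typed next_tm" "fvs next_tm = {(ty1, 0), (ty2, 0)}"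
  by (auto simp: next_tm_def)

lemma peak_tm_simps [simp]:
  "tyof (peak_tm t) = N" "tyof (higher_peak s t) = N" "tyof next_peak = ty1"
  "well_typed (peak_tm t) \<longleftrightarrow> well_typed t \<and> tyof t = N"
  "well_typed (higher_peak s t) \<longleftrightarrow> well_typed s \<and> well_typed t \<and> tyof s = N \<and> tyof t = N"
  "fvs (peak_tm t) = {(ty1, 0), (ty2, 0)} \<union> fvs t"
  "fvs (higher_peak s t) = {(ty1, 0), (ty2, 0)} \<union> fvs s \<union> fvs t"
  by (auto simp: peak_tm_def higher_peak_def next_peak_def)

lemma next_peak_simps [simp]: "well_typed next_peak" "fvs next_peak = {(ty1, 0), (ty2, 0)}"
  by (auto simp: next_peak_def)

lemma peak_bound_simps [simp]:
  "tyof peak_bound = N" "well_typed peak_bound" "fvs peak_bound = {(ty1, 0), (ty2, 0)}"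
  by (auto simp: peak_bound_def)

lemma bounded_peaks_simps [simp]:
  "tyof bounded_peaks = N" "well_typed bounded_peaks" "fvs bounded_peaks = {(ty1, 0), (ty2, 0)}"
  by (auto simp: bounded_peaks_def)

lemma ads_start_simps [simp]:
  "tyof ads_start = N" "well_typed ads_start" "fvs ads_start = {(ty1, 0), (ty2, 0)}"
  by (auto simp: ads_start_def)

lemma ads_step_simps [simp]:
  "tyof ads_step = N \<Rrightarrow> N \<Rrightarrow> N" "well_typed ads_step" "fvs ads_step = {(ty1, 0), (ty2, 0)}"
  by (auto simp: ads_step_def)

lemma ads_tm_simps [simp]: "tyof ads_tm = ty2 \<Rrightarrow> ty11" "well_typed ads_tm" "fvs ads_tm = {}"
  by (auto simp: ads_tm_def)

context rca_model
begin

lemma val_X: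
  assumes "env_in D e"
  shows "well_typed (X_le s t) \<Longrightarrow> vl e (X_le s t) = zr \<longleftrightarrow> Le (e ty1 0) (vl e s) (vl e t)"
    and "well_typed (X_lt s t) \<Longrightarrow> vl e (X_lt s t) = zr \<longleftrightarrow> Lt (e ty1 0) (vl e s) (vl e t)"
    and "well_typed (higher s t) \<Longrightarrow> vl e (higher s t) = zr \<longleftrightarrow> lt (vl e s) (vl e t) \<and> Lt (e ty1 0) (vl e s) (vl e t)"
proof -
  show 1: "vl e (X_le s t) = zr \<longleftrightarrow> Le (e ty1 0) (vl e s) (vl e t)" if "well_typed (X_le s t)" for s t
    using assms that by (simp add: X_le_def val_truth Le_def tm_one_def)
  show 2: "vl e (X_lt s t) = zr \<longleftrightarrow> Lt (e ty1 0) (vl e s) (vl e t)" if "well_typed (X_lt s t)" for s t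
    using assms that by (simp add: X_lt_def val_truth Lt_def 1)
  show "vl e (higher s t) = zr \<longleftrightarrow> lt (vl e s) (vl e t) \<and> Lt (e ty1 0) (vl e s) (vl e t)"
    if "well_typed (higher s t)"
    using assms that by (simp add: higher_def val_truth 2)
qed

lemma val_mu_search:
  assumes "env_in D e" "mu_functional (e ty2 0)" "well_typed t" "tyof t = N"
    and "j \<in> D N" "vl (upd e N i j) t = zr"
  shows "vl (upd e N i (vl e (mu_search i t))) t = zr"
proof -
  let ?f = "vl e (abs N i t)"
  have f: "?f \<in> D ty1" using assms by (intro val_in) (simp_all add: has_type_iff)
  have "app ?f j = zr" using assms by (simp add: val_abs)
  then have "app ?f (app (e ty2 0) ?f) = zr" using assms f by (auto simp: mu_functional_def)
  moreover have "app (e ty2 0) ?f \<in> D N" using assms f by (auto simp: env_in_def intro: app_in)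
  ultimately show ?thesis using assms by (simp add: val_abs mu_search_def)
qed

lemma ads_tm_correct:
  assumes \<mu>: "\<mu> \<in> D ty2" "mu_functional \<mu>"
  shows "ads_functional (app (vl env0 ads_tm) \<mu>)"
  unfolding ads_functional_def
proof (intro ballI impI)
  fix X assume X: "X \<in> D ty1" "LO X"
  define e where "e = upd (upd env0 ty2 0 \<mu>) ty1 0 X"
  have e [simp]: "env_in D e" "e ty2 0 = \<mu>" "e ty1 0 = X"
    using \<mu> X by (simp_all add: e_def)
  note \<mu>(2) [simp]
  have in_N [simp]: "well_typed t \<Longrightarrow> tyof t = N \<Longrightarrow> vl e t \<in> D N" for t by (rule val_N_in) simp_all
  define nx where "nx x = app (vl e next_tm) x" for x
  define np where "np x = app (vl e next_peak) x" for x
  define peak where "peak x \<longleftrightarrow> Le X x x \<and> \<not> (lt x (nx x) \<and> Lt X x (nx x))" for x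
  have [simp]: "nx x \<in> D N" "np x \<in> D N" if "x \<in> D N" for x
    using that unfolding nx_def np_def by (auto intro!: app_in[of _ N] val_in simp: has_type_iff)
  have nx: "lt x (nx x) \<and> Lt X x (nx x)" if x: "x \<in> D N" "j \<in> D N" "lt x j" "Lt X x j" for x j
  proof -
    have *: "nx x = vl (upd e N 0 x) (mu_search 1 (higher (Var N 0) (Var N 1)))"
      using x by (simp add: nx_def next_tm_def val_abs)
    show ?thesis
      using val_mu_search[of "upd e N 0 x" "higher (Var N 0) (Var N 1)" j 1, folded *] x
      by (simp add: val_X)
  qed
  have val_peak: "vl e' (peak_tm t) = zr \<longleftrightarrow> peak (vl e' t)"
    if "env_in D e'" "e' ty1 0 = X" "vl e' next_tm = vl e next_tm" "well_typed t" "tyof t = N" for e' t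
    using that by (simp add: peak_tm_def peak_def val_truth val_X nx_def)
  have val_hp: "vl e' (higher_peak s t) = zr \<longleftrightarrow> lt (vl e' s) (vl e' t) \<and> peak (vl e' t)"
    if "env_in D e'" "e' ty1 0 = X" "vl e' next_tm = vl e next_tm"
      "well_typed s" "tyof s = N" "well_typed t" "tyof t = N" for e' s t
    using that by (simp add: higher_peak_def val_truth val_peak)
  have np: "lt x (np x) \<and> peak (np x)" if x: "x \<in> D N" "j \<in> D N" "lt x j" "peak j" for x j
  proof -
    have *: "np x = vl (upd e N 0 x) (mu_search 1 (higher_peak (Var N 0) (Var N 1)))"
      using x by (simp add: np_def next_peak_def val_abs)
    show ?thesis
      using val_mu_search[of "upd e N 0 x" "higher_peak (Var N 0) (Var N 1)" j 1, folded *] x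
      by (simp add: val_hp)
  qed
  define b where "b = vl e peak_bound"
  have b [simp]: "b \<in> D N" by (simp add: b_def)
  define mode where "mode \<longleftrightarrow> \<not> (lt b (np b) \<and> peak (np b))"
  have val_mode: "vl e' bounded_peaks = zr \<longleftrightarrow> mode" if "vl e' bounded_peaks = vl e bounded_peaks" for e'
    unfolding that unfolding bounded_peaks_def mode_def b_def np_def by (simp add: val_truth val_hp)
  \<comment> \<open>A number with no peak beyond it would be a zero of the search for
    \<open>peak_bound\<close>; then \<open>b\<close> would have the same property, that is,
    \<open>mode\<close> would hold.\<close>
  have unb: "lt x (np x) \<and> peak (np x)" if "\<not> mode" "x \<in> D N" for x
  proof (rule ccontr)
    assume "\<not> ?thesis"
    then have "vl (upd e N 0 b) (tm_not (higher_peak (Var N 0) (next_peak \<cdot> Var N 0))) = zr"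
      unfolding b_def peak_bound_def using that
      by (intro val_mu_search[of _ _ x]) (simp_all add: val_truth val_hp np_def)
    then show False using that by (simp add: val_truth val_hp np_def mode_def)
  qed
  have refl: "Le X i i \<and> Le X j j" if "Le X i j" "i \<in> D N" "j \<in> D N" for i j
    using X that unfolding LO_def by blast
  define F where "F = app (app (vl env0 ads_tm) \<mu>) X"
  have F: "F \<in> D ty1" unfolding F_def using \<mu> X
    by (intro app_in[of _ ty1] app_in[of _ ty2] val_in) (simp_all add: has_type_iff)
  have step: "vl e ads_step \<in> D (N \<Rrightarrow> N \<Rrightarrow> N)" by (rule val_in) (simp_all add: has_type_iff)
  have F_app: "app F n = rc n (vl e ads_start) (vl e ads_step)" if "n \<in> D N" for n
    using that \<mu> X unfolding F_def ads_tm_def by (simp add: val_abs rc_def e_def)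
  have F_in [simp]: "app F n \<in> D N" if "n \<in> D N" for n using F that by (rule app_in)
  have step_app: "app (app (vl e ads_step) u) v = (if mode then nx u else np u)" if "u \<in> D N" "v \<in> D N" for u v
    using that by (simp add: ads_step_def val_abs val_cond val_mode nx_def np_def)
  have F_zero: "app F zr = vl e ads_start" by (simp add: F_app step)
  have F_succ: "app F (sc n) = (if mode then nx (app F n) else np (app F n))" if "n \<in> D N" for n
    using that by (simp add: F_app step step_app)
  have asc: "\<forall>n\<in>D N. Lt X (app F n) (app F (sc n))" if mode
  proof -
    have not_peak: "\<not> peak x" if "x \<in> D N" "lt b x" for x
      using np[of b x] that \<open>mode\<close> by (auto simp: mode_def)
    have up: "lt x (nx x) \<and> Lt X x (nx x)" if "x \<in> D N" "lt b x" "Le X x x" for x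
      using not_peak[of x] that by (auto simp: peak_def)
    define s where "s = vl e (mu_search 0 (tm_and (tm_lt peak_bound (Var N 0)) (X_le (Var N 0) (Var N 0))))"
    obtain j where j: "j \<in> D N" "lt b j" "Le X j j" using X b unfolding LO_def by blast
    have [simp]: "s \<in> D N" by (simp add: s_def)
    have "vl (upd e N 0 s) (tm_and (tm_lt peak_bound (Var N 0)) (X_le (Var N 0) (Var N 0))) = zr"
      unfolding s_def using j by (intro val_mu_search[of _ _ j]) (simp_all add: val_truth val_X b_def)
    then have s: "lt b s \<and> Le X s s" by (simp add: val_truth val_X b_def)
    have "app F zr = s" unfolding F_zero ads_start_def by (simp add: val_cond val_mode \<open>mode\<close> s_def)
    \<comment> \<open>There are no peaks past \<open>b\<close>, so a field element there can always
      be left upwards. Position and membership are all that the induction has to preserve.\<close>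
    have inv: "lt b (app F n) \<and> Le X (app F n) (app F n)" if "n \<in> D N" for n
    proof (rule induction_qf[where P = "\<lambda>n. lt b (app F n) \<and> Le X (app F n) (app F n)", OF that])
      show "qfp (\<lambda>n. lt b (app F n) \<and> Le X (app F n) (app F n))"
        unfolding Le_def using F X by (intro qf_intros rep_app[of N] rep_const[of F] rep_const[of X]) simp_all
    next
      fix n assume n: "n \<in> D N" and IH: "lt b (app F n) \<and> Le X (app F n) (app F n)"
      have "lt (app F n) (nx (app F n)) \<and> Lt X (app F n) (nx (app F n))" using up IH n by simp
      then show "lt b (app F (sc n)) \<and> Le X (app F (sc n)) (app F (sc n))"
        using IH n lt_trans[of b "app F n" "nx (app F n)"] refl[of "app F n" "nx (app F n)"] \<open>mode\<close>
        by (simp add: F_succ Lt_def)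
    qed (use s \<open>app F zr = s\<close> in simp)
    show ?thesis using inv up \<open>mode\<close> by (simp add: F_succ)
  qed
  have desc: "\<forall>n\<in>D N. Lt X (app F (sc n)) (app F n)" if "\<not> mode"
  proof
    fix n assume n: "n \<in> D N"
    have "app F zr = np zr" unfolding F_zero ads_start_def by (simp add: val_cond val_mode \<open>\<not> mode\<close> np_def)
    \<comment> \<open>Every value is an answer of \<open>np\<close> and thus a peak, so
      distinguishing zero from successors is enough.\<close>
    then have pk: "peak (app F n)"
      using n unb \<open>\<not> mode\<close> by (cases n rule: nat_cases) (simp_all add: F_succ)
    define i where "i = app F n"
    define j where "j = np i"
    have ij: "i \<in> D N" "j \<in> D N" "peak i" "peak j" "lt i j"
      using n pk unb[OF \<open>\<not> mode\<close>] by (simp_all add: i_def j_def)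
    \<comment> \<open>Otherwise \<open>nx\<close> would find a number above the peak
      \<open>i\<close>. Since \<open>i\<close> and \<open>j\<close> differ, totality leaves only the
      descent.\<close>
    then have "\<not> Lt X i j" using nx[of i j] by (auto simp: peak_def)
    moreover have "Le X i j \<or> Le X j i" using X ij unfolding LO_def peak_def by blast
    moreover have "\<not> (Le X i j \<and> Le X j i)"
    proof
      assume "Le X i j \<and> Le X j i"
      then have "i = j" using X ij unfolding LO_def by blast
      then show False using ij by simp
    qed
    ultimately have "Lt X j i" by (auto simp: Lt_def)
    then show "Lt X (app F (sc n)) (app F n)" using n \<open>\<not> mode\<close> by (simp add: F_succ i_def j_def)
  qed
  show "(\<forall>n\<in>D N. Lt X (app (app (app (vl env0 ads_tm) \<mu>) X) n) (app (app (app (vl env0 ads_tm) \<mu>) X) (sc n))) \<or>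
     (\<forall>n\<in>D N. Lt X (app (app (app (vl env0 ads_tm) \<mu>) X) (sc n)) (app (app (app (vl env0 ads_tm) \<mu>) X) n))"
    using asc desc unfolding F_def by blast
qed

end

subsection \<open>From \<open>UADS\<close> to \<open>(\<mu>\<^sup>2)\<close>\<close>

text \<open>\<open>zero_search \<cdot> k\<close> is the least zero of \<open>f\<close> (\<open>Var ty1 0\<close>) up to \<open>k\<close>, and \<open>k\<close> if there is none;
  \<open>k\<close> is late in the former case.  The order lists the numbers that are not late increasingly, followed by
  the late ones in decreasing order.\<close>

definition search_step :: tm where
  "search_step = abs N 1 (abs N 2 (tm_cond (Var ty1 0 \<cdot> Var N 1) (Var N 1) (Succ \<cdot> Var N 2)))"
definition zero_search :: tm where "zero_search = abs N 0 (Rec \<cdot> Var N 0 \<cdot> Zero \<cdot> search_step)"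
definition late :: "tm \<Rightarrow> tm" where "late t = Var ty1 0 \<cdot> (zero_search \<cdot> t)"
definition order_tm :: tm where
  "order_tm = abs ty1 0 (abs N 0 (tm_cond
     (tm_cond (late (tm_fst (Var N 0)))
       (tm_and (late (tm_snd (Var N 0))) (tm_le (tm_snd (Var N 0)) (tm_fst (Var N 0))))
       (tm_le (tm_fst (Var N 0)) (tm_snd (Var N 0))))
     tm_one Zero))"
text \<open>\<open>\<omega>\<close> arises from the same construction at a function without zeros,
  so the facts about \<open>ord\<close> cover it as well.\<close>

definition const_one :: tm where "const_one = abs N 0 tm_one"
definition omega_tm :: tm where "omega_tm = order_tm \<cdot> const_one"

text \<open>Either the second value of the sequence for \<open>\<omega>\<close> or the separating
  number \<open>t\<close> is late. Lateness is inherited upwards, so their sum serves in both cases;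
  \<open>t\<close> is left open because its origin differs between the two versions of the
  implication.\<close>

definition mu_tm :: "tm \<Rightarrow> tm" where
  "mu_tm t = abs ty1 0 (zero_search \<cdot> add (Var ty11 0 \<cdot> omega_tm \<cdot> tm_one) t)"

lemma search_simps [simp]:
  "tyof search_step = N \<Rrightarrow> N \<Rrightarrow> N" "well_typed search_step" "fvs search_step = {(ty1, 0)}"
  by (auto simp: search_step_def)

lemma zero_search_simps [simp]: "tyof zero_search = ty1" "well_typed zero_search" "fvs zero_search = {(ty1, 0)}"
  by (auto simp: zero_search_def)

lemma late_simps [simp]:
  "tyof (late t) = N" "well_typed (late t) \<longleftrightarrow> well_typed t \<and> tyof t = N" "fvs (late t) = insert (ty1, 0) (fvs t)"
  by (auto simp: late_def)

lemma order_tm_simps [simp]: "tyof order_tm = ty11" "well_typed order_tm" "fvs order_tm = {}"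
  by (auto simp: order_tm_def)

lemma omega_tm_simps [simp]:
  "tyof const_one = ty1" "well_typed const_one" "fvs const_one = {}"
  "tyof omega_tm = ty1" "well_typed omega_tm" "fvs omega_tm = {}"
  by (auto simp: const_one_def omega_tm_def)

lemma mu_tm_simps [simp]:
  "tyof (mu_tm t) = ty2" "well_typed t \<Longrightarrow> tyof t = N \<Longrightarrow> well_typed (mu_tm t)"
  "fvs (mu_tm t) = insert (ty11, 0) (fvs t - {(ty1, 0)})"
  by (auto simp: mu_tm_def)

context rca_model
begin

section \<open>Late numbers and the order of \<open>f\<close> in a model\<close>

definition srch :: "'a \<Rightarrow> 'a" where "srch f = vl (upd env0 ty1 0 f) zero_search"
definition L :: "'a \<Rightarrow> 'a \<Rightarrow> bool" where "L f k \<longleftrightarrow> app f (app (srch f) k) = zr"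
definition ord :: "'a \<Rightarrow> 'a" where "ord f = app (vl env0 order_tm) f"
definition omega :: 'a where "omega = vl env0 omega_tm"

lemma val_order: "app (vl e order_tm) f = ord f"
  by (simp add: ord_def val_closed[of _ e])

lemma val_omega: "vl e omega_tm = omega"
  by (simp add: omega_def val_closed[of _ e])

lemma val_search: "vl e zero_search = srch (e ty1 0)"
  unfolding srch_def by (rule val_cong) auto

lemma srch_in [simp]: "f \<in> D ty1 \<Longrightarrow> srch f \<in> D ty1"
  unfolding srch_def by (rule val_in) (simp_all add: has_type_iff)

lemma fun_app_in [simp]: "f \<in> D ty1 \<Longrightarrow> k \<in> D N \<Longrightarrow> app f k \<in> D N"
  by (rule app_in)

lemma srch_zero [simp]: "f \<in> D ty1 \<Longrightarrow> app (srch f) zr = zr"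
proof -
  assume "f \<in> D ty1"
  then have "vl (upd env0 ty1 0 f) search_step \<in> D (N \<Rrightarrow> N \<Rrightarrow> N)" by (intro val_in) (simp_all add: has_type_iff)
  with \<open>f \<in> D ty1\<close> have "app (srch f) zr = rc zr zr (vl (upd env0 ty1 0 f) search_step)"
    by (simp add: srch_def zero_search_def val_abs rc_def)
  then show ?thesis using \<open>vl _ _ \<in> _\<close> by simp
qed

lemma srch_succ:
  "f \<in> D ty1 \<Longrightarrow> k \<in> D N \<Longrightarrow> app (srch f) (sc k) = (if L f k then app (srch f) k else sc k)"
proof -
  assume fk: "f \<in> D ty1" "k \<in> D N"
  let ?h = "vl (upd env0 ty1 0 f) search_step"
  have h: "?h \<in> D (N \<Rrightarrow> N \<Rrightarrow> N)" using fk by (intro val_in) (simp_all add: has_type_iff)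
  have s: "app (srch f) n = rc n zr ?h" if "n \<in> D N" for n
    using fk that by (simp add: srch_def zero_search_def val_abs rc_def)
  have "app (app ?h u) v = (if app f u = zr then u else sc v)" if "u \<in> D N" "v \<in> D N" for u v
    using fk that by (simp add: search_step_def val_abs val_cond)
  then show ?thesis using fk h by (simp add: s L_def)
qed

lemma L_succ: "f \<in> D ty1 \<Longrightarrow> k \<in> D N \<Longrightarrow> L f k \<Longrightarrow> L f (sc k)"
  by (simp add: L_def[of f "sc k"] srch_succ) (simp add: L_def)

text \<open>Either the search stopped earlier at another zero, or it has arrived at \<open>k\<close>
  itself.\<close>

lemma L_zero: "f \<in> D ty1 \<Longrightarrow> k \<in> D N \<Longrightarrow> app f k = zr \<Longrightarrow> L f k"
proof (cases k rule: nat_cases)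
  case (3 y)
  assume "f \<in> D ty1" "app f k = zr"
  then show ?thesis using 3 by (cases "L f y") (simp_all add: L_succ, simp add: L_def[of f "sc y"] srch_succ)
qed (simp_all add: L_def)

lemma rep_L: "f \<in> D ty1 \<Longrightarrow> rep N g \<Longrightarrow> qfp (\<lambda>x. L f (g x))"
  unfolding L_def by (intro qfp_eq rep_app[of N] rep_const[of f] rep_const[of "srch f"] rep_const[of zr]) simp_all

lemma L_mono: "f \<in> D ty1 \<Longrightarrow> k \<in> D N \<Longrightarrow> m \<in> D N \<Longrightarrow> le k m \<Longrightarrow> L f k \<Longrightarrow> L f m"
proof -
  assume f: "f \<in> D ty1" and km: "k \<in> D N" "m \<in> D N" "le k m" and L: "L f k"
  then obtain z where z: "z \<in> D N" "pl k z = m" by (auto simp: le_iff_pl)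
  have "L f (pl k z)"
  proof (rule induction_qf[where P = "\<lambda>z. L f (pl k z)", OF z(1)])
    show "qfp (\<lambda>z. L f (pl k z))" using f km by (intro rep_L qf_intros)
  qed (use f km L in \<open>simp_all add: L_succ\<close>)
  then show ?thesis using z by simp
qed

lemma ord_in [simp]: "f \<in> D ty1 \<Longrightarrow> ord f \<in> D ty1"
  unfolding ord_def by (rule app_in[of _ ty1]) (auto intro!: val_in simp: has_type_iff)

lemma omega_eq: "omega = ord (vl env0 const_one)"
  by (simp add: omega_def omega_tm_def ord_def)

lemma const_one_in [simp]: "vl env0 const_one \<in> D ty1"
  by (rule val_in) (simp_all add: has_type_iff)

lemma omega_in [simp]: "omega \<in> D ty1"
  by (simp add: omega_eq)

lemma val_late: "env_in D e \<Longrightarrow> vl e (late t) = zr \<longleftrightarrow> L (e ty1 0) (vl e t)"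
  by (simp add: late_def L_def val_search)

lemma ord_app:
  "f \<in> D ty1 \<Longrightarrow> x \<in> D N \<Longrightarrow> app (ord f) x =
    (if (if L f (p1 x) then L f (p2 x) \<and> le (p2 x) (p1 x) else le (p1 x) (p2 x)) then sc zr else zr)"
  by (simp add: ord_def order_tm_def val_abs val_cond val_truth val_late tm_one_def)

text \<open>Late numbers form a final segment, so numerical comparison already puts early numbers
  before late ones; hence \<open>i\<close> alone decides which clause applies.\<close>

lemma Le_ord:
  "f \<in> D ty1 \<Longrightarrow> i \<in> D N \<Longrightarrow> j \<in> D N \<Longrightarrow> Le (ord f) i j \<longleftrightarrow> (if L f i then L f j \<and> le j i else le i j)"
  by (simp add: Le_def ord_app)

lemma Lt_ord_late:
  assumes "f \<in> D ty1" "i \<in> D N" "j \<in> D N" "Lt (ord f) i j" "L f i"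
  shows "L f j \<and> lt j i"
  using assms not_le[of i j] by (auto simp: Lt_def Le_ord)

lemma Lt_ord_early:
  assumes "f \<in> D ty1" "i \<in> D N" "j \<in> D N" "Lt (ord f) i j" "\<not> L f j"
  shows "lt i j"
  using assms not_le[of j i] by (auto simp: Lt_def Le_ord split: if_splits)

lemma not_L_const_one: "k \<in> D N \<Longrightarrow> \<not> L (vl env0 const_one) k"
proof -
  have "app (vl env0 const_one) x = sc zr" if "x \<in> D N" for x
    using that by (simp add: const_one_def val_abs tm_one_def)
  then show "k \<in> D N \<Longrightarrow> ?thesis" by (simp add: L_def)
qed

lemma LO_ord:
  assumes f: "f \<in> D ty1"
  shows "LO (ord f)"
proof -
  note Le = Le_ord[OF f]
  have up: "L f j" if "L f i" "\<not> le j i" "i \<in> D N" "j \<in> D N" for i j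
    using that L_mono[OF f, of i j] le_total[of i j] by blast
  have tr: "Le (ord f) i k" if "i \<in> D N" "j \<in> D N" "k \<in> D N" "Le (ord f) i j" "Le (ord f) j k" for i j k
  proof (cases "L f i")
    case True
    then show ?thesis using that le_trans[of k j i] by (auto simp: Le)
  next
    case False
    show ?thesis
    proof (cases "L f j")
      case True
      \<comment> \<open>Here \<open>k\<close> is late like \<open>j\<close>, so \<open>k\<close>
        being numerically at most \<open>i\<close> would make \<open>i\<close> late.\<close>
      then have "\<not> le k i" using that False L_mono[OF f, of k i] by (auto simp: Le)
      then show ?thesis using that False le_total[of i k] by (auto simp: Le)
    next
      case False
      then show ?thesis using that \<open>\<not> L f i\<close> le_trans[of i j k] by (auto simp: Le)
    qed
  qed
  have an: "i = j" if "i \<in> D N" "j \<in> D N" "Le (ord f) i j" "Le (ord f) j i" for i j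
    using that le_antisym[of i j] by (auto simp: Le split: if_splits)
  have tot: "Le (ord f) i j \<or> Le (ord f) j i" if "i \<in> D N" "j \<in> D N" for i j
    using that le_total[of i j] up[of i j] up[of j i] by (auto simp: Le)
  have rf: "Le (ord f) i i" if "i \<in> D N" for i using that by (simp add: Le)
  have un: "\<exists>j\<in>D N. lt i j \<and> Le (ord f) j j" if "i \<in> D N" for i
    using that by (intro bexI[of _ "sc i"]) (simp_all add: Le lt_def)
  have bi: "\<forall>n\<in>D N. app (ord f) n = zr \<or> app (ord f) n = sc zr" using f by (simp add: ord_app)
  show ?thesis unfolding LO_def
  proof (intro conjI)
    show "\<forall>i\<in>D N. \<forall>j\<in>D N. \<forall>k\<in>D N. Le (ord f) i j \<and> Le (ord f) j k \<longrightarrow> Le (ord f) i k"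
      using tr by blast
    show "\<forall>i\<in>D N. \<forall>j\<in>D N. Le (ord f) i j \<and> Le (ord f) j i \<longrightarrow> i = j" using an by blast
  qed (use bi rf tot un in blast)+
qed

text \<open>For an early first component both orders compare numerically, so the first component of
  \<open>m\<close> is late, and it is at most \<open>m\<close>.\<close>

lemma ord_omega_differ:
  assumes f: "f \<in> D ty1" and m: "m \<in> D N" and "app (ord f) m \<noteq> app omega m"
  shows "L f m"
proof -
  have "L f (p1 m)"
    using assms not_L_const_one by (auto simp: omega_eq ord_app split: if_splits)
  then show ?thesis using L_mono[OF f _ m p_le(1)[OF m]] m by simp
qed

text \<open>Well-foundedness in a possibly nonstandard model, for sequences that the model contains:
  under a permanent descent, quantifier-free induction bounds \<open>n + g n\<close> by
  \<open>g 0\<close>, which fails at \<open>n = g 0 + 1\<close>.\<close>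

lemma no_descent:
  assumes "rep N g" and g: "\<And>n. n \<in> D N \<Longrightarrow> g n \<in> D N"
  shows "\<exists>n\<in>D N. \<not> lt (g (sc n)) (g n)"
proof (rule ccontr)
  assume "\<not> ?thesis"
  then have desc: "lt (g (sc n)) (g n)" if "n \<in> D N" for n using that by blast
  have P: "le (pl n (g n)) (g zr)" if "n \<in> D N" for n
  proof (rule induction_qf[where P = "\<lambda>n. le (pl n (g n)) (g zr)", OF that])
    show "qfp (\<lambda>n. le (pl n (g n)) (g zr))" using assms by (intro qf_intros) simp_all
  next
    fix n assume n: "n \<in> D N" and IH: "le (pl n (g n)) (g zr)"
    have "le (pl n (sc (g (sc n)))) (pl n (g n))" using desc n g by (intro pl_le_mono) (simp_all add: lt_def)
    then show "le (pl (sc n) (g (sc n))) (g zr)"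
      using IH n g le_trans[of "sc (pl n (g (sc n)))" "pl n (g n)" "g zr"] by simp
  qed (use g in simp)
  let ?n = "sc (g zr)"
  have "le ?n (pl ?n (g ?n))" using g by (intro le_pl) simp_all
  then have "le ?n (g zr)" using P[of ?n] g le_trans[of ?n "pl ?n (g ?n)" "g zr"] by simp
  then show False using not_succ_le g by simp
qed

lemma ads_omega:
  assumes \<Phi>: "\<Phi> \<in> D ty11" "ads_functional \<Phi>"
  shows "lt (app (app \<Phi> omega) zr) (app (app \<Phi> omega) (sc zr))"
proof -
  define c where "c = app \<Phi> omega"
  have c [simp]: "c \<in> D ty1" using \<Phi> unfolding c_def by (intro app_in[of _ ty1]) simp_all
  have Lt: "lt i j" if "Lt omega i j" "i \<in> D N" "j \<in> D N" for i j
    using that not_L_const_one by (auto simp: omega_eq intro: Lt_ord_early[of "vl env0 const_one"])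
  have "LO omega" by (simp add: omega_eq LO_ord)
  then have "(\<forall>n\<in>D N. Lt omega (app c n) (app c (sc n))) \<or> (\<forall>n\<in>D N. Lt omega (app c (sc n)) (app c n))"
    using \<Phi> unfolding ads_functional_def c_def by simp
  moreover have "\<exists>n\<in>D N. \<not> lt (app c (sc n)) (app c n)"
    by (rule no_descent) (auto intro!: rep_app[of N] rep_const rep_id)
  ultimately have "Lt omega (app c zr) (app c (sc zr))" using Lt by fastforce
  then show ?thesis using Lt by (simp flip: c_def)
qed

text \<open>An ascending sequence grows numerically while its values are early, so a late value is
  reached by stage \<open>z\<close>. From then on all values are late and ascending means decreasing
  numerically, against \<open>no_descent\<close>.\<close>

lemma ads_ord_descending:
  assumes \<Phi>: "\<Phi> \<in> D ty11" "ads_functional \<Phi>" and f: "f \<in> D ty1" and z: "z \<in> D N" "app f z = zr"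
  shows "Lt (ord f) (app (app \<Phi> (ord f)) (sc zr)) (app (app \<Phi> (ord f)) zr)"
proof -
  define c where "c = app \<Phi> (ord f)"
  have c [simp]: "c \<in> D ty1" using \<Phi> f unfolding c_def by (intro app_in[of _ ty1]) simp_all
  have rep_c: "rep N g \<Longrightarrow> rep N (\<lambda>n. app c (g n))" for g by (intro rep_app[of N] rep_const[of c]) simp_all
  have "False" if asc: "\<forall>n\<in>D N. Lt (ord f) (app c n) (app c (sc n))"
  proof -
    have Q: "L f (app c n) \<or> le n (app c n)" if "n \<in> D N" for n
    proof (rule induction_qf[where P = "\<lambda>n. L f (app c n) \<or> le n (app c n)", OF that])
      show "qfp (\<lambda>n. L f (app c n) \<or> le n (app c n))" using f by (intro qf_intros rep_L rep_c)
    next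
      fix n assume n: "n \<in> D N" and IH: "L f (app c n) \<or> le n (app c n)"
      have Lt: "Lt (ord f) (app c n) (app c (sc n))" using asc n by blast
      show "L f (app c (sc n)) \<or> le (sc n) (app c (sc n))"
      proof (cases "L f (app c n) \<or> L f (app c (sc n))")
        case True
        then show ?thesis using Lt_ord_late[OF f _ _ Lt] n by auto
      next
        case False
        then have "lt (app c n) (app c (sc n))" using Lt_ord_early[OF f _ _ Lt] n by simp
        then show ?thesis using IH False n le_lt_trans[of n "app c n" "app c (sc n)"] by (simp add: lt_def)
      qed
    qed (simp)
    then have "L f (app c z)" using L_zero[OF f z] L_mono[OF f z(1), of "app c z"] z by auto
    have R: "L f (app c (pl z n))" if "n \<in> D N" for n
    proof (rule induction_qf[where P = "\<lambda>n. L f (app c (pl z n))", OF that])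
      show "qfp (\<lambda>n. L f (app c (pl z n)))" using f z by (intro rep_L rep_c qf_intros)
    next
      fix n assume "n \<in> D N" "L f (app c (pl z n))"
      then show "L f (app c (pl z (sc n)))" using Lt_ord_late[OF f _ _ bspec[OF asc, of "pl z n"]] z by simp
    qed (use z \<open>L f (app c z)\<close> in simp)
    have "\<exists>n\<in>D N. \<not> lt (app c (pl z (sc n))) (app c (pl z n))"
      using z by (intro no_descent[of "\<lambda>n. app c (pl z n)"] rep_c qf_intros) simp_all
    then show False using R Lt_ord_late[OF f _ _ bspec[OF asc, of "pl z _"]] z by simp
  qed
  moreover have "(\<forall>n\<in>D N. Lt (ord f) (app c n) (app c (sc n))) \<or> (\<forall>n\<in>D N. Lt (ord f) (app c (sc n)) (app c n))"
    using \<Phi> f LO_ord[OF f] unfolding ads_functional_def c_def by simp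
  ultimately have "\<forall>n\<in>D N. Lt (ord f) (app c (sc n)) (app c n)" by blast
  then show ?thesis using zr_in unfolding c_def by blast
qed

text \<open>A zero of \<open>f\<close> makes \<open>\<Phi> (ord f)\<close> descend where \<open>\<Phi> omega\<close> ascends.  So either \<open>\<Phi>\<close> distinguishes the two
  orders on the first two values and \<open>m\<close> separates them, or the second value itself is late.\<close>

lemma search_bound:
  assumes \<Phi>: "\<Phi> \<in> D ty11" "ads_functional \<Phi>" and f: "f \<in> D ty1" and z: "z \<in> D N" "app f z = zr"
    and m: "m \<in> D N"
    and sep: "L f m \<or> (app (app \<Phi> (ord f)) zr = app (app \<Phi> omega) zr \<and>
       app (app \<Phi> (ord f)) (sc zr) = app (app \<Phi> omega) (sc zr))"
  shows "L f (pl (app (app \<Phi> omega) (sc zr)) m)"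
proof -
  define a b where "a = app (app \<Phi> omega) zr" and "b = app (app \<Phi> omega) (sc zr)"
  have "app \<Phi> omega \<in> D ty1" using \<Phi> by (intro app_in[of _ ty1]) simp_all
  then have ab: "a \<in> D N" "b \<in> D N" by (simp_all add: a_def b_def)
  from sep consider "L f m" | "app (app \<Phi> (ord f)) zr = a" "app (app \<Phi> (ord f)) (sc zr) = b"
    unfolding a_def b_def by blast
  then have "L f (pl b m)"
  proof cases
    case 1
    then show ?thesis using L_mono[OF f m _ _ 1, of "pl b m"] le_pl[OF m ab(2)] pl_comm[OF m ab(2)] ab m by simp
  next
    case 2
    then have "Lt (ord f) b a" using ads_ord_descending[OF \<Phi> f z] by simp
    moreover have "lt a b" using ads_omega[OF \<Phi>] by (simp add: a_def b_def)
    \<comment> \<open>For an early \<open>b\<close>, preceding \<open>a\<close> in the order would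
      mean being numerically at most \<open>a\<close>, contrary to \<open>lt a b\<close>.\<close>
    ultimately have "L f b" using ab f not_le[of b a] by (auto simp: Lt_def Le_ord split: if_splits)
    then show ?thesis using L_mono[OF f ab(2) _ le_pl[OF ab(2) m]] ab m by simp
  qed
  then show ?thesis by (simp add: b_def)
qed

lemma mu_tm_correct:
  assumes e: "env_in D e" and ads: "ads_functional (e ty11 0)" and t: "well_typed t" "tyof t = N"
    and sep: "\<And>f. f \<in> D ty1 \<Longrightarrow> L f (vl (upd e ty1 0 f) t) \<or>
       (app (app (e ty11 0) (ord f)) zr = app (app (e ty11 0) omega) zr \<and>
        app (app (e ty11 0) (ord f)) (sc zr) = app (app (e ty11 0) omega) (sc zr))"
  shows "mu_functional (vl e (mu_tm t))"
  unfolding mu_functional_def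
proof (intro ballI impI)
  fix f assume f: "f \<in> D ty1" and "\<exists>n\<in>D N. app f n = zr"
  then obtain z where z: "z \<in> D N" "app f z = zr" by blast
  have \<Phi>: "e ty11 0 \<in> D ty11" using e by (simp add: env_in_def)
  have m: "vl (upd e ty1 0 f) t \<in> D N" using e f t by (intro val_N_in) simp_all
  have "app (vl e (mu_tm t)) f = app (srch f) (pl (app (app (e ty11 0) omega) (sc zr)) (vl (upd e ty1 0 f) t))"
    using e f t by (simp add: mu_tm_def val_abs val_search tm_one_def val_omega)
  then show "app f (app (vl e (mu_tm t)) f) = zr"
    using search_bound[OF \<Phi> ads f z m sep[OF f]] by (simp add: L_def)
qed

end

text \<open>\<open>Succ \<cdot> tm_one\<close> is 2: agreement is wanted on initial segments of
  length two, that is, for the values at 0 and 1.\<close>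

definition mu_ext_tm :: tm where
  "mu_ext_tm = abs ty11 0 (abs ext_ty 0 (mu_tm
     (Var ext_ty 0 \<cdot> (order_tm \<cdot> Var ty1 0) \<cdot> omega_tm \<cdot> (Succ \<cdot> tm_one))))"

lemma mu_ext_tm_simps [simp]: "tyof mu_ext_tm = ty11 \<Rrightarrow> ext_ty \<Rrightarrow> ty2" "well_typed mu_ext_tm" "fvs mu_ext_tm = {}"
  by (auto simp: mu_ext_tm_def)

text \<open>\<open>\<Phi>\<close> is \<open>Var ty11 0\<close>, \<open>f\<close> is \<open>Var ty1 0\<close>, and \<open>Var N 0\<close> is the number chosen for \<open>f\<close>.\<close>

definition separation :: fm where
  "separation = (order_tm \<cdot> Var ty1 0 \<cdot> Var N 0 \<^bold>= omega_tm \<cdot> Var N 0 \<^bold>\<longrightarrow>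
     Var ty11 0 \<cdot> (order_tm \<cdot> Var ty1 0) \<cdot> Zero \<^bold>= Var ty11 0 \<cdot> omega_tm \<cdot> Zero \<^bold>\<and>
     Var ty11 0 \<cdot> (order_tm \<cdot> Var ty1 0) \<cdot> tm_one \<^bold>= Var ty11 0 \<cdot> omega_tm \<cdot> tm_one)"

context rca_model
begin

lemma mu_ext_tm_correct:
  assumes \<Phi>: "\<Phi> \<in> D ty11" "ads_functional \<Phi>" and \<Xi>: "\<Xi> \<in> D ext_ty" "ext_bound \<Phi> \<Xi>"
  shows "mu_functional (app (app (vl env0 mu_ext_tm) \<Phi>) \<Xi>)"
proof -
  define t where "t = Var ext_ty 0 \<cdot> (order_tm \<cdot> Var ty1 0) \<cdot> omega_tm \<cdot> (Succ \<cdot> tm_one)"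
  define e where "e = upd (upd env0 ty11 0 \<Phi>) ext_ty 0 \<Xi>"
  have t [simp]: "tyof t = N" "well_typed t" by (simp_all add: t_def)
  have e [simp]: "env_in D e" "e ty11 0 = \<Phi>" "e ext_ty 0 = \<Xi>" using \<Phi> \<Xi> by (simp_all add: e_def)
  have "mu_functional (vl e (mu_tm t))"
  proof (rule mu_tm_correct)
    fix f assume f: "f \<in> D ty1"
    let ?m = "app (app (app \<Xi> (ord f)) omega) (sc (sc zr))"
    have val: "vl (upd e ty1 0 f) t = ?m"
      by (simp add: t_def tm_one_def val_order val_omega)
    have m: "?m \<in> D N"
      using \<Xi> f by (intro app_in[OF app_in[OF app_in[OF \<Xi>(1)]]]) simp_all
    \<comment> \<open>A difference between the orders below \<open>?m\<close> makes
      \<open>?m\<close> late; without one, \<open>ext_bound\<close> makes the values of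
      \<open>\<Phi>\<close> agree.\<close>
    have "L f ?m" if "k \<in> D N" "lt k ?m" "app (ord f) k \<noteq> app omega k" for k
      using ord_omega_differ[OF f that(1,3)] L_mono[OF f that(1) m] lt_imp_le[OF that(2,1) m] by simp
    then consider "L f ?m" | "\<forall>k\<in>D N. lt k ?m \<longrightarrow> app (ord f) k = app omega k" by blast
    then show "L f (vl (upd e ty1 0 f) t) \<or>
       (app (app (e ty11 0) (ord f)) zr = app (app (e ty11 0) omega) zr \<and>
        app (app (e ty11 0) (ord f)) (sc zr) = app (app (e ty11 0) omega) (sc zr))"
    proof cases
      case 2
      moreover have "sc (sc zr) \<in> D N" "ord f \<in> D ty1" "omega \<in> D ty1" using f by simp_all
      ultimately have "\<forall>k\<in>D N. lt k (sc (sc zr)) \<longrightarrow> app (app \<Phi> (ord f)) k = app (app \<Phi> omega) k"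
        using \<Xi>(2) unfolding ext_bound_def by blast
      then show ?thesis by (simp add: lt_def)
    qed (simp add: val)
  qed (use \<Phi> in simp_all)
  moreover have "app (app (vl env0 mu_ext_tm) \<Phi>) \<Xi> = vl e (mu_tm t)"
    using \<Phi> \<Xi> unfolding mu_ext_tm_def t_def[symmetric] by (simp add: val_abs e_def)
  ultimately show ?thesis by simp
qed

lemma mu_exists:
  assumes \<Phi>: "\<Phi> \<in> D ty11" "ads_functional \<Phi>"
  shows "\<exists>\<mu>\<in>D ty2. mu_functional \<mu>"
proof -
  define e where "e = upd env0 ty11 0 \<Phi>"
  have e [simp]: "env_in D e" "e ty11 0 = \<Phi>" using \<Phi> by (simp_all add: e_def)
  have sat: "sat D app con (cons_subst N n (cons_subst ty1 f e)) separation \<longleftrightarrow>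
      (app (ord f) n = app omega n \<longrightarrow>
       app (app \<Phi> (ord f)) zr = app (app \<Phi> omega) zr \<and>
       app (app \<Phi> (ord f)) (sc zr) = app (app \<Phi> omega) (sc zr))" for f n
    by (simp add: separation_def tm_one_def val_order val_omega)
  have "\<exists>F\<in>D ty2. \<forall>f\<in>D ty1. sat D app con (cons_subst N (app F f) (cons_subst ty1 f e)) separation"
  proof (rule choice_qf)
    fix f assume f: "f \<in> D ty1"
    show "\<exists>n\<in>D N. sat D app con (cons_subst N n (cons_subst ty1 f e)) separation"
      \<comment> \<open>If the two orders are equal, so are their images and any number serves, here
        zero; otherwise extensionality yields a point of difference.\<close>
      unfolding sat using extensional[of "ord f" N N omega] f zr_in ord_in omega_in by metis
  qed (simp_all add: separation_def has_type_iff)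
  then obtain F where F: "F \<in> D ty2" and
    sep: "\<And>f. f \<in> D ty1 \<Longrightarrow> app (ord f) (app F f) = app omega (app F f) \<longrightarrow>
       app (app \<Phi> (ord f)) zr = app (app \<Phi> omega) zr \<and>
       app (app \<Phi> (ord f)) (sc zr) = app (app \<Phi> omega) (sc zr)"
    unfolding sat by blast
  let ?e = "upd e ty2 0 F" and ?t = "Var ty2 0 \<cdot> Var ty1 0"
  have "mu_functional (vl ?e (mu_tm ?t))"
  proof (rule mu_tm_correct)
    fix f assume f: "f \<in> D ty1"
    have "app F f \<in> D N" using F f by (rule app_in)
    then show "L f (vl (upd ?e ty1 0 f) ?t) \<or>
       (app (app (?e ty11 0) (ord f)) zr = app (app (?e ty11 0) omega) zr \<and>
        app (app (?e ty11 0) (ord f)) (sc zr) = app (app (?e ty11 0) omega) (sc zr))"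
      using sep[OF f] ord_omega_differ[OF f, of "app F f"] by simp blast
  qed (use \<Phi> F in simp_all)
  moreover have "vl ?e (mu_tm ?t) \<in> D ty2" using F by (intro val_in) (simp_all add: has_type_iff)
  ultimately show ?thesis by blast
qed

end

subsection \<open>The equivalence\<close>

lemma wff_sentences [simp]: "wff UADS_matrix" "wff mu_matrix" "wff ext_functional"
  by (simp_all add: UADS_matrix_def mu_matrix_def ext_functional_def LO_inf_def Let_def less_in_def le_in_def
      in_field_def mem_def less_def same_initial_def shift_def has_type_iff)

lemma provable_ads_imp_mu: "provable RCA0w (Exists ty11 UADS_matrix \<^bold>\<longrightarrow> Exists ty2 mu_matrix)"
proof (rule completeness)
  fix D app and con :: "tm \<Rightarrow> tm set" and e
  assume "rca_model D app con" and e: "env_in D e"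
  then interpret rca_model D app con by simp
  show "sat D app con e (Exists ty11 UADS_matrix \<^bold>\<longrightarrow> Exists ty2 mu_matrix)"
    using e mu_exists by (auto simp: sat_UADS sat_mu env_in_cons)
qed simp

lemma provable_mu_imp_ads: "provable RCA0w (Exists ty2 mu_matrix \<^bold>\<longrightarrow> Exists ty11 UADS_matrix)"
proof (rule completeness)
  fix D app and con :: "tm \<Rightarrow> tm set" and e
  assume "rca_model D app con" and e: "env_in D e"
  then interpret rca_model D app con by simp
  have "app (vl env0 ads_tm) \<mu> \<in> D ty11" if "\<mu> \<in> D ty2" for \<mu>
    using that by (intro app_in[of _ ty2] val_in) (simp_all add: has_type_iff)
  then show "sat D app con e (Exists ty2 mu_matrix \<^bold>\<longrightarrow> Exists ty11 UADS_matrix)"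
    using e ads_tm_correct by (auto simp: sat_UADS sat_mu env_in_cons)
qed simp

lemma provable_ads_tm:
  "provable RCA0w (Forall ty2 (mu_matrix \<^bold>\<longrightarrow> subst (inst ty11 (ads_tm \<cdot> Var ty2 0)) UADS_matrix))"
proof (rule completeness)
  fix D app and con :: "tm \<Rightarrow> tm set" and e
  assume "rca_model D app con" and e: "env_in D e"
  then interpret rca_model D app con by simp
  have "sat D app con e' (subst (inst ty11 (ads_tm \<cdot> Var ty2 0)) UADS_matrix)"
    if "env_in D e'" "mu_functional (e' ty2 0)" for e'
  proof -
    let ?e = "\<lambda>\<sigma> i. vl e' (inst ty11 (ads_tm \<cdot> Var ty2 0) \<sigma> i)"
    have "wt_subst (inst ty11 (ads_tm \<cdot> Var ty2 0))" by (rule wt_inst) (simp add: has_type_iff)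
    then have "env_in D ?e" using that val_in unfolding env_in_def[of D ?e] wt_subst_def by blast
    moreover have "?e ty11 0 = app (vl env0 ads_tm) (e' ty2 0)" by (simp add: inst_def val_closed[of ads_tm e'])
    ultimately show ?thesis using that ads_tm_correct by (simp add: sat_subst sat_UADS env_in_def)
  qed
  then show "sat D app con e (Forall ty2 (mu_matrix \<^bold>\<longrightarrow> subst (inst ty11 (ads_tm \<cdot> Var ty2 0)) UADS_matrix))"
    using e by (simp add: sat_mu env_in_cons)
qed (simp add: wff_subst wt_inst has_type_iff)

lemma provable_mu_ext_tm:
  "provable RCA0w (Forall ty11 (Forall ext_ty (ext_functional \<^bold>\<longrightarrow> UADS_matrix \<^bold>\<longrightarrow>
     subst (inst ty2 (mu_ext_tm \<cdot> Var ty11 0 \<cdot> Var ext_ty 0)) mu_matrix)))"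
proof (rule completeness)
  let ?t = "mu_ext_tm \<cdot> Var ty11 0 \<cdot> Var ext_ty 0"
  fix D app and con :: "tm \<Rightarrow> tm set" and e
  assume "rca_model D app con" and e: "env_in D e"
  then interpret rca_model D app con by simp
  have "sat D app con e' (subst (inst ty2 ?t) mu_matrix)"
    if "env_in D e'" "ads_functional (e' ty11 0)" "ext_bound (e' ty11 0) (e' ext_ty 0)" for e'
  proof -
    let ?e = "\<lambda>\<sigma> i. vl e' (inst ty2 ?t \<sigma> i)"
    have "wt_subst (inst ty2 ?t)" by (rule wt_inst) (simp add: has_type_iff)
    then have "env_in D ?e" using that val_in unfolding env_in_def[of D ?e] wt_subst_def by blast
    moreover have "?e ty2 0 = app (app (vl env0 mu_ext_tm) (e' ty11 0)) (e' ext_ty 0)"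
      by (simp add: inst_def val_closed[of mu_ext_tm e'])
    ultimately show ?thesis using that mu_ext_tm_correct by (simp add: sat_subst sat_mu env_in_def)
  qed
  then show "sat D app con e (Forall ty11 (Forall ext_ty (ext_functional \<^bold>\<longrightarrow> UADS_matrix \<^bold>\<longrightarrow>
     subst (inst ty2 ?t) mu_matrix)))"
    using e by (simp add: sat_UADS sat_ext env_in_cons)
qed (simp add: wff_subst wt_inst has_type_iff)

lemma provable_conj: "provable T \<phi> \<Longrightarrow> provable T \<psi> \<Longrightarrow> provable T (\<phi> \<^bold>\<and> \<psi>)"
proof -
  assume \<phi>: "provable T \<phi>" and \<psi>: "provable T \<psi>"
  let ?\<chi> = "\<phi> \<^bold>\<longrightarrow> \<^bold>\<not> \<psi>"
  have w: "wff ?\<chi>" using derivable_wff[OF \<phi>] derivable_wff[OF \<psi>] by simp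
  have "derivable T {?\<chi>} ?\<chi>" using w by (intro derivable.Assume) simp_all
  then have "derivable T {?\<chi>} (\<^bold>\<not> \<psi>)" by (rule derivable.ImpE) (rule derivable_mono[OF \<phi>], simp)
  then have "derivable T {?\<chi>} Falsum" by (rule derivable.ImpE) (rule derivable_mono[OF \<psi>], simp)
  then show ?thesis by (rule derivable.ImpI[OF w])
qed

theorem theorem4p4:
  shows "explicit_equiv RCA0w ty11 UADS_matrix ty2 mu_matrix"
proof -
  have "closed_tm ads_tm" "has_type ads_tm (ty2 \<Rrightarrow> ty11)"
    and "closed_tm mu_ext_tm" "has_type mu_ext_tm (ty11 \<Rrightarrow> ext_ty \<Rrightarrow> ty2)"
    by (simp_all add: closed_tm_iff has_type_iff)
  \<comment> \<open>The implication from \<open>UADS\<close> meets the alternative of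
    \<open>explicit_imp\<close> with an extensionality functional, the converse the one
    without.\<close>
  then show ?thesis
    unfolding explicit_equiv_def explicit_imp_def
    using provable_conj[OF provable_ads_imp_mu provable_mu_imp_ads]
      provable_ads_imp_mu provable_mu_imp_ads provable_ads_tm provable_mu_ext_tm by blast
qed

end
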